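(* Let $\mathbf{S_{n,n}}=(S_{1,n},\dots,S_{n,n})^*$ be uniformly distributed on the complex moment space $\mathcal{M}_n(\mathbb{C})$. Then the corresponding symmetric canonical moments $U_{1,n},\dots,U_{n,n}$ are independent and, for $k=1,\dots,n$, $U_{k,n}\sim\mathrm{Beta}^{(2)}_p\big(p(n-k+1),p(n-k+1)\big)$.
   Context: $\mathcal{S}_p(\mathbb{C})$: complex hermitian $p\times p$ matrices, with Lebesgue measure $dX=\prod_{i}dx_{ii}\prod_{i<j}d\operatorname{Re}x_{ij}\,d\operatorname{Im}x_{ij}$; $A^*$ is the conjugate transpose. A complex matrix measure on $[0,1]$ is a $p\times p$ matrix of complex Borel measures with $\mu(B)$ hermitian nonnegative definite for every Borel $B$ and $\mu([0,1])=I_p$; moments $S_k=\int_0^1x^kd\mu$, $S_0=I_p$. $\mathcal{M}_n(\mathbb{C})\subset(\mathcal{S}_p(\mathbb{C}))^n$ is the set of moment vectors $(S_1,\dots,S_n)^*$ of such measures; the uniform distribution has density proportional to its indicator. With block Hankel matrices $\underline H_{2m}=(S_{i+j})_{i,j=0}^m$, $\overline H_{2m}=(S_{i+j+1}-S_{i+j+2})_{i,j=0}^{m-1}$, $\underline H_{2m+1}=(S_{i+j+1})_{i,j=0}^m$, $\overline H_{2m+1}=(S_{i+j}-S_{i+j+1})_{i,j=0}^m$ and block vectors $\underline h_{2m}=(S_{m+1},\dots,S_{2m})^T$, $\underline h_{2m-1}=(S_m,\dots,S_{2m-1})^T$, $\bar h_{2m}=(S_m-S_{m+1},\dots,S_{2m-1}-S_{2m})^T$,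 $\bar h_{2m-1}=(S_m-S_{m+1},\dots,S_{2m-2}-S_{2m-1})^T$, set $S_1^-=0_p$, $S_1^+=I_p$, $S_2^+=S_1$, $S^-_{n+1}=\underline h_n^*\underline H_{n-1}^{-1}\underline h_n$, $S^+_{n+1}=S_n-\bar h_n^*\overline H_{n-1}^{-1}\bar h_n$; the interior of $\mathcal{M}_n(\mathbb{C})$ is $\{S_k^-<S_k<S_k^+\ \forall k\}$ and there the canonical moments are $U_k=(S_k^+-S_k^-)^{-1/2}(S_k-S_k^-)(S_k^+-S_k^-)^{-1/2}$. $\mathrm{Beta}^{(2)}_p(a,b)$ ($a,b>p-1$) has density $B_p^{(2)}(a,b)^{-1}(\det X)^{a-p}\det(I_p-X)^{b-p}\mathbf{1}_{\{0_p<X<I_p\}}$ with $B^{(2)}_p(a,b)=\Gamma^{(2)}_p(a)\Gamma^{(2)}_p(b)/\Gamma^{(2)}_p(a+b)$, $\Gamma^{(2)}_p(a)=\pi^{p(p-1)/2}\prod_{i=1}^p\Gamma(a-i+1)$. *)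

theory Defs
  imports "HOL-Analysis.Analysis"
begin

definition cadj :: "complex^'p^'p \<Rightarrow> complex^'p^'p" where
  "cadj A = (\<chi> i j. cnj (A $ j $ i))"

definition hermitian :: "complex^'p^'p \<Rightarrow> bool" where
  "hermitian A \<longleftrightarrow> cadj A = A"

definition qform :: "complex^'p^'p \<Rightarrow> complex^'p \<Rightarrow> complex" where
  "qform A v = (\<Sum>i\<in>UNIV. \<Sum>j\<in>UNIV. cnj (v $ i) * A $ i $ j * v $ j)"

definition psd :: "complex^'p^'p \<Rightarrow> bool" where
  "psd A \<longleftrightarrow> hermitian A \<and> (\<forall>v. 0 \<le> Re (qform A v))"

definition pd :: "complex^'p^'p \<Rightarrow> bool" where
  "pd A \<longleftrightarrow> hermitian A \<and> (\<forall>v. v \<noteq> 0 \<longrightarrow> 0 < Re (qform A v))"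

definition loewner_less :: "complex^'p^'p \<Rightarrow> complex^'p^'p \<Rightarrow> bool" where
  "loewner_less A B \<longleftrightarrow> hermitian A \<and> hermitian B \<and> pd (B - A)"

definition msqrt :: "complex^'p^'p \<Rightarrow> complex^'p^'p" where
  "msqrt A = (THE R. psd R \<and> R ** R = A)"

definition herm_of :: "real^('p::{finite,linorder})^('p::{finite,linorder}) \<Rightarrow> complex^('p::{finite,linorder})^('p::{finite,linorder})" where
  "herm_of Y = (\<chi> i j. if i = j then complex_of_real (Y $ i $ i)
                      else if i < j then Complex (Y $ i $ j) (Y $ j $ i)
                      else Complex (Y $ j $ i) (- (Y $ i $ j)))"

definition lebH :: "(complex^('p::{finite,linorder})^('p::{finite,linorder})) measure" where
  "lebH = distr lborel borel herm_of"

definition matrix_measure :: "(real set \<Rightarrow> complex^'p^'p) \<Rightarrow> bool" where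
  "matrix_measure \<mu> \<longleftrightarrow>
     (\<forall>B \<in> sets borel. B \<subseteq> {0..1} \<longrightarrow> psd (\<mu> B)) \<and>
     \<mu> {0..1} = mat 1 \<and>
     (\<forall>A :: nat \<Rightarrow> real set. (\<forall>i. A i \<in> sets borel \<and> A i \<subseteq> {0..1}) \<longrightarrow> disjoint_family A \<longrightarrow>
        (\<lambda>i. \<mu> (A i)) sums \<mu> (\<Union>i. A i))"

text \<open>Riemann--Stieltjes sums for the integral of x^k over [0,1]; the cells
  [j/N,(j+1)/N), j<N, together with {1} partition [0,1].\<close>
definition mm_rsum :: "(real set \<Rightarrow> complex^'p^'p) \<Rightarrow> nat \<Rightarrow> nat \<Rightarrow> complex^'p^'p" where
  "mm_rsum \<mu> k N = (\<Sum>j<N. (real j / real N) ^ k *\<^sub>R \<mu> {real j / real N ..< real (Suc j) / real N})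
                     + \<mu> {1}"

definition mm_moment :: "(real set \<Rightarrow> complex^'p^'p) \<Rightarrow> nat \<Rightarrow> complex^'p^'p" where
  "mm_moment \<mu> k = lim (mm_rsum \<mu> k)"

definition moment_space :: "nat \<Rightarrow> (nat \<Rightarrow> complex^'p^'p) set" where
  "moment_space n = {S \<in> PiE {1..n} (\<lambda>_. UNIV).
      \<exists>\<mu>. matrix_measure \<mu> \<and> (\<forall>k\<in>{1..n}. S k = mm_moment \<mu> k)}"

definition blockmult :: "nat \<Rightarrow> (nat \<Rightarrow> nat \<Rightarrow> complex^'p^'p) \<Rightarrow> (nat \<Rightarrow> nat \<Rightarrow> complex^'p^'p)
    \<Rightarrow> nat \<Rightarrow> nat \<Rightarrow> complex^'p^'p" where
  "blockmult m A B i j = (\<Sum>l<m. A i l ** B l j)"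

definition blockinv :: "nat \<Rightarrow> (nat \<Rightarrow> nat \<Rightarrow> complex^'p^'p) \<Rightarrow> nat \<Rightarrow> nat \<Rightarrow> complex^'p^'p" where
  "blockinv m A = (THE B. (\<forall>i j. (m \<le> i \<or> m \<le> j) \<longrightarrow> B i j = 0) \<and>
      (\<forall>i<m. \<forall>j<m. blockmult m A B i j = (if i = j then mat 1 else 0)
                  \<and> blockmult m B A i j = (if i = j then mat 1 else 0)))"

definition Sx :: "(nat \<Rightarrow> complex^'p^'p) \<Rightarrow> nat \<Rightarrow> complex^'p^'p" where
  "Sx S k = (if k = 0 then mat 1 else S k)"

text \<open>underline H_j: block size j div 2 + 1, entries S_{i+l} (j even) / S_{i+l+1} (j odd)\<close>
definition Hlow :: "(nat \<Rightarrow> complex^'p^'p) \<Rightarrow> nat \<Rightarrow> nat \<Rightarrow> nat \<Rightarrow> complex^'p^'p" where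
  "Hlow S j i l = Sx S (i + l + j mod 2)"

text \<open>overline H_j: block size (j+1) div 2, entries S_{i+l+1}-S_{i+l+2} (j even) /
  S_{i+l}-S_{i+l+1} (j odd)\<close>
definition Hup :: "(nat \<Rightarrow> complex^'p^'p) \<Rightarrow> nat \<Rightarrow> nat \<Rightarrow> nat \<Rightarrow> complex^'p^'p" where
  "Hup S j i l = Sx S (i + l + (1 - j mod 2)) - Sx S (i + l + (1 - j mod 2) + 1)"

text \<open>underline h_j: length (j+1) div 2, entries S_{j div 2 + 1 + i}\<close>
definition hlow :: "(nat \<Rightarrow> complex^'p^'p) \<Rightarrow> nat \<Rightarrow> nat \<Rightarrow> complex^'p^'p" where
  "hlow S j i = Sx S (j div 2 + 1 + i)"

text \<open>bar h_j: length j div 2, entries S_{s+i} - S_{s+i+1} with s = (j+1) div 2\<close>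
definition hup :: "(nat \<Rightarrow> complex^'p^'p) \<Rightarrow> nat \<Rightarrow> nat \<Rightarrow> complex^'p^'p" where
  "hup S j i = Sx S ((j + 1) div 2 + i) - Sx S ((j + 1) div 2 + i + 1)"

definition Sminus :: "(nat \<Rightarrow> complex^'p^'p) \<Rightarrow> nat \<Rightarrow> complex^'p^'p" where
  "Sminus S k = (if k \<le> 1 then 0 else
     (let j = k - 1; m = (j + 1) div 2; Hi = blockinv m (Hlow S (j - 1)) in
      \<Sum>r<m. \<Sum>s<m. cadj (hlow S j r) ** Hi r s ** hlow S j s))"

definition Splus :: "(nat \<Rightarrow> complex^'p^'p) \<Rightarrow> nat \<Rightarrow> complex^'p^'p" where
  "Splus S k = (if k \<le> 1 then mat 1 else
     (let j = k - 1; m = j div 2; Hi = blockinv m (Hup S (j - 1)) in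
      S j - (\<Sum>r<m. \<Sum>s<m. cadj (hup S j r) ** Hi r s ** hup S j s)))"

definition canon_moment :: "(nat \<Rightarrow> complex^'p^'p) \<Rightarrow> nat \<Rightarrow> complex^'p^'p" where
  "canon_moment S k =
     (let D = matrix_inv (msqrt (Splus S k - Sminus S k)) in D ** (S k - Sminus S k) ** D)"

definition mGamma2 :: "nat \<Rightarrow> real \<Rightarrow> real" where
  "mGamma2 p a = pi powr (real (p * (p - 1)) / 2) * (\<Prod>i=1..p. Gamma (a - real i + 1))"

definition mBeta2 :: "nat \<Rightarrow> real \<Rightarrow> real \<Rightarrow> real" where
  "mBeta2 p a b = mGamma2 p a * mGamma2 p b / mGamma2 p (a + b)"

definition beta2 :: "real \<Rightarrow> real \<Rightarrow> (complex^('p::{finite,linorder})^('p::{finite,linorder})) measure" where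
  "beta2 a b = density lebH (\<lambda>X. ennreal
     (if loewner_less 0 X \<and> loewner_less X (mat 1)
      then Re (det X) powr (a - real CARD('p)) * Re (det (mat 1 - X)) powr (b - real CARD('p))
           / mBeta2 CARD('p) a b
      else 0))"

end

(* The moments S_1, ..., S_n are mapped to the canonical moments U_1, ..., U_n one coordinate at a
   time. With L_k = S_k - S_k^-, R_k = S_k^+ - S_k and D_k = L_k + R_k, the map S_k -> U_k is, for
   fixed S_1, ..., S_{k-1}, a translation followed by the congruence with D_k^{-1/2}, whose Jacobian
   on hermitian matrices is det(D_k)^{-p}. Schur complements of the Hankel matrices give the identity
   D_{k+1}^{-1} = L_k^{-1} + R_k^{-1}, hence det D_{k+1} = det(D_k) det(U_k) det(1 - U_k), so that the
   total Jacobian is the product of the (det(U_k) det(1 - U_k))^{p(n-k)}: these are independent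
   matrix Beta densities.

   A point with S_k^- < S_k < S_k^+ for all k lies in the moment space because the corresponding
   Hankel forms are positive, which makes the sequence completely monotone, and Bernstein weights
   then give atomic measures whose moments converge to it. Conversely moments satisfy the weak inequalities,
   and the boundary of the cone of positive matrices is negligible. The Jacobian of a congruence is
   a multiplicative function of the matrix, so it is enough to compute it on diagonal matrices. *)

theory Submission
  imports Defs "HOL-Probability.Probability" "HOL-Real_Asymp.Real_Asymp"
begin

text \<open>Eigenvalues never enter: square roots come from a connectedness argument, and one
  elimination by shears yields determinants, Jacobians and the Gamma integral. Two independent Gamma
  matrices, with their sum as new variable, then give the Beta integral and so all normalising
  constants.

  The identity for the ranges relates Hankel matrices of different sizes. To treat it as ring
  algebra, blocks of every size are cut by idempotents out of one ring.

  Complete monotonicity needs a continuation of the finite sequence to all orders. For odd n the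
  Hankel matrices H of S_(i+j) and K of S_(i+j+1) have equal size; H^(-1) K is self-adjoint for the
  form of H, lies between 0 and 1 and acts as multiplication by x, so its powers continue the
  sequence. An even n is first prolonged by the midpoint of the next range.

  Limits of measures are avoided: by Caratheodory's argument boundedly many atoms suffice, so the
  atomic moment vectors form a compact set. Its closedness also makes the moment space Borel.

  Canonical moments are needed as Borel functions on the whole product space, including points where
  a root or an inverse is missing.\<close>

type_synonym 'p cmat = "((complex, 'p) vec, 'p) vec"
type_synonym 'p rmat = "((real, 'p) vec, 'p) vec"

subsection \<open>Hermitian and positive matrices\<close>

definition cdot :: "complex^'p \<Rightarrow> complex^'p \<Rightarrow> complex" where
  "cdot u v = (\<Sum>i\<in>UNIV. cnj (u $ i) * v $ i)"

lemma cdot_add_left: "cdot (u + v) w = cdot u w + cdot v w"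
  and cdot_add_right: "cdot w (u + v) = cdot w u + cdot w v"
  and cdot_diff_left: "cdot (u - v) w = cdot u w - cdot v w"
  and cdot_diff_right: "cdot w (u - v) = cdot w u - cdot w v"
  and cdot_zero_left [simp]: "cdot 0 w = 0"
  and cdot_zero_right [simp]: "cdot w 0 = 0"
  by (simp_all add: cdot_def algebra_simps sum.distrib sum_subtractf)

lemma cdot_scale_right: "cdot u (c *s v) = c * cdot u v"
  and cdot_scale_left: "cdot (c *s u) v = cnj c * cdot u v"
  by (simp_all add: cdot_def sum_distrib_left mult_ac)

lemma cdot_cnj: "cnj (cdot u v) = cdot v u"
  by (simp add: cdot_def mult.commute)

lemma cdot_self: "cdot u u = of_real ((norm u)\<^sup>2)"
proof -
  have "cdot u u = (\<Sum>i\<in>UNIV. of_real ((norm (u $ i))\<^sup>2))"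
    unfolding cdot_def by (intro sum.cong refl) (metis complex_norm_square mult.commute)
  also have "\<dots> = of_real (\<Sum>i\<in>UNIV. (norm (u $ i))\<^sup>2)" by simp
  also have "(\<Sum>i\<in>UNIV. (norm (u $ i))\<^sup>2) = (norm u)\<^sup>2"
    by (simp add: norm_vec_def L2_set_def sum_nonneg)
  finally show ?thesis .
qed

lemma qform_cdot: "qform A v = cdot v (A *v v)"
  by (simp add: qform_def cdot_def matrix_vector_mult_def sum_distrib_left mult_ac)

lemma cdot_cadj: "cdot (cadj A *v u) v = cdot u (A *v v)"
  by (simp add: cdot_def cadj_def matrix_vector_mult_def sum_distrib_left sum_distrib_right)
     (subst sum.swap, simp add: mult_ac)

lemma cadj_nth: "cadj A $ i $ j = cnj (A $ j $ i)"
  by (simp add: cadj_def)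

lemma cadj_cadj [simp]: "cadj (cadj A) = A"
  and cadj_add: "cadj (A + B) = cadj A + cadj B"
  and cadj_diff: "cadj (A - B) = cadj A - cadj B"
  and cadj_zero [simp]: "cadj 0 = 0"
  and cadj_mat_1 [simp]: "cadj (mat 1) = mat 1"
  and cadj_scaleR: "cadj (c *\<^sub>R A) = c *\<^sub>R cadj A"
  and cadj_mult: "cadj (A ** B) = cadj B ** cadj A"
  for A B :: "complex^'p^'p"
  by (simp_all add: cadj_def vec_eq_iff mat_def matrix_matrix_mult_def mult.commute)

lemma cadj_sum: "cadj (sum f I) = (\<Sum>i\<in>I. cadj (f i))"
  by (induction I rule: infinite_finite_induct) (simp_all add: cadj_add)

lemma matrix_mult_diff_left: "A ** (B - C) = A ** B - A ** C"
  and matrix_mult_diff_right: "(B - C) ** A = B ** A - C ** A"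
  and matrix_mult_add_right: "(B + C) ** A = B ** A + C ** A"
  and matrix_mult_minus_left: "(- B) ** A = - (B ** A)"
  and matrix_mult_minus_right: "B ** (- A) = - (B ** A)"
  and matrix_mult_zero_left [simp]: "0 ** A = 0"
  and matrix_mult_zero_right [simp]: "A ** 0 = 0"
  for A B C :: "complex^'p^'p"
  by (simp_all add: matrix_matrix_mult_def vec_eq_iff algebra_simps sum.distrib sum_subtractf sum_negf)

lemma matrix_mult_scaleR_left: "(c *\<^sub>R A) ** B = c *\<^sub>R (A ** B)"
  and matrix_mult_scaleR_right: "A ** (c *\<^sub>R B) = c *\<^sub>R (A ** B)"
  for A B :: "complex^'p^'p"
  by (simp_all add: matrix_matrix_mult_def vec_eq_iff scaleR_sum_right)

lemma matrix_mult_sum_left: "sum f I ** A = (\<Sum>i\<in>I. f i ** A)"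
  and matrix_mult_sum_right: "A ** sum f I = (\<Sum>i\<in>I. A ** f i)"
  for A :: "complex^'p^'p"
  by (induction I rule: infinite_finite_induct)
     (simp_all add: matrix_add_ldistrib matrix_mult_add_right)

lemmas matrix_ring_simps = matrix_add_ldistrib matrix_mult_add_right matrix_mult_diff_left
  matrix_mult_diff_right matrix_mult_minus_left matrix_mult_minus_right matrix_mul_assoc

lemma hermitian_add: "hermitian A \<Longrightarrow> hermitian B \<Longrightarrow> hermitian (A + B)"
  and hermitian_diff: "hermitian A \<Longrightarrow> hermitian B \<Longrightarrow> hermitian (A - B)"
  and hermitian_zero [simp]: "hermitian 0"
  and hermitian_mat_1 [simp]: "hermitian (mat 1)"
  and hermitian_scaleR: "hermitian A \<Longrightarrow> hermitian (c *\<^sub>R A)"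
  and hermitian_congr: "hermitian A \<Longrightarrow> hermitian (C ** A ** cadj C)"
  by (simp_all add: hermitian_def cadj_add cadj_diff cadj_scaleR cadj_mult matrix_mul_assoc)

lemma cdot_hermitian: "hermitian A \<Longrightarrow> cdot (A *v u) v = cdot u (A *v v)"
  using cdot_cadj[of A u v] by (simp add: hermitian_def)

lemma qform_hermitian_real: "hermitian A \<Longrightarrow> qform A v = of_real (Re (qform A v))"
proof -
  assume h: "hermitian A"
  have "cnj (qform A v) = qform A v"
    by (simp add: qform_cdot cdot_cnj cdot_hermitian[OF h])
  then show ?thesis by (metis complex_eq_iff complex_cnj_cancel_iff Reals_cnj_iff of_real_Re)
qed

lemma qform_add: "qform (A + B) v = qform A v + qform B v"
  and qform_diff: "qform (A - B) v = qform A v - qform B v"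
  and qform_zero [simp]: "qform 0 v = 0"
  and qform_zero_vec [simp]: "qform A 0 = 0"
  and qform_scaleR: "qform (c *\<^sub>R A) v = of_real c * qform A v"
  by (simp_all add: qform_def algebra_simps sum.distrib sum_subtractf sum_distrib_left scaleR_conv_of_real[where 'a=complex])

lemma qform_mat_1: "qform (mat 1) v = of_real ((norm v)\<^sup>2)"
  by (simp add: qform_cdot cdot_self)

lemma qform_congr: "qform (C ** A ** cadj C) v = qform A (cadj C *v v)"
  unfolding qform_cdot using cdot_cadj[of "cadj C" v]
  by (simp add: matrix_vector_mul_assoc[symmetric] cdot_cadj)

lemma psdD: "psd A \<Longrightarrow> hermitian A" "psd A \<Longrightarrow> 0 \<le> Re (qform A v)"
  and pdD: "pd A \<Longrightarrow> hermitian A" "pd A \<Longrightarrow> v \<noteq> 0 \<Longrightarrow> 0 < Re (qform A v)"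
  by (simp_all add: psd_def pd_def)

lemma pd_imp_psd: "pd A \<Longrightarrow> psd A"
  by (metis order.refl order.strict_implies_order pd_def psd_def qform_zero_vec zero_complex.simps(1))

lemma psd_add: "psd A \<Longrightarrow> psd B \<Longrightarrow> psd (A + B)"
  and psd_zero [simp]: "psd 0"
  and psd_mat_1 [simp]: "psd (mat 1)"
  and psd_scaleR: "psd A \<Longrightarrow> 0 \<le> c \<Longrightarrow> psd (c *\<^sub>R A)"
  and psd_congr: "psd A \<Longrightarrow> psd (C ** A ** cadj C)"
  by (simp_all add: psd_def hermitian_add hermitian_scaleR hermitian_congr qform_add qform_scaleR
      qform_congr qform_mat_1 del: of_real_power)

lemma psd_sum: "(\<And>i. i \<in> I \<Longrightarrow> psd (f i)) \<Longrightarrow> psd (sum f I)"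
  by (induction I rule: infinite_finite_induct) (simp_all add: psd_add)

lemma pd_mat_1 [simp]: "pd (mat 1)"
  by (simp add: pd_def qform_mat_1 del: of_real_power)

lemma pd_add_psd: "pd A \<Longrightarrow> psd B \<Longrightarrow> pd (A + B)"
  by (simp add: pd_def psd_def hermitian_add qform_add add_pos_nonneg)

lemma pd_scaleR: "pd A \<Longrightarrow> 0 < c \<Longrightarrow> pd (c *\<^sub>R A)"
  by (simp add: pd_def hermitian_scaleR qform_scaleR)

text \<open>A definite form has trivial kernel. The inverse \<open>B\<close> equals
  \<open>B ** A ** cadj B\<close>, hence is congruent to \<open>A\<close> and definite as
  well.\<close>

lemma pd_imp_inverse:
  assumes "pd A"
  obtains B where "A ** B = mat 1" "B ** A = mat 1" "pd B"
proof -
  have "A *v x = 0 \<longrightarrow> x = 0" for x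
    using pdD(2)[OF assms, of x] by (cases "x = 0") (auto simp: qform_cdot)
  then obtain B where B: "B ** A = mat 1"
    using matrix_left_invertible_ker[of A] by blast
  then have AB: "A ** B = mat 1"
    by (simp add: matrix_left_right_inverse)
  have hB: "hermitian B"
  proof -
    have "cadj B = cadj B ** (A ** B)" by (simp add: AB)
    also have "\<dots> = cadj (A ** B) ** B"
      using pdD(1)[OF assms] by (simp add: cadj_mult hermitian_def matrix_mul_assoc)
    finally show ?thesis by (simp add: AB hermitian_def)
  qed
  have "B = B ** A ** cadj B"
    using hB by (simp add: B hermitian_def)
  then have q: "qform B v = qform A (B *v v)" for v
    using qform_congr[of B A v] hB by (simp add: hermitian_def)
  have "B *v v \<noteq> 0" if "v \<noteq> 0" for v
    using that AB by (metis matrix_vector_mul_assoc matrix_vector_mul_lid matrix_vector_mult_0_right)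
  then have "pd B"
    using pdD(2)[OF assms] hB by (simp add: pd_def q)
  with AB B that show ?thesis by blast
qed

text \<open>For square matrices the one-sided inverse \<open>D\<close> makes \<open>cadj C\<close>
  injective, so the form is tested at nonzero vectors only.\<close>

lemma pd_congr:
  assumes "pd A" "D ** C = mat 1"
  shows "pd (C ** A ** cadj C)"
proof -
  have "cadj C ** cadj D = mat 1"
    using assms(2) by (metis cadj_mat_1 cadj_mult)
  then have "cadj D ** cadj C = mat 1"
    by (simp add: matrix_left_right_inverse)
  then have "cadj C *v v \<noteq> 0" if "v \<noteq> 0" for v
    using that by (metis matrix_vector_mul_assoc matrix_vector_mul_lid matrix_vector_mult_0_right)
  then show ?thesis
    using assms(1) by (simp add: pd_def hermitian_congr qform_congr)
qed

lemma pd_congr_iff: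
  assumes "D ** C = mat 1"
  shows "pd (C ** A ** cadj C) \<longleftrightarrow> pd A"
proof
  assume "pd (C ** A ** cadj C)"
  have CD: "C ** D = mat 1" using assms by (simp add: matrix_left_right_inverse)
  then have 2: "cadj C ** cadj D = mat 1" using assms by (metis cadj_mat_1 cadj_mult)
  have "D ** (C ** A ** cadj C) ** cadj D = (D ** C) ** A ** (cadj C ** cadj D)"
    by (simp add: matrix_mul_assoc)
  also have "\<dots> = A" by (simp add: assms 2)
  finally show "pd A" using pd_congr[OF \<open>pd (C ** A ** cadj C)\<close> CD] by simp
qed (rule pd_congr[OF _ assms])

text \<open>Testing a positive form on \<open>e\<^sub>i + c e\<^sub>j\<close> with a phase \<open>c\<close> bounds the entries by the trace.\<close>

lemma psd_entry_le:
  assumes "psd A"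
  shows "0 \<le> Re (A $ i $ i)" "2 * norm (A $ i $ j) \<le> Re (A $ i $ i) + Re (A $ j $ j)"
proof -
  have q: "qform A (axis i 1 + c *s axis j 1) =
      A $ i $ i + c * A $ i $ j + cnj c * A $ j $ i + cnj c * c * A $ j $ j" for c i j
  proof -
    have a: "(A *v axis k 1) $ l = A $ l $ k" for k l
      by (simp add: matrix_vector_mult_def axis_def if_distrib[of "\<lambda>x. _ * x"] cong: if_cong)
    have b: "cdot (axis k 1) x = x $ k" for k and x :: "complex^'b"
      by (simp add: cdot_def axis_def if_distrib[of cnj] if_distrib[of "\<lambda>x. x * _"] cong: if_cong)
    show ?thesis
      by (simp add: qform_cdot cdot_add_left cdot_add_right cdot_scale_left cdot_scale_right
          matrix_vector_right_distrib vector_scalar_commute a b algebra_simps)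
  qed
  show "0 \<le> Re (A $ i $ i)"
    using psdD(2)[OF assms, of "axis i 1 + 0 *s axis i 1"] unfolding q by simp
  show "2 * norm (A $ i $ j) \<le> Re (A $ i $ i) + Re (A $ j $ j)"
  proof (cases "A $ i $ j = 0")
    case True
    have "0 \<le> Re (A $ k $ k)" for k
      using psdD(2)[OF assms, of "axis k 1 + 0 *s axis k 1"] unfolding q by simp
    then show ?thesis using True by simp
  next
    case False
    \<comment> \<open>With this phase both off-diagonal terms of \<open>q\<close> equal
      \<open>- norm a\<close>.\<close>
    define a c where "a = A $ i $ j" and "c = - cnj a / norm a"
    have ji: "A $ j $ i = cnj a"
      using psdD(1)[OF assms] by (metis a_def cadj_nth hermitian_def)
    have ca: "c * a = - norm a" and cc: "cnj c * c = 1"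
      using False complex_norm_square[of a]
      by (simp_all add: c_def a_def[symmetric] power2_eq_square mult_ac field_simps)
    have "cnj c * cnj a = - norm a"
      using ca by (metis complex_cnj_complex_of_real complex_cnj_minus complex_cnj_mult)
    then have "qform A (axis i 1 + c *s axis j 1) = A $ i $ i - 2 * norm a + A $ j $ j"
      unfolding q ji using ca cc by (simp add: a_def)
    then show ?thesis
      using psdD(2)[OF assms, of "axis i 1 + c *s axis j 1"] by (simp add: a_def)
  qed
qed

section \<open>The trace as a bound on positive matrices\<close>

definition tr :: "complex^'p^'p \<Rightarrow> real" where "tr A = (\<Sum>i\<in>UNIV. Re (A $ i $ i))"

lemma tr_add: "tr (A + B) = tr A + tr B"
  and tr_diff: "tr (A - B) = tr A - tr B"
  and tr_zero [simp]: "tr 0 = 0"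
  and tr_mat_1: "tr (mat 1 :: complex^'p^'p) = real CARD('p)"
  by (simp_all add: tr_def sum.distrib sum_subtractf sum_distrib_left mat_def)

lemma tr_sum: "tr (sum f I) = (\<Sum>i\<in>I. tr (f i))"
  by (induction I rule: infinite_finite_induct) (simp_all add: tr_add)

lemma tr_commute: "tr (A ** B) = tr (B ** A)"
  by (simp add: tr_def matrix_matrix_mult_def Re_sum[symmetric] del: Re_sum)
     (subst sum.swap, simp add: mult.commute)

text \<open>Each of the p^2 entries of a positive matrix is at most its trace. Since the trace is
  additive, the total mass of a family of positive matrices controls the sum of their norms.\<close>

lemma norm_le_tr:
  fixes A :: "complex^'p^'p"
  assumes "psd A"
  shows "norm A \<le> (real CARD('p))\<^sup>2 * tr A"
proof -
  have "norm (A $ i $ j) \<le> tr A" for i j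
  proof -
    have "Re (A $ i $ i) \<le> tr A" "Re (A $ j $ j) \<le> tr A"
      unfolding tr_def using psd_entry_le(1)[OF assms] by (auto intro: member_le_sum)
    then show ?thesis using psd_entry_le(2)[OF assms, of i j] by simp
  qed
  note e = this
  have "norm A \<le> (\<Sum>i\<in>UNIV. norm (A $ i))" by (simp add: norm_vec_def L2_set_le_sum)
  also have "\<dots> \<le> (\<Sum>i\<in>UNIV. \<Sum>j\<in>UNIV. norm (A $ i $ j))"
    by (intro sum_mono) (simp add: norm_vec_def L2_set_le_sum)
  also have "\<dots> \<le> (\<Sum>(i::'p)\<in>UNIV. \<Sum>(j::'p)\<in>UNIV. tr A)"
    by (intro sum_mono e)
  finally show ?thesis by (simp add: power2_eq_square)
qed

lemma psd_tr_nonneg: "psd A \<Longrightarrow> 0 \<le> tr A"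
  by (simp add: tr_def psd_entry_le(1) sum_nonneg)

lemma psd_tr_zero: "psd A \<Longrightarrow> tr A = 0 \<Longrightarrow> A = 0"
  using norm_le_tr[of A] by simp

text \<open>The nested Euclidean norm on matrices is the Frobenius norm.\<close>

lemma tr_cadj_mult_self: "tr (cadj A ** A) = (norm A)\<^sup>2"
proof -
  have "(norm A)\<^sup>2 = (\<Sum>i\<in>UNIV. \<Sum>j\<in>UNIV. (norm (A $ i $ j))\<^sup>2)"
    by (simp add: norm_vec_def L2_set_def sum_nonneg)
  also have "\<dots> = (\<Sum>j\<in>UNIV. \<Sum>i\<in>UNIV. (norm (A $ i $ j))\<^sup>2)" by (rule sum.swap)
  also have "\<dots> = tr (cadj A ** A)"
    by (simp add: tr_def matrix_matrix_mult_def cadj_nth cmod_power2) (simp add: power2_eq_square)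
  finally show ?thesis ..
qed

text \<open>If the form vanished at \<open>v\<close>, a small step from \<open>v\<close> in the
  direction \<open>- (A *v v)\<close> would make it negative, because the linear term dominates.
  Invertibility keeps \<open>A *v v\<close> nonzero.\<close>

lemma pd_psd_det: "psd A \<Longrightarrow> det A \<noteq> 0 \<Longrightarrow> pd A"
proof -
  assume A: "psd A" and d: "det A \<noteq> 0"
  then obtain B where B: "B ** A = mat 1"
    using invertible_det_nz[of A] invertible_def by blast
  have "Re (qform A v) \<noteq> 0" if "v \<noteq> 0" for v
  proof
    assume z: "Re (qform A v) = 0"
    define w where "w = A *v v"
    have "w \<noteq> 0" using that B w_def
      by (metis matrix_vector_mul_assoc matrix_vector_mul_lid matrix_vector_mult_0_right)
    have ex: "Re (qform A (v + of_real (- t) *s w)) = - 2 * t * (norm w)\<^sup>2 + t\<^sup>2 * Re (qform A w)" for t :: real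
    proof -
      have "cdot w (A *v v) = of_real ((norm w)\<^sup>2)" "cdot v (A *v w) = of_real ((norm w)\<^sup>2)"
        using cdot_hermitian[OF psdD(1)[OF A], of v w] by (simp_all add: w_def[symmetric] cdot_self)
      then show ?thesis using z
        by (simp add: qform_cdot cdot_add_left cdot_add_right cdot_scale_left cdot_scale_right
          matrix_vector_right_distrib matrix_vector_mult_diff_distrib cdot_diff_left cdot_diff_right vector_scalar_commute w_def[symmetric] power2_eq_square algebra_simps)
    qed
    \<comment> \<open>Chosen so that \<open>t * Re (qform A w)\<close> is at most the square of
      \<open>norm w\<close>; the quadratic term then costs at most half of the linear one. The
      summand 1 admits a vanishing form at \<open>w\<close>.\<close>
    define t where "t = (norm w)\<^sup>2 / (Re (qform A w) + 1)"
    have q: "0 \<le> Re (qform A w)" by (rule psdD(2)[OF A])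
    have t: "t > 0" using \<open>w \<noteq> 0\<close> q by (simp add: t_def)
    have "t * Re (qform A w) \<le> (norm w)\<^sup>2" using q by (simp add: t_def field_simps)
    then have "t\<^sup>2 * Re (qform A w) \<le> t * (norm w)\<^sup>2" using t by (simp add: power2_eq_square)
    moreover have "t * (norm w)\<^sup>2 > 0" using t \<open>w \<noteq> 0\<close> by simp
    ultimately have "Re (qform A (v + of_real (- t) *s w)) < 0" unfolding ex by linarith
    then show False using psdD(2)[OF A] by (meson not_less)
  qed
  then show ?thesis using A by (auto simp: pd_def psd_def order.strict_iff_order)
qed

lemma pd_det_nz: "pd A \<Longrightarrow> det A \<noteq> 0"
  by (metis pd_imp_inverse invertible_det_nz invertible_def)

subsection \<open>Square roots\<close>

text \<open>For \<open>D = R - Q\<close> equal squares give \<open>D ** R + Q ** D = 0\<close>.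
  Multiplying by \<open>D\<close> and taking traces shows that the positive matrices
  \<open>D ** R ** D\<close> and \<open>D ** Q ** D\<close> vanish; their difference is the cube of
  the hermitian matrix \<open>D\<close>.\<close>

lemma psd_sqrt_unique:
  assumes R: "psd R" and Q: "psd Q" and eq: "R ** R = Q ** Q"
  shows "R = Q"
proof -
  define D where "D = R - Q"
  have hD: "cadj D = D" using psdD(1)[OF R] psdD(1)[OF Q]
    by (simp add: D_def cadj_diff hermitian_def)
  have "D ** R + Q ** D = 0" by (simp add: D_def matrix_ring_simps eq)
  then have "tr ((D ** R + Q ** D) ** D) = 0" by simp
  then have "tr (D ** R ** D) + tr (Q ** D ** D) = 0"
    by (simp add: tr_add matrix_ring_simps)
  moreover have "tr (Q ** D ** D) = tr (D ** Q ** D)"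
    by (metis tr_commute matrix_mul_assoc)
  moreover have pR: "psd (D ** R ** D)" "psd (D ** Q ** D)"
    using psd_congr[OF R, of D] psd_congr[OF Q, of D] by (simp_all add: hD)
  ultimately have "D ** R ** D = 0" "D ** Q ** D = 0"
    using psd_tr_nonneg[OF pR(1)] psd_tr_nonneg[OF pR(2)] by (auto intro!: psd_tr_zero)
  then have "D ** D ** D = 0"
    by (simp add: D_def matrix_ring_simps)
  then have "tr ((cadj (D ** D)) ** (D ** D)) = 0"
    by (simp add: cadj_mult hD matrix_mul_assoc)
  then have "D ** D = 0" by (simp add: tr_cadj_mult_self)
  then have "tr (cadj D ** D) = 0" by (simp add: hD)
  then have "D = 0" by (simp add: tr_cadj_mult_self)
  then show ?thesis by (simp add: D_def)
qed

section \<open>Real coordinates and topology of hermitian matrices\<close>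

definition unherm :: "'p::{finite,linorder} cmat \<Rightarrow> 'p rmat" where
  "unherm X = (\<chi> i j. if i \<le> j then Re (X $ i $ j) else Im (X $ j $ i))"

lemma unherm_herm_of [simp]: "unherm (herm_of Y) = Y"
  by (auto simp: unherm_def herm_of_def vec_eq_iff)

lemma hermitian_herm_of [simp]: "hermitian (herm_of Y)"
  by (auto simp: hermitian_def cadj_def herm_of_def vec_eq_iff complex_eq_iff)

lemma herm_of_unherm:
  assumes "hermitian X" shows "herm_of (unherm X) = X"
proof -
  have "X $ j $ i = cnj (X $ i $ j)" for i j
    using assms by (metis cadj_nth hermitian_def)
  note a = this
  have "herm_of (unherm X) $ i $ j = X $ i $ j" for i j
    using a[of i j] a[of i i] by (cases i j rule: linorder_cases) (auto simp: unherm_def herm_of_def complex_eq_iff not_le)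
  then show ?thesis by (simp add: vec_eq_iff)
qed

lemma linear_herm_of: "linear herm_of"
  by (rule linearI) (auto simp: herm_of_def vec_eq_iff complex_eq_iff)

lemma linear_unherm: "linear unherm"
  by (rule linearI) (auto simp: unherm_def vec_eq_iff)

lemma continuous_herm_of [continuous_intros]: "continuous_on S f \<Longrightarrow> continuous_on S (\<lambda>x. herm_of (f x))"
  by (rule continuous_on_compose2[of UNIV herm_of]) (use linear_herm_of in \<open>auto simp: linear_conv_bounded_linear intro: linear_continuous_on\<close>)

lemma continuous_unherm [continuous_intros]: "continuous_on S f \<Longrightarrow> continuous_on S (\<lambda>x. unherm (f x))"
  by (rule continuous_on_compose2[of UNIV unherm]) (use linear_unherm in \<open>auto simp: linear_conv_bounded_linear intro: linear_continuous_on\<close>)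

lemma continuous_matrix_mult [continuous_intros]:
  fixes f g :: "'a::topological_space \<Rightarrow> complex^'p^'p"
  shows "continuous_on S f \<Longrightarrow> continuous_on S g \<Longrightarrow> continuous_on S (\<lambda>x. f x ** g x)"
  unfolding matrix_matrix_mult_def
  by (intro continuous_intros) (auto intro: continuous_intros)

lemma isCont_herm_of: "isCont herm_of Y"
  using continuous_herm_of[OF continuous_on_id, of UNIV]
  by (simp only: continuous_on_eq_continuous_at open_UNIV) blast

lemma isCont_matrix_square: "isCont (\<lambda>B :: complex^'p^'p. B ** B) R"
  using continuous_matrix_mult[OF continuous_on_id continuous_on_id, of UNIV]
  by (simp only: continuous_on_eq_continuous_at open_UNIV) blast

lemma continuous_cadj [continuous_intros]:
  "continuous_on S f \<Longrightarrow> continuous_on S (\<lambda>x. cadj (f x))"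
  unfolding cadj_def by (intro continuous_intros)

lemma continuous_qform [continuous_intros]:
  "continuous_on S f \<Longrightarrow> continuous_on S g \<Longrightarrow> continuous_on S (\<lambda>x. qform (f x) (g x))"
  unfolding qform_def by (intro continuous_intros)

lemma closed_hermitian: "closed {A. hermitian A}"
  unfolding hermitian_def by (intro closed_Collect_eq continuous_intros)

lemma closed_psd: "closed {A. psd A}"
  unfolding psd_def
  by (intro closed_Collect_conj closed_Collect_all closed_hermitian closed_Collect_le continuous_intros)

lemma qform_vec_scale: "qform A (c *s v) = of_real ((norm c)\<^sup>2) * qform A v"
proof -
  have "qform A (c *s v) = (c * cnj c) * qform A v"
    by (simp add: qform_cdot cdot_scale_left cdot_scale_right vector_scalar_commute mult_ac)
  then show ?thesis by (simp only: complex_norm_square)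
qed

text \<open>On the compact unit sphere the failure of positivity becomes a closed condition.\<close>

lemma pd_sphere: "pd A \<longleftrightarrow> hermitian A \<and> (\<forall>v\<in>sphere 0 1. 0 < Re (qform A v))"
proof -
  have "0 < Re (qform A v)" if a: "\<forall>v\<in>sphere 0 1. 0 < Re (qform A v)" and v: "v \<noteq> 0" for v
  proof -
    define w where "w = inverse (norm v) *\<^sub>R v"
    have w: "w = complex_of_real (inverse (norm v)) *s v"
      by (simp add: w_def vec_eq_iff scaleR_conv_of_real[where 'a=complex])
    have "norm w = 1" using v by (simp add: w_def)
    then have "0 < Re (qform A w)" using a by simp
    then show ?thesis using v by (simp add: w qform_vec_scale zero_less_mult_iff del: of_real_power of_real_inverse)
  qed
  moreover have "v \<noteq> 0" if "v \<in> sphere 0 1" for v :: "complex^'a" using that by auto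
  ultimately show ?thesis unfolding pd_def by blast
qed

lemma closed_not_pd: "closed {A. \<exists>v. v \<in> sphere 0 1 \<and> Re (qform A v) \<le> 0}"
proof -
  have "closed {A. \<exists>v. v \<in> sphere 0 1 \<and> (v, A) \<in> {z. Re (qform (snd z) (fst z)) \<le> 0}}"
    by (rule closed_compact_projection) (auto intro!: closed_Collect_le continuous_intros)
  then show ?thesis by simp
qed

text \<open>Positive definiteness is open only among hermitian matrices, hence the pullback to real
  coordinates.\<close>

lemma open_pd_herm: "open {Y. pd (herm_of Y)}"
proof -
  have eq: "{Y. pd (herm_of Y)} = herm_of -` (- {A. \<exists>v. v \<in> sphere 0 1 \<and> Re (qform A v) \<le> 0})"
    by (auto simp: pd_sphere not_le)
  show ?thesis unfolding eq
    by (rule open_vimage[OF open_Compl[OF closed_not_pd] continuous_herm_of[OF continuous_on_id]])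
qed

lemma convex_pd_herm: "convex {Y. pd (herm_of Y)}"
proof (rule convexI)
  fix x y :: "'p::{finite,linorder} rmat" and u v :: real
  assume *: "x \<in> {Y. pd (herm_of Y)}" "y \<in> {Y. pd (herm_of Y)}" "0 \<le> u" "0 \<le> v" "u + v = 1"
  have eq: "herm_of (u *\<^sub>R x + v *\<^sub>R y) = u *\<^sub>R herm_of x + v *\<^sub>R herm_of y"
    by (simp add: linear_add[OF linear_herm_of] linear_scale[OF linear_herm_of])
  have "pd (u *\<^sub>R herm_of x + v *\<^sub>R herm_of y)"
  proof (cases "u = 0")
    case True then show ?thesis using * by simp
  next
    case False then show ?thesis using * by (intro pd_add_psd pd_scaleR psd_scaleR pd_imp_psd) auto
  qed
  then show "u *\<^sub>R x + v *\<^sub>R y \<in> {Y. pd (herm_of Y)}" by (simp add: eq)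
qed

text \<open>Squaring is injective on the cone of positive definite matrices, so invariance of domain makes
  its range open in the cone; the range is also closed there, and the cone is connected.\<close>

lemma pd_sqrt_exists:
  fixes A :: "'p::{finite,linorder} cmat"
  assumes "pd A"
  shows "\<exists>R. pd R \<and> R ** R = A"
proof -
  define P where "P = {Y :: 'p::{finite,linorder} rmat. pd (herm_of Y)}"
  \<comment> \<open>Squaring in real coordinates, where domain and range have equal dimension, as
    invariance of domain requires.\<close>
  define f :: "'p::{finite,linorder} rmat \<Rightarrow> 'p::{finite,linorder} rmat" where "f Y = unherm (herm_of Y ** herm_of Y)" for Y
  have hf: "herm_of (f Y) = herm_of Y ** herm_of Y" for Y
    unfolding f_def using hermitian_herm_of[of Y]
    by (intro herm_of_unherm) (simp add: hermitian_def cadj_mult)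
  have inj: "herm_of X = herm_of Y \<Longrightarrow> X = Y" for X Y :: "'p::{finite,linorder} rmat"
    by (metis unherm_herm_of)
  have fP: "f ` P \<subseteq> P"
  proof -
    have "pd (herm_of (f Y))" if a: "pd (herm_of Y)" for Y
    proof -
      obtain B where B: "B ** herm_of Y = mat 1" using pd_imp_inverse[OF a] by metis
      have "pd (herm_of Y ** mat 1 ** cadj (herm_of Y))"
        by (rule pd_congr[OF pd_mat_1 B])
      then show ?thesis using hermitian_herm_of[of Y] by (simp add: hf hermitian_def)
    qed
    then show ?thesis by (auto simp: P_def)
  qed
  have cont: "continuous_on S f" for S
    unfolding f_def by (intro continuous_intros)
  have "inj_on f P"
  proof (rule inj_onI)
    fix X Y assume "X \<in> P" "Y \<in> P" "f X = f Y"
    then have "herm_of X ** herm_of X = herm_of Y ** herm_of Y" by (metis hf)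
    then show "X = Y"
      using \<open>X \<in> P\<close> \<open>Y \<in> P\<close> inj psd_sqrt_unique pd_imp_psd unfolding P_def by blast
  qed
  then have 1: "open (f ` P)"
    using open_pd_herm cont by (intro invariance_of_domain_gen) (auto simp: P_def)
  have 2: "\<exists>C. closed C \<and> f ` P = P \<inter> C"
  proof (intro exI conjI)
    show "closed (closure (f ` P))" by simp
    show "f ` P = P \<inter> closure (f ` P)"
    proof
      show "f ` P \<subseteq> P \<inter> closure (f ` P)" by (simp add: fP closure_subset)
      show "P \<inter> closure (f ` P) \<subseteq> f ` P"
      proof
        fix Y assume "Y \<in> P \<inter> closure (f ` P)"
        then obtain Z where Z: "\<forall>n. Z n \<in> f ` P" "Z \<longlonglongrightarrow> Y" and Y: "Y \<in> P"
          by (metis IntD1 IntD2 closure_sequential)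
        from Z(1) have "\<forall>n. \<exists>x. x \<in> P \<and> Z n = f x" by blast
        then obtain X where X0: "\<forall>n. X n \<in> P \<and> Z n = f (X n)" by (rule choice[THEN exE])
        then have "Z = (\<lambda>n. f (X n))" by (simp add: fun_eq_iff)
        with Z(2) X0 have X: "\<And>n. X n \<in> P" "(\<lambda>n. f (X n)) \<longlonglongrightarrow> Y" by simp_all
        \<comment> \<open>Roots of a convergent sequence of squares are bounded, since the trace of
          \<open>X ** X\<close> is the squared norm of a hermitian \<open>X\<close>. A subsequence
          of roots then converges, and its limit is a root of the limit.\<close>
        have "bounded (range (\<lambda>n. herm_of (f (X n))))"
        proof -
          have "isCont herm_of Y" by (rule isCont_herm_of)
          then have "(\<lambda>n. herm_of (f (X n))) \<longlonglongrightarrow> herm_of Y"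
            by (rule isCont_tendsto_compose[OF _ X(2)])
          then show ?thesis by (rule convergent_imp_bounded)
        qed
        then obtain b where b: "\<And>n. norm (herm_of (f (X n))) \<le> b"
          by (auto simp: bounded_iff)
        have trle: "tr B \<le> real CARD('p) * norm B" for B :: "'p cmat"
        proof -
          have "tr B \<le> (\<Sum>(i::'p)\<in>UNIV. norm B)" unfolding tr_def
          proof (rule sum_mono)
            show "Re (B $ i $ i) \<le> norm B" for i
              using complex_Re_le_cmod[of "B $ i $ i"] Finite_Cartesian_Product.norm_nth_le[of "B $ i" i] Finite_Cartesian_Product.norm_nth_le[of B i] by linarith
          qed
          then show ?thesis by simp
        qed
        have "(norm (herm_of (X n)))\<^sup>2 \<le> real CARD('p) * b" for n
        proof -
          have "(norm (herm_of (X n)))\<^sup>2 = tr (herm_of (f (X n)))"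
            using tr_cadj_mult_self[of "herm_of (X n)"] hermitian_herm_of[of "X n"]
            by (simp add: hf hermitian_def)
          also have "\<dots> \<le> real CARD('p) * norm (herm_of (f (X n)))" by (rule trle)
          also have "\<dots> \<le> real CARD('p) * b" by (intro mult_left_mono b) simp
          finally show ?thesis .
        qed
        then have "norm (herm_of (X n)) \<le> sqrt (real CARD('p) * b)" for n
          by (simp add: real_le_rsqrt)
        then have bd: "bounded (range (\<lambda>n. herm_of (X n)))" by (auto simp: bounded_iff)
        then obtain R r where r: "strict_mono (r :: nat \<Rightarrow> nat)" "((\<lambda>n. herm_of (X n)) \<circ> r) \<longlonglongrightarrow> R"
          using bounded_imp_convergent_subsequence by blast
        have R: "psd R"
          using closed_sequentially[OF closed_psd, of "(\<lambda>n. herm_of (X n)) \<circ> r"] r X(1)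
          by (auto simp: P_def pd_imp_psd)
        have 1: "((\<lambda>n. herm_of (f (X n))) \<circ> r) \<longlonglongrightarrow> R ** R"
        proof -
          have "isCont (\<lambda>B. B ** B) R" by (rule isCont_matrix_square)
          then show ?thesis using isCont_tendsto_compose[OF _ r(2)] by (simp add: o_def hf)
        qed
        have 2: "((\<lambda>n. herm_of (f (X n))) \<circ> r) \<longlonglongrightarrow> herm_of Y"
        proof -
          have "isCont herm_of Y" by (rule isCont_herm_of)
          then have "(\<lambda>n. herm_of (f (X n))) \<longlonglongrightarrow> herm_of Y"
            by (rule isCont_tendsto_compose[OF _ X(2)])
          then show ?thesis using LIMSEQ_subseq_LIMSEQ[OF _ r(1)] by blast
        qed
        have RR: "R ** R = herm_of Y" by (rule LIMSEQ_unique[OF 1 2])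
        \<comment> \<open>The limit root is so far only semidefinite; an invertible square makes it
          definite.\<close>
        have "det (herm_of Y) \<noteq> 0" using Y by (intro pd_det_nz) (auto simp: P_def)
        then have "det R \<noteq> 0" by (metis RR det_mul mult_zero_left)
        then have "pd R" by (rule pd_psd_det[OF R])
        moreover have "f (unherm R) = Y" using psdD(1)[OF R] by (intro inj) (simp add: hf herm_of_unherm RR)
        ultimately show "Y \<in> f ` P"
          using psdD(1)[OF R] by (intro image_eqI[of _ _ "unherm R"]) (auto simp: P_def herm_of_unherm)
      qed
    qed
  qed
  have "openin (top_of_set P) (f ` P)" using 1 fP by (auto simp: openin_open)
  moreover have "closedin (top_of_set P) (f ` P)" using 2 by (auto simp: closedin_closed)
  moreover have "connected P" unfolding P_def by (rule convex_connected[OF convex_pd_herm])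
  moreover have "f ` P \<noteq> {}"
  proof -
    have "unherm (mat 1) \<in> P" by (simp add: P_def herm_of_unherm)
    then show ?thesis by blast
  qed
  ultimately have "f ` P = P" unfolding connected_clopen by metis
  then have "unherm A \<in> f ` P" using assms by (simp add: P_def herm_of_unherm pdD(1))
  then obtain Y where Y: "Y \<in> P" "unherm A = f Y" by (rule imageE)
  then have "herm_of Y ** herm_of Y = A"
    using hf[of Y] herm_of_unherm[OF pdD(1)[OF assms]] by simp
  with Y(1) show ?thesis by (auto simp: P_def)
qed

lemma msqrt:
  fixes A :: "'p::{finite,linorder} cmat"
  assumes "pd A"
  shows "pd (msqrt A)" "msqrt A ** msqrt A = A"
proof -
  obtain R where R: "pd R" "R ** R = A" using pd_sqrt_exists[OF assms] by blast
  have "msqrt A = R" unfolding msqrt_def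
    by (rule the_equality) (use R psd_sqrt_unique pd_imp_psd in auto)
  then show "pd (msqrt A)" "msqrt A ** msqrt A = A" using R by auto
qed

subsection \<open>Lebesgue measure on hermitian matrices\<close>

lemma sets_lebH [simp, measurable_cong]: "sets lebH = sets borel"
  by (simp add: lebH_def)

lemma space_lebH [simp]: "space lebH = UNIV"
  by (simp add: lebH_def)

lemma measurable_herm_of [measurable]: "herm_of \<in> borel_measurable borel"
  by (intro borel_measurable_continuous_onI continuous_intros)

lemma measurable_unherm [measurable]: "unherm \<in> borel_measurable borel"
  by (intro borel_measurable_continuous_onI continuous_intros)

lemma nn_integral_lebH:
  "f \<in> borel_measurable borel \<Longrightarrow> (\<integral>\<^sup>+X. f X \<partial>lebH) = (\<integral>\<^sup>+Y. f (herm_of Y) \<partial>lborel)"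
  by (simp add: lebH_def nn_integral_distr)

lemma emeasure_lebH:
  "A \<in> sets borel \<Longrightarrow> emeasure lebH A = emeasure lborel (herm_of -` A)"
  by (simp add: lebH_def emeasure_distr)

lemma norm_le_herm_of:
  obtains B where "\<And>Y :: 'p::{finite,linorder} rmat. norm Y \<le> B * norm (herm_of Y)"
proof -
  have "linear (unherm :: 'p cmat \<Rightarrow> 'p rmat)" by (rule linear_unherm)
  then obtain B where "\<And>X :: 'p cmat. norm (unherm X) \<le> B * norm X"
    using linear_bounded by metis
  then have "norm Y \<le> B * norm (herm_of Y)" for Y :: "'p rmat"
    by (metis unherm_herm_of)
  then show ?thesis by (rule that)
qed

lemma sigma_finite_lebH: "sigma_finite_measure (lebH :: 'p::{finite,linorder} cmat measure)"
proof
  obtain B where B: "\<And>Y :: 'p rmat. norm Y \<le> B * norm (herm_of Y)" using norm_le_herm_of by metis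
  have fin: "emeasure lebH (cball (0 :: 'p cmat) (real n)) \<noteq> \<infinity>" for n :: nat
  proof -
    have "bounded (herm_of -` cball (0 :: 'p cmat) (real n))"
    proof (rule boundedI)
      fix Y :: "'p rmat" assume "Y \<in> herm_of -` cball 0 (real n)"
      then have "norm (herm_of Y) \<le> real n" by simp
      moreover have "norm Y \<le> \<bar>B\<bar> * norm (herm_of Y)"
        by (rule order_trans[OF B]) (intro mult_right_mono, auto)
      ultimately show "norm Y \<le> \<bar>B\<bar> * real n" by (meson abs_ge_zero mult_left_mono order_trans)
    qed
    then show ?thesis
      using emeasure_bounded_finite by (simp add: emeasure_lebH less_top[symmetric])
  qed
  have "(\<Union>n. cball (0 :: 'p cmat) (real n)) = UNIV"
    using real_arch_simple by auto
  then show "\<exists>A. countable A \<and> A \<subseteq> sets (lebH :: 'p cmat measure) \<and> \<Union> A = space lebH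
      \<and> (\<forall>a\<in>A. emeasure lebH a \<noteq> \<infinity>)"
    using fin by (intro exI[of _ "range (\<lambda>n. cball 0 (real n))"]) auto
qed

lemma nn_integral_lborel_shift:
  fixes f :: "'a::euclidean_space \<Rightarrow> ennreal"
  assumes [measurable]: "f \<in> borel_measurable borel"
  shows "(\<integral>\<^sup>+x. f (c + x) \<partial>lborel) = (\<integral>\<^sup>+x. f x \<partial>lborel)"
  by (subst (2) lborel_distr_plus[of c, symmetric]) (simp add: nn_integral_distr)

lemma nn_integral_lborel_reflect:
  fixes f :: "'a::euclidean_space \<Rightarrow> ennreal"
  assumes [measurable]: "f \<in> borel_measurable borel"
  shows "(\<integral>\<^sup>+x. f (c - x) \<partial>lborel) = (\<integral>\<^sup>+x. f x \<partial>lborel)"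
proof -
  have "lborel = density (distr lborel borel (\<lambda>x. c + (-1) *\<^sub>R x)) (\<lambda>_. ennreal (\<bar>-1\<bar> ^ DIM('a)))"
    by (rule lborel_affine) simp
  then have "lborel = distr lborel borel (\<lambda>x. c - x)" by (simp add: density_1)
  then have "(\<integral>\<^sup>+x. f x \<partial>lborel) = (\<integral>\<^sup>+x. f x \<partial>distr lborel borel (\<lambda>x. c - x))" by metis
  then show ?thesis by (simp add: nn_integral_distr)
qed

text \<open>\<open>lebH\<close> is a measure on all complex matrices carried by the hermitian ones,
  so only hermitian shifts preserve it.\<close>

lemma nn_integral_lebH_shift:
  assumes [measurable]: "f \<in> borel_measurable borel" and "hermitian C"
  shows "(\<integral>\<^sup>+X. f (C + X) \<partial>lebH) = (\<integral>\<^sup>+X. f X \<partial>lebH)"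
proof -
  have "C + herm_of Y = herm_of (unherm C + Y)" for Y
    using assms(2) by (simp add: linear_add[OF linear_herm_of] herm_of_unherm)
  then show ?thesis
    by (simp add: nn_integral_lebH nn_integral_lborel_shift[of "\<lambda>Y. f (herm_of Y)"])
qed

lemma nn_integral_lebH_reflect:
  assumes [measurable]: "f \<in> borel_measurable borel" and "hermitian C"
  shows "(\<integral>\<^sup>+X. f (C - X) \<partial>lebH) = (\<integral>\<^sup>+X. f X \<partial>lebH)"
proof -
  have "C - herm_of Y = herm_of (unherm C - Y)" for Y
    using assms(2) by (simp add: linear_diff[OF linear_herm_of] herm_of_unherm)
  then show ?thesis
    by (simp add: nn_integral_lebH nn_integral_lborel_reflect[of "\<lambda>Y. f (herm_of Y)"])
qed

text \<open>Integrating \<open>1\<^sub>B(y) 1\<^sub>C(x + y)\<close> in both orders shows that a translation invariant measure is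
  proportional to Lebesgue measure.\<close>

lemma translation_invariant_unique:
  fixes N :: "'a::euclidean_space measure"
  assumes N: "sigma_finite_measure N" and [measurable_cong]: "sets N = sets borel"
    and inv: "\<And>c. distr N borel ((+) c) = N"
    and [measurable]: "B \<in> sets borel" "C \<in> sets borel"
  shows "emeasure lborel C * emeasure N B = emeasure N C * emeasure lborel B"
proof -
  interpret sigma_finite_measure N by (rule N)
  interpret P: pair_sigma_finite lborel N ..
  have N_inv: "(\<integral>\<^sup>+y. h (c + y) \<partial>N) = (\<integral>\<^sup>+y. h y \<partial>N)" if [measurable]: "h \<in> borel_measurable borel" for h c
    by (subst (2) inv[of c, symmetric]) (simp add: nn_integral_distr)
  have "emeasure lborel C * emeasure N B = (\<integral>\<^sup>+y. emeasure lborel C * indicator B y \<partial>N)"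
    by (simp add: nn_integral_cmult_indicator)
  also have "\<dots> = (\<integral>\<^sup>+y. (\<integral>\<^sup>+x. indicator C (y + x) \<partial>lborel) * indicator B y \<partial>N)"
    by (subst nn_integral_lborel_shift) auto
  also have "\<dots> = (\<integral>\<^sup>+y. (\<integral>\<^sup>+x. indicator C (y + x) * indicator B y \<partial>lborel) \<partial>N)"
    by (simp add: nn_integral_multc)
  also have "\<dots> = (\<integral>\<^sup>+x. (\<integral>\<^sup>+y. indicator C (y + x) * indicator B y \<partial>N) \<partial>lborel)"
    by (rule P.Fubini') measurable
  also have "\<dots> = (\<integral>\<^sup>+x. (\<integral>\<^sup>+y. indicator C y * indicator B (y - x) \<partial>N) \<partial>lborel)"
  proof (rule nn_integral_cong)
    show "(\<integral>\<^sup>+y. indicator C (y + x) * indicator B y \<partial>N) = (\<integral>\<^sup>+y. indicator C y * indicator B (y - x) \<partial>N)" for x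
      using N_inv[of "\<lambda>y. indicator C (y + x) * indicator B y" "- x", symmetric] by (simp add: add.commute)
  qed
  also have "\<dots> = (\<integral>\<^sup>+y. (\<integral>\<^sup>+x. indicator C y * indicator B (y - x) \<partial>lborel) \<partial>N)"
    by (rule P.Fubini'[symmetric]) measurable
  also have "\<dots> = (\<integral>\<^sup>+y. indicator C y * (\<integral>\<^sup>+x. indicator B (y - x) \<partial>lborel) \<partial>N)"
    by (simp add: nn_integral_cmult)
  also have "\<dots> = (\<integral>\<^sup>+y. emeasure lborel B * indicator C y \<partial>N)"
    by (subst nn_integral_lborel_reflect) (auto simp: mult.commute)
  also have "\<dots> = emeasure N C * emeasure lborel B"
    by (subst nn_integral_cmult_indicator) (simp_all add: mult.commute)
  finally show ?thesis .
qed

text \<open>A test set of measure one, used to read off the constant of proportionality.\<close>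

definition unit_herm :: "'p::{finite,linorder} cmat set" where
  "unit_herm = unherm -` cbox 0 One"

lemma unit_herm_borel [measurable]: "unit_herm \<in> sets borel"
  unfolding unit_herm_def using measurable_sets[OF measurable_unherm, of "cbox 0 One"] by simp

text \<open>The volume of the preimage of the unit cube under the congruence with \<open>A\<close>;
  for invertible \<open>A\<close> this is the reciprocal of its Jacobian.\<close>

definition jacH :: "'p::{finite,linorder} cmat \<Rightarrow> ennreal" where
  "jacH A = (\<integral>\<^sup>+X. indicator unit_herm (A ** X ** cadj A) \<partial>lebH)"

lemma measurable_congr [measurable]:
  "(\<lambda>X. A ** X ** cadj A) \<in> borel_measurable (borel :: (complex^'p^'p) measure)"
  by (intro borel_measurable_continuous_onI continuous_intros)

lemma emeasure_unit_herm: "emeasure lebH (unit_herm :: 'p::{finite,linorder} cmat set) = 1"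
proof -
  have "herm_of -` unit_herm = (cbox 0 One :: 'p rmat set)" by (auto simp: unit_herm_def)
  then show ?thesis by (simp add: emeasure_lebH)
qed

text \<open>The image of Lebesgue measure under an invertible linear map is translation invariant,
  hence a multiple of Lebesgue measure; its value at the unit cube is the factor
  \<open>jacH A\<close>.\<close>

lemma nn_integral_congr:
  fixes A :: "'p::{finite,linorder} cmat"
  assumes A: "A ** A' = mat 1" and [measurable]: "f \<in> borel_measurable borel"
  shows "(\<integral>\<^sup>+X. f (A ** X ** cadj A) \<partial>lebH) = jacH A * (\<integral>\<^sup>+X. f X \<partial>lebH)"
proof -
  have A': "A' ** A = mat 1" using A by (simp add: matrix_left_right_inverse)
  have A'': "cadj A ** cadj A' = mat 1" using A' by (metis cadj_mat_1 cadj_mult)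
  define T where "T Y = unherm (A ** herm_of Y ** cadj A)" for Y :: "'p rmat"
  have hT: "herm_of (T Y) = A ** herm_of Y ** cadj A" for Y
    unfolding T_def by (intro herm_of_unherm hermitian_congr hermitian_herm_of)
  have linT: "linear T"
    unfolding T_def by (intro linearI)
     (simp_all add: linear_add[OF linear_herm_of] linear_scale[OF linear_herm_of] linear_add[OF linear_unherm]
        linear_scale[OF linear_unherm] matrix_ring_simps matrix_mult_scaleR_left matrix_mult_scaleR_right)
  define T' where "T' Y = unherm (A' ** herm_of Y ** cadj A')" for Y :: "'p rmat"
  have linT': "linear T'"
    unfolding T'_def by (intro linearI)
     (simp_all add: linear_add[OF linear_herm_of] linear_scale[OF linear_herm_of] linear_add[OF linear_unherm]
        linear_scale[OF linear_unherm] matrix_ring_simps matrix_mult_scaleR_left matrix_mult_scaleR_right)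
  have AX: "A' ** (A ** X ** cadj A) ** cadj A' = X" for X
  proof -
    have "A' ** (A ** X ** cadj A) ** cadj A' = (A' ** A) ** X ** (cadj A ** cadj A')"
      by (simp add: matrix_mul_assoc)
    then show ?thesis by (simp add: A' A'')
  qed
  have AX': "A ** (A' ** X ** cadj A') ** cadj A = X" for X
  proof -
    have "cadj A' ** cadj A = mat 1" using A by (metis cadj_mat_1 cadj_mult)
    moreover have "A ** (A' ** X ** cadj A') ** cadj A = (A ** A') ** X ** (cadj A' ** cadj A)"
      by (simp add: matrix_mul_assoc)
    ultimately show ?thesis by (simp add: A)
  qed
  have T'T: "T' (T Y) = Y" for Y
    unfolding T'_def by (simp add: hT AX)
  have TT': "T (T' Y) = Y" for Y
  proof -
    have "herm_of (T' Y) = A' ** herm_of Y ** cadj A'"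
      unfolding T'_def by (intro herm_of_unherm hermitian_congr hermitian_herm_of)
    then show ?thesis by (simp add: T_def AX')
  qed
  have [measurable]: "T \<in> borel_measurable borel"
    unfolding T_def by measurable
  define N where "N = distr lborel borel T"
  have setsN [measurable_cong]: "sets N = sets borel" by (simp add: N_def)
  \<comment> \<open>The bounded inverse \<open>T'\<close> keeps preimages of balls bounded.\<close>
  have "sigma_finite_measure N"
  proof
    obtain B where B: "\<And>Y. norm (T' Y) \<le> B * norm Y"
      using linear_bounded[OF linT'] by blast
    have fin: "emeasure N (cball 0 (real n)) \<noteq> \<infinity>" for n :: nat
    proof -
      have "bounded (T -` cball 0 (real n))"
      proof (rule boundedI)
        fix Y assume "Y \<in> T -` cball 0 (real n)"
        then have "norm (T Y) \<le> real n" by simp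
        moreover have "norm Y \<le> \<bar>B\<bar> * norm (T Y)"
          using B[of "T Y"] mult_right_mono[OF abs_ge_self[of B] norm_ge_zero[of "T Y"]] by (simp add: T'T)
        ultimately show "norm Y \<le> \<bar>B\<bar> * real n" by (meson abs_ge_zero mult_left_mono order_trans)
      qed
      then show ?thesis
        using emeasure_bounded_finite by (simp add: N_def emeasure_distr less_top[symmetric])
    qed
    have "(\<Union>n. cball (0 :: 'p rmat) (real n)) = UNIV"
      using real_arch_simple by auto
    then show "\<exists>A. countable A \<and> A \<subseteq> sets N \<and> \<Union> A = space N \<and> (\<forall>a\<in>A. emeasure N a \<noteq> \<infinity>)"
      using fin by (intro exI[of _ "range (\<lambda>n. cball 0 (real n))"]) (auto simp: setsN N_def)
  qed
  \<comment> \<open>A shift by \<open>c\<close> after \<open>T\<close> is a shift by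
    \<open>T' c\<close> before it.\<close>
  moreover have "distr N borel ((+) c) = N" for c
  proof -
    have "distr N borel ((+) c) = distr lborel borel (\<lambda>Y. T (T' c + Y))"
      by (simp add: N_def distr_distr o_def linear_add[OF linT] TT')
    also have "\<dots> = distr (distr lborel borel ((+) (T' c))) borel T"
      by (simp add: distr_distr o_def)
    finally show ?thesis by (simp add: lborel_distr_plus N_def)
  qed
  ultimately have key: "emeasure N B = emeasure N (cbox 0 One) * emeasure lborel B" if "B \<in> sets borel" for B
    using translation_invariant_unique[of N B "cbox 0 One"] that setsN by simp
  have jac: "jacH A = emeasure N (cbox 0 One)"
  proof -
    have [measurable]: "T -` cbox 0 One \<in> sets borel"
      using measurable_sets[OF \<open>T \<in> borel_measurable borel\<close>, of "cbox 0 One"] by simp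
    have "indicator unit_herm (A ** herm_of Y ** cadj A) = (indicator (T -` cbox 0 One) Y :: ennreal)" for Y
      by (simp add: unit_herm_def T_def indicator_def)
    then show ?thesis
      unfolding jacH_def N_def by (subst nn_integral_lebH) (simp_all add: emeasure_distr)
  qed
  have "N = scale_measure (jacH A) lborel"
  proof (rule measure_eqI)
    fix B assume "B \<in> sets N"
    then show "emeasure N B = emeasure (scale_measure (jacH A) lborel) B"
      using key[of B] by (simp add: jac setsN)
  qed (simp add: setsN)
  then have "(\<integral>\<^sup>+Y. g Y \<partial>N) = jacH A * (\<integral>\<^sup>+Y. g Y \<partial>lborel)" if "g \<in> borel_measurable borel" for g
    using that by (simp add: nn_integral_scale_measure)
  from this[of "\<lambda>Y. f (herm_of Y)"] show ?thesis
    by (simp add: nn_integral_lebH N_def nn_integral_distr hT)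
qed

lemma jacH_mult:
  fixes A B :: "'p::{finite,linorder} cmat"
  assumes "A ** A' = mat 1" "B ** B' = mat 1"
  shows "jacH (A ** B) = jacH A * jacH B"
proof -
  have "jacH (A ** B) = (\<integral>\<^sup>+X. indicator unit_herm (A ** (B ** X ** cadj B) ** cadj A) \<partial>lebH)"
    by (simp add: jacH_def cadj_mult matrix_mul_assoc)
  also have "\<dots> = jacH B * (\<integral>\<^sup>+X. indicator unit_herm (A ** X ** cadj A) \<partial>lebH)"
    by (rule nn_integral_congr[OF assms(2), of "\<lambda>X. indicator unit_herm (A ** X ** cadj A)"]) measurable
  finally show ?thesis by (simp add: jacH_def mult.commute)
qed

lemma jacH_1: "jacH (mat 1) = 1"
  by (simp add: jacH_def emeasure_unit_herm)

subsection \<open>Elimination of positive definite matrices\<close>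

text \<open>For \<open>v $ q = 0\<close> this is a unipotent matrix; congruence with it performs one
  step of Gaussian elimination with pivot index \<open>q\<close>.\<close>

definition shear :: "'p \<Rightarrow> complex^'p \<Rightarrow> complex^'p^'p" where
  "shear q v = (\<chi> i j. (if i = j then 1 else 0) + (if j = q then v $ i else 0))"

definition diagm :: "('p \<Rightarrow> real) \<Rightarrow> complex^'p^'p" where
  "diagm r = (\<chi> i j. if i = j then complex_of_real (r i) else 0)"

lemma shear_mult: "w $ q = 0 \<Longrightarrow> shear q v ** shear q w = shear q (v + w)"
  by (auto simp: shear_def matrix_matrix_mult_def vec_eq_iff distrib_left distrib_right sum.distrib
      if_distrib[of "\<lambda>x. x * _"] if_distrib[of "\<lambda>x. _ * x"] cong: if_cong)

lemma shear_0 [simp]: "shear q 0 = mat 1"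
  by (auto simp: shear_def mat_def vec_eq_iff)

lemma diagm_mult: "diagm r ** diagm s = diagm (\<lambda>i. r i * s i)"
  by (auto simp: diagm_def matrix_matrix_mult_def vec_eq_iff
      if_distrib[of "\<lambda>x. x * _"] if_distrib[of "\<lambda>x. _ * x"] cong: if_cong)

lemma diagm_1: "diagm (\<lambda>_. 1) = mat 1"
  by (simp add: diagm_def mat_def vec_eq_iff)

lemma cadj_diagm [simp]: "cadj (diagm r) = diagm r"
  by (auto simp: diagm_def cadj_def vec_eq_iff)

lemma det_diagm: "det (diagm r) = complex_of_real (\<Prod>i\<in>UNIV. r i)"
  by (subst det_diagonal) (auto simp: diagm_def)

text \<open>Conjugation by \<open>D\<close> doubles \<open>v\<close>, and doubling \<open>v\<close>
  squares the shear.\<close>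

lemma diagm_shear:
  fixes q :: "'p::finite"
  assumes "v $ q = 0"
  defines "D \<equiv> diagm (\<lambda>i. if i = q then 1 else 2)"
  shows "D ** shear q v = shear q v ** shear q v ** D"
  unfolding shear_mult[OF assms(1)] D_def using assms(1)
  by (auto simp: shear_def diagm_def matrix_matrix_mult_def vec_eq_iff distrib_left distrib_right sum.distrib
      if_distrib[of "\<lambda>x. x * _"] if_distrib[of "\<lambda>x. _ * x"] cong: if_cong)

text \<open>A unipotent elimination matrix is conjugate to its own square, so every homomorphism into the
  units of a commutative monoid is trivial on it.\<close>

lemma multiplicative_shear:
  fixes f :: "complex^'p^'p \<Rightarrow> 'b::comm_monoid_mult"
  assumes mult: "\<And>A B A' B'. A ** A' = mat 1 \<Longrightarrow> B ** B' = mat 1 \<Longrightarrow> f (A ** B) = f A * f B"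
    and one: "f (mat 1) = 1" and v: "v $ q = 0"
  shows "f (shear q v) = 1" "f (cadj (shear q v)) = 1"
proof -
  define D D' :: "complex^'p^'p" where "D = diagm (\<lambda>i. if i = q then 1 else 2)"
    and "D' = diagm (\<lambda>i. if i = q then 1 else 1/2)"
  have DD: "D ** D' = mat 1" "D' ** D = mat 1"
    by (simp_all add: D_def D'_def diagm_mult if_distrib[of "\<lambda>x. x * _"] if_distrib[of "\<lambda>x. _ * x"] diagm_1 cong: if_cong)
  \<comment> \<open>The units \<open>f D\<close> and \<open>f L\<close> cancel from
    \<open>f D * f L = f D * f L * f L\<close>. The second alternative is the adjoint relation,
    which serves \<open>cadj (shear q v)\<close>.\<close>
  have *: "f L = 1" if L: "L ** L' = mat 1" and conj: "D ** L = L ** L ** D \<or> L ** D = D ** L ** L" for L L'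
  proof -
    have L2: "(L ** L) ** (L' ** L') = mat 1" and DL: "(D ** L) ** (L' ** D') = mat 1"
    proof -
      have "(L ** L) ** (L' ** L') = L ** (L ** L') ** L'" by (simp add: matrix_mul_assoc)
      then show "(L ** L) ** (L' ** L') = mat 1" by (simp add: L)
      have "(D ** L) ** (L' ** D') = D ** (L ** L') ** D'" by (simp add: matrix_mul_assoc)
      then show "(D ** L) ** (L' ** D') = mat 1" by (simp add: L DD)
    qed
    have a: "f (D ** L) = f D * f L" "f (L ** D) = f L * f D" "f (L ** L ** D) = f L * f L * f D"
      "f (D ** L ** L) = f D * f L * f L"
      using mult[OF DD(1) L] mult[OF L DD(1)] mult[OF L2 DD(1)] mult[OF L L] mult[OF DL L] by simp_all
    have u: "f L * f L' = 1" "f D * f D' = 1"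
      using mult[OF L, of L' L] mult[OF DD(1) DD(2)] one L DD(1) by (simp_all add: matrix_left_right_inverse)
    have "f D * f L = f D * f L * f L"
      using conj a by (auto simp: mult_ac)
    moreover have "f L = (f D * f D') * (f L * f L') * f L" by (simp add: u)
    moreover have "\<dots> = f D' * (f D * f L * f L) * f L'" by (simp only: mult_ac)
    moreover have "f D' * (f D * f L) * f L' = (f D * f D') * (f L * f L')" by (simp only: mult_ac)
    ultimately show ?thesis by (simp add: u)
  qed
  have L: "shear q v ** shear q (- v) = mat 1" using v by (simp add: shear_mult)
  show "f (shear q v) = 1"
    using diagm_shear[OF v] by (intro *[OF L]) (simp add: D_def)
  have "shear q (- v) ** shear q v = mat 1" using v by (simp add: shear_mult)
  then have L': "cadj (shear q v) ** cadj (shear q (- v)) = mat 1"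
    by (metis cadj_mat_1 cadj_mult)
  have "cadj (D ** shear q v) = cadj (shear q v ** shear q v ** D)"
    using diagm_shear[OF v] by (simp add: D_def)
  then have "cadj (shear q v) ** D = D ** cadj (shear q v) ** cadj (shear q v)"
    by (simp add: cadj_mult D_def matrix_mul_assoc)
  then show "f (cadj (shear q v)) = 1" by (intro *[OF L']) simp
qed

lemma det_shear: "v $ q = 0 \<Longrightarrow> det (shear q v) = 1" "v $ q = 0 \<Longrightarrow> det (cadj (shear q v)) = 1"
  using multiplicative_shear[where f=det] by (simp_all add: det_mul det_I)

lemma shear_congr_nth:
  "(shear q v ** X ** cadj (shear q v)) $ i $ j =
    X $ i $ j + v $ i * X $ q $ j + X $ i $ q * cnj (v $ j) + v $ i * X $ q $ q * cnj (v $ j)"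
proof -
  have 1: "(shear q v ** Z) $ i $ j = Z $ i $ j + v $ i * Z $ q $ j" for Z i j
    by (auto simp: shear_def matrix_matrix_mult_def distrib_right sum.distrib
      if_distrib[of "\<lambda>x. x * _"] cong: if_cong)
  have 2: "(Z ** cadj (shear q v)) $ i $ j = Z $ i $ j + Z $ i $ q * cnj (v $ j)" for Z i j
    by (auto simp: shear_def cadj_def matrix_matrix_mult_def distrib_left sum.distrib if_distrib[of cnj]
      if_distrib[of "\<lambda>x. _ * x"] cong: if_cong)
  show ?thesis by (simp add: 1 2 algebra_simps)
qed

lemma pd_diag_pos:
  assumes "pd X" shows "0 < Re (X $ q $ q)" "X $ q $ q = complex_of_real (Re (X $ q $ q))"
proof -
  have "qform X (axis q 1) = X $ q $ q"
    by (simp add: qform_def axis_def if_distrib[of cnj] if_distrib[of "\<lambda>x. x * _"] if_distrib[of "\<lambda>x. _ * x"] cong: if_cong)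
  moreover have "axis q (1::complex) \<noteq> 0" by (simp add: axis_eq_0_iff)
  ultimately show "0 < Re (X $ q $ q)" "X $ q $ q = complex_of_real (Re (X $ q $ q))"
    using pdD(2)[OF assms, of "axis q 1"] qform_hermitian_real[OF pdD(1)[OF assms], of "axis q 1"] by simp_all
qed

lemma shear_inverse_congr:
  assumes "v $ q = 0"
  shows "shear q v ** (shear q (- v) ** X ** cadj (shear q (- v))) ** cadj (shear q v) = X"
proof -
  have 1: "shear q v ** shear q (- v) = mat 1" using assms by (simp add: shear_mult)
  then have 2: "cadj (shear q (- v)) ** cadj (shear q v) = mat 1" by (metis cadj_mat_1 cadj_mult)
  have "shear q v ** (shear q (- v) ** X ** cadj (shear q (- v))) ** cadj (shear q v)
      = (shear q v ** shear q (- v)) ** X ** (cadj (shear q (- v)) ** cadj (shear q v))"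
    by (simp add: matrix_mul_assoc)
  then show ?thesis by (simp add: 1 2)
qed

lemma pd_shear_iff:
  assumes "v $ q = 0"
  shows "pd (shear q v ** X ** cadj (shear q v)) \<longleftrightarrow> pd X"
  by (rule pd_congr_iff[of "shear q (- v)"]) (simp add: shear_mult assms)

text \<open>Gaussian elimination as an induction rule: diagonal entries of a definite matrix are
  positive, so each can serve as a pivot, and clearing its row and column is a congruence by a
  shear.\<close>

lemma pd_elimination_induct [consumes 1, case_names diag step]:
  fixes X :: "complex^'p^'p"
  assumes X: "pd X"
    and diag: "\<And>r. (\<And>i. 0 < r i) \<Longrightarrow> P (diagm r)"
    and step: "\<And>X q v. pd X \<Longrightarrow> v $ q = 0 \<Longrightarrow> P X \<Longrightarrow> P (shear q v ** X ** cadj (shear q v))"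
  shows "P X"
proof -
  \<comment> \<open>\<open>J\<close> holds the indices whose rows may still have off-diagonal
    entries.\<close>
  have "P X" if "finite J" "pd X" "\<And>i j. i \<notin> J \<Longrightarrow> j \<noteq> i \<Longrightarrow> X $ i $ j = 0" for J X
    using that
  proof (induction J arbitrary: X rule: finite_induct)
    case empty
    have "X = diagm (\<lambda>i. Re (X $ i $ i))"
      using empty.prems(2) pd_diag_pos(2)[OF empty.prems(1)] by (simp add: diagm_def vec_eq_iff)
    then show ?case using diag[of "\<lambda>i. Re (X $ i $ i)"] pd_diag_pos(1)[OF empty.prems(1)] by simp
  next
    case (insert q J)
    define d where "d = X $ q $ q"
    have d: "d \<noteq> 0" "cnj d = d"
      using pd_diag_pos[OF insert.prems(1), of q] by (auto simp: d_def complex_eq_iff)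
    \<comment> \<open>The elimination multipliers; \<open>shear q (- v)\<close> clears row and
      column \<open>q\<close> and \<open>shear q v\<close> restores them.\<close>
    define v :: "complex^'p" where "v = (\<chi> i. if i = q then 0 else X $ i $ q / d)"
    have h: "cnj (X $ i $ j) = X $ j $ i" for i j
      using pdD(1)[OF insert.prems(1)] by (metis cadj_nth hermitian_def)
    define X' where "X' = shear q (- v) ** X ** cadj (shear q (- v))"
    have v: "v $ q = 0" by (simp add: v_def)
    have X'n: "X' $ i $ j = (if i = q \<and> j = q then d else if i = q \<or> j = q then 0 else X $ i $ j - X $ i $ q * X $ q $ j / d)" for i j
      using d unfolding X'_def shear_congr_nth by (auto simp: v_def h d_def[symmetric] field_simps)
    have "P X'"
    proof (rule insert.IH)
      show "pd X'" unfolding X'_def using insert.prems(1) v by (subst pd_shear_iff) auto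
      fix i j assume "i \<notin> J" "j \<noteq> i"
      then show "X' $ i $ j = 0"
        using insert.prems(2)[of i j] insert.prems(2)[of i q] by (cases "i = q") (auto simp: X'n)
    qed
    moreover have "pd X'" using insert.prems(1) v by (simp add: pd_shear_iff X'_def)
    ultimately have "P (shear q v ** X' ** cadj (shear q v))" using v by (metis step)
    then show ?case unfolding X'_def shear_inverse_congr[OF v] .
  qed
  from this[of UNIV X] show ?thesis using X by simp
qed

lemma det_pd:
  assumes "pd X" shows "det X = complex_of_real (Re (det X))" "0 < Re (det X)"
proof -
  have "Im (det X) = 0 \<and> 0 < Re (det X)" using assms
  proof (induction rule: pd_elimination_induct)
    case (diag r) then show ?case by (simp add: det_diagm prod_pos del: of_real_prod)
  next
    case (step X q v) then show ?case by (simp add: det_mul det_shear)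
  qed
  then show "det X = complex_of_real (Re (det X))" "0 < Re (det X)" by (auto simp: complex_eq_iff)
qed

subsection \<open>The Jacobian of a congruence\<close>

lemma bij_betw_axis2:
  "bij_betw (\<lambda>(i, j). axis i (axis j 1)) UNIV (Basis :: (real^'p^'p) set)"
  unfolding bij_betw_def
  by (auto simp: inj_on_def axis_eq_axis Basis_vec_def image_def)

text \<open>In real coordinates the congruence scales coordinate (i, j) by \<open>r i * r j\<close>,
  real and imaginary parts alike. In the product over all p^2 coordinates each \<open>r i\<close>
  occurs 2p times.\<close>

lemma jacH_diagm:
  fixes r :: "'p::{finite,linorder} \<Rightarrow> real"
  assumes r: "\<And>i. 0 < r i"
  shows "jacH (diagm r) * ennreal ((\<Prod>i\<in>UNIV. r i) ^ (2 * CARD('p))) = 1"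
proof -
  \<comment> \<open>The scale factor of coordinate (i, j), extended linearly from the basis element
    that indexes it.\<close>
  define c :: "'p rmat \<Rightarrow> real" where "c b = (\<Sum>i\<in>UNIV. \<Sum>j\<in>UNIV. r i * r j * b $ i $ j)" for b
  have cb: "c (axis i (axis j 1)) = r i * r j" for i j
  proof -
    have "(\<Sum>l\<in>UNIV. r k * r l * axis i (axis j 1) $ k $ l) = (if k = i then r i * r j else 0)" for k
      by (simp add: axis_def if_distrib[of "\<lambda>x. _ * x"] cong: if_cong)
    then show ?thesis by (simp add: c_def)
  qed
  define T :: "'p rmat \<Rightarrow> 'p rmat" where "T Y = (\<chi> i j. r i * r j * Y $ i $ j)" for Y
  have sumB: "(\<Sum>b\<in>(Basis :: 'p rmat set). g b) = (\<Sum>i\<in>UNIV. \<Sum>j\<in>UNIV. g (axis i (axis j 1)))" for g :: "'p rmat \<Rightarrow> 'p rmat"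
    using sum.reindex_bij_betw[OF bij_betw_axis2, of g] by (simp add: sum.cartesian_product case_prod_unfold)
  have T: "T Y = 0 + (\<Sum>b\<in>Basis. (c b * (Y \<bullet> b)) *\<^sub>R b)" for Y
  proof -
    have e: "axis k (axis l (1::real)) $ i $ j = (if l = j then if k = i then 1 else 0 else 0)" for k l i j :: 'p
      by (auto simp: axis_def)
    show ?thesis unfolding sumB cb
      by (simp add: T_def vec_eq_iff inner_axis e if_distrib[of "\<lambda>x. _ * x"] cong: if_cong)
  qed
  have cn: "c b \<noteq> 0" if "b \<in> Basis" for b
  proof -
    have "b \<in> (\<lambda>(i, j). axis i (axis j 1)) ` UNIV"
      using bij_betw_axis2 that by (metis bij_betw_imp_surj_on)
    then obtain i j where "b = axis i (axis j 1)" by auto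
    then show ?thesis using r[of i] r[of j] by (simp add: cb)
  qed
  have "(\<Prod>b\<in>Basis. \<bar>c b\<bar>) = (\<Prod>(i, j)\<in>UNIV. r i * r j)"
    using prod.reindex_bij_betw[OF bij_betw_axis2, of "\<lambda>b. \<bar>c b\<bar>"] r
    by (simp add: case_prod_unfold cb abs_mult abs_of_pos)
  also have "\<dots> = (\<Prod>i\<in>UNIV. \<Prod>j\<in>UNIV. r i * r j)"
    by (simp add: prod.cartesian_product case_prod_unfold)
  also have "\<dots> = (\<Prod>i\<in>UNIV. r i) ^ (2 * CARD('p))"
    by (simp add: prod.distrib power_mult power2_eq_square prod_power_distrib mult_2 power_add)
  finally have K: "(\<Prod>b\<in>Basis. \<bar>c b\<bar>) = (\<Prod>i\<in>UNIV. r i) ^ (2 * CARD('p))" .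
  have [measurable]: "T \<in> borel_measurable borel"
    unfolding T_def by (intro borel_measurable_continuous_onI continuous_intros)
  have "lborel = density (distr lborel borel T) (\<lambda>_. ennreal (\<Prod>b\<in>Basis. \<bar>c b\<bar>))"
    using lborel_affine_euclidean[of c 0] cn by (simp add: T[abs_def])
  then have "(\<integral>\<^sup>+Y. f Y \<partial>lborel) = (\<integral>\<^sup>+Y. f Y \<partial>density (distr lborel borel T) (\<lambda>_. ennreal (\<Prod>b\<in>Basis. \<bar>c b\<bar>)))" for f
    by metis
  note dens = this
  have lb: "(\<integral>\<^sup>+Y. f Y \<partial>lborel) = ennreal (\<Prod>b\<in>Basis. \<bar>c b\<bar>) * (\<integral>\<^sup>+Y. f (T Y) \<partial>lborel)" if [measurable]: "f \<in> borel_measurable borel" for f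
    by (subst dens) (simp add: nn_integral_density nn_integral_distr nn_integral_cmult)
  have "diagm r ** herm_of Y ** cadj (diagm r) = herm_of (T Y)" for Y
  proof -
    have "(diagm r ** herm_of Y ** diagm r) $ i $ j = r i * r j * herm_of Y $ i $ j" for i j
      by (simp add: diagm_def matrix_matrix_mult_def sum_distrib_right if_distrib[of "\<lambda>x. x * _"]
         if_distrib[of "\<lambda>x. _ * x"] cong: if_cong)
    then show ?thesis
      by (auto simp: vec_eq_iff herm_of_def T_def complex_eq_iff)
  qed
  then have "jacH (diagm r) = (\<integral>\<^sup>+Y. indicator (unit_herm :: 'p cmat set) (herm_of (T Y)) \<partial>lborel)"
  proof -
    have m: "(\<lambda>X :: 'p cmat. indicator unit_herm (diagm r ** X ** cadj (diagm r)) :: ennreal) \<in> borel_measurable borel"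
      by measurable
    assume "\<And>Y. diagm r ** herm_of Y ** cadj (diagm r) = herm_of (T Y)"
    then show ?thesis unfolding jacH_def nn_integral_lebH[OF m] by metis
  qed
  then have "ennreal (\<Prod>b\<in>Basis. \<bar>c b\<bar>) * jacH (diagm r) = (\<integral>\<^sup>+Y. indicator (unit_herm :: 'p cmat set) (herm_of Y) \<partial>lborel)"
    using lb[of "\<lambda>Y. indicator (unit_herm :: 'p cmat set) (herm_of Y)"] by simp
  also have "\<dots> = emeasure lebH (unit_herm :: 'p cmat set)"
    by (subst nn_integral_lebH[symmetric]) simp_all
  finally show ?thesis by (simp add: K emeasure_unit_herm mult.commute)
qed

lemma jacH_pd:
  fixes R :: "'p::{finite,linorder} cmat"
  assumes "pd R"
  shows "jacH R * ennreal (Re (det R) ^ (2 * CARD('p))) = 1"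
  using assms
proof (induction rule: pd_elimination_induct)
  case (diag r) then show ?case by (simp add: det_diagm jacH_diagm del: of_real_prod)
next
  case (step X q v)
  obtain X' where X': "X ** X' = mat 1" using pd_imp_inverse[OF step(1)] by metis
  have i: "shear q v ** shear q (- v) = mat 1" "shear q (- v) ** shear q v = mat 1"
    using step(2) by (simp_all add: shear_mult)
  then have j: "cadj (shear q v) ** cadj (shear q (- v)) = mat 1" by (metis cadj_mat_1 cadj_mult)
  have k: "(shear q v ** X) ** (X' ** shear q (- v)) = mat 1"
  proof -
    have "(shear q v ** X) ** (X' ** shear q (- v)) = shear q v ** (X ** X') ** shear q (- v)"
      by (simp add: matrix_mul_assoc)
    then show ?thesis by (simp add: X' i)
  qed
  have "jacH (shear q v ** X ** cadj (shear q v)) = jacH X"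
    using multiplicative_shear[where f=jacH, OF jacH_mult jacH_1 step(2)]
    by (simp add: jacH_mult[OF k j] jacH_mult[OF i(1) X'])
  then show ?case using step by (simp add: det_mul det_shear)
qed

text \<open>Written with \<open>R ** R\<close> because \<open>R\<close> will be a square root of a
  range D, whose Jacobian is then a power of det D.\<close>

lemma nn_integral_pd_congr:
  fixes R :: "'p::{finite,linorder} cmat"
  assumes R: "pd R" and [measurable]: "f \<in> borel_measurable borel"
  shows "(\<integral>\<^sup>+X. f X \<partial>lebH) = ennreal (Re (det (R ** R)) ^ CARD('p)) * (\<integral>\<^sup>+X. f (R ** X ** R) \<partial>lebH)"
proof -
  obtain R' where "R ** R' = mat 1" using pd_imp_inverse[OF R] by metis
  from nn_integral_congr[OF this, of f] pdD(1)[OF R]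
  have "(\<integral>\<^sup>+X. f (R ** X ** R) \<partial>lebH) = jacH R * (\<integral>\<^sup>+X. f X \<partial>lebH)"
    by (simp add: hermitian_def)
  moreover have "Re (det (R ** R)) ^ CARD('p) = Re (det R) ^ (2 * CARD('p))"
    using det_pd(1)[OF R] by (simp add: det_mul power_mult power2_eq_square)
      (metis Re_complex_of_real mult_zero_right of_real_mult diff_zero Im_complex_of_real)
  ultimately have "ennreal (Re (det (R ** R)) ^ CARD('p)) * (\<integral>\<^sup>+X. f (R ** X ** R) \<partial>lebH)
      = (jacH R * ennreal (Re (det R) ^ (2 * CARD('p)))) * (\<integral>\<^sup>+X. f X \<partial>lebH)"
    by (simp add: mult_ac)
  then show ?thesis by (simp add: jacH_pd[OF R])
qed

subsection \<open>The boundary of the cone is negligible\<close>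

lemma measurable_pd [measurable]: "Measurable.pred borel (pd :: complex^'p^'p \<Rightarrow> bool)"
proof -
  have "{A. pd A} = {A. hermitian A} - {A :: complex^'p^'p. \<exists>v. v \<in> sphere 0 1 \<and> Re (qform A v) \<le> 0}"
    by (auto simp: pd_sphere not_le Ball_def)
  also have "\<dots> \<in> sets borel"
    by (intro sets.Diff borel_closed closed_hermitian closed_not_pd)
  finally show ?thesis by (simp add: pred_def)
qed

lemma measurable_psd [measurable]: "Measurable.pred borel (psd :: complex^'p^'p \<Rightarrow> bool)"
  by (auto simp: pred_def intro!: borel_closed closed_psd)

lemma measurable_hermitian [measurable]: "Measurable.pred borel (hermitian :: complex^'p^'p \<Rightarrow> bool)"
  by (auto simp: pred_def intro!: borel_closed closed_hermitian)

text \<open>A semidefinite but not definite matrix leaves the cone when a small multiple of the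
  identity is subtracted, so it lies on the frontier of a convex set, and such frontiers are
  null.\<close>

lemma AE_psd_imp_pd: "AE X in (lebH :: 'p::{finite,linorder} cmat measure). psd X \<longrightarrow> pd X"
proof -
  define P where "P = {Y :: 'p rmat. psd (herm_of Y)}"
  have conv: "convex P"
    unfolding P_def by (intro convexI)
     (simp add: linear_add[OF linear_herm_of] linear_scale[OF linear_herm_of] psd_add psd_scaleR)
  have sub: "{Y. psd (herm_of Y) \<and> \<not> pd (herm_of Y)} \<subseteq> frontier P"
  proof clarify
    fix Y :: "'p rmat" assume Y: "psd (herm_of Y)" "\<not> pd (herm_of Y)"
    then obtain v where v: "v \<noteq> 0" "Re (qform (herm_of Y) v) \<le> 0"
      by (auto simp: pd_def psd_def not_less)
    have "Y \<notin> interior P"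
    proof
      assume "Y \<in> interior P"
      then obtain e where e: "e > 0" "ball Y e \<subseteq> P" by (auto simp: mem_interior)
      define I :: "'p rmat" where "I = unherm (mat 1)"
      \<comment> \<open>Small enough for \<open>Y - d *\<^sub>R I\<close> to remain in the ball
        around \<open>Y\<close>.\<close>
      define d where "d = e / (2 * (norm I + 1))"
      have n: "0 < norm I + 1" by (simp add: add_nonneg_pos)
      have "e * norm I < e * (2 * (norm I + 1))"
        using e(1) n by (intro mult_strict_left_mono) auto
      then have d: "d > 0" "d * norm I < e" using e(1) n
        by (simp_all add: d_def pos_divide_less_eq)
      have "dist Y (Y - d *\<^sub>R I) < e" using d by (simp add: dist_norm)
      then have "Y - d *\<^sub>R I \<in> P" using e(2) by auto
      then have "psd (herm_of Y - d *\<^sub>R mat 1)"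
        by (simp add: P_def I_def linear_diff[OF linear_herm_of] linear_scale[OF linear_herm_of] herm_of_unherm)
      then have "0 \<le> Re (qform (herm_of Y) v) - d * (norm v)\<^sup>2"
        using psdD(2)[of "herm_of Y - d *\<^sub>R mat 1" v] by (simp add: qform_diff qform_scaleR qform_mat_1 del: of_real_power)
      moreover have "d * (norm v)\<^sup>2 > 0" using d v(1) by simp
      ultimately show False using v(2) by linarith
    qed
    moreover have "Y \<in> P" using Y by (simp add: P_def)
    ultimately show "Y \<in> frontier P" using closure_subset[of P] by (auto simp: frontier_def)
  qed
  have "negligible {Y :: 'p rmat. psd (herm_of Y) \<and> \<not> pd (herm_of Y)}"
    using negligible_convex_frontier[OF conv] negligible_subset sub by blast
  moreover have "{Y :: 'p rmat. psd (herm_of Y) \<and> \<not> pd (herm_of Y)} \<in> sets borel" by measurable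
  ultimately have "{Y :: 'p rmat. psd (herm_of Y) \<and> \<not> pd (herm_of Y)} \<in> null_sets lborel"
    by (simp add: negligible_iff_null_sets null_sets_completion_iff)
  then have "AE Y in lborel. \<not> (psd (herm_of Y) \<and> \<not> pd (herm_of (Y :: 'p rmat)))"
    by (drule_tac AE_not_in) simp
  then show ?thesis
  proof -
    assume *: "AE Y in lborel. \<not> (psd (herm_of Y) \<and> \<not> pd (herm_of (Y :: 'p rmat)))"
    have "{X :: 'p cmat. psd X \<longrightarrow> pd X} \<in> sets borel" by measurable
    then show ?thesis
      using * unfolding lebH_def by (subst AE_distr_iff) simp_all
  qed
qed

subsection \<open>The matrix Gamma integral\<close>

lemma measurable_rmat:
  fixes f :: "'a \<Rightarrow> real^'p^'p"
  assumes "\<And>i j. (\<lambda>x. f x $ i $ j) \<in> borel_measurable M"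
  shows "f \<in> borel_measurable M"
proof (subst borel_measurable_euclidean_space, intro ballI)
  fix b :: "real^'p^'p" assume "b \<in> Basis"
  then have "b \<in> (\<lambda>(i, j). axis i (axis j 1)) ` UNIV"
    using bij_betw_axis2 by (metis bij_betw_imp_surj_on)
  then obtain i j where "b = axis i (axis j 1)" by auto
  then show "(\<lambda>x. f x \<bullet> b) \<in> borel_measurable M"
    using assms[of i j] by (simp add: inner_axis)
qed

interpretation lborel_product: product_sigma_finite "\<lambda>_. lborel :: real measure"
  by unfold_locales

text \<open>As a product over index pairs, Lebesgue measure can be integrated one row and column at
  a time.\<close>

lemma lborel_rmat_eq_PiM:
  "(lborel :: (real^'p^'p) measure) =
    distr (Pi\<^sub>M UNIV (\<lambda>_. lborel)) borel (\<lambda>y. \<chi> i j. y (i, j))"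
proof (rule lborel_eqI)
  let ?f = "\<lambda>y. (\<chi> i j. y (i, j)) :: real^'p^'p"
  have m: "?f \<in> borel_measurable (Pi\<^sub>M UNIV (\<lambda>_. lborel))"
    by (rule measurable_rmat) simp
  fix l u :: "real^'p^'p" assume lu: "\<And>b. b \<in> Basis \<Longrightarrow> l \<bullet> b \<le> u \<bullet> b"
  have in_B: "axis i (axis j 1) \<in> (Basis :: (real^'p^'p) set)" for i j
    using bij_betw_axis2 bij_betw_imp_surj_on by fastforce
  have box: "x \<in> box l u \<longleftrightarrow> (\<forall>i j. l $ i $ j < x $ i $ j \<and> x $ i $ j < u $ i $ j)" for x
  proof -
    have "x \<in> box l u \<longleftrightarrow> (\<forall>b\<in>(\<lambda>(i, j). axis i (axis j 1)) ` UNIV. l \<bullet> b < x \<bullet> b \<and> x \<bullet> b < u \<bullet> b)"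
      using bij_betw_imp_surj_on[OF bij_betw_axis2[where 'p='p]] by (simp add: mem_box)
    then show ?thesis by (simp add: inner_axis)
  qed
  have "emeasure (distr (Pi\<^sub>M UNIV (\<lambda>_. lborel)) borel ?f) (box l u)
      = emeasure (Pi\<^sub>M UNIV (\<lambda>_. lborel)) (Pi\<^sub>E UNIV (\<lambda>(i, j). {l $ i $ j <..< u $ i $ j}))"
    by (subst emeasure_distr[OF m])
       (auto simp: box space_PiM PiE_iff intro!: arg_cong2[where f=emeasure])
  also have "\<dots> = (\<Prod>k\<in>UNIV. emeasure lborel (case k of (i, j) \<Rightarrow> {l $ i $ j <..< u $ i $ j}))"
    by (subst lborel_product.emeasure_PiM) (auto simp: case_prod_unfold)
  also have "\<dots> = (\<Prod>k\<in>UNIV. ennreal (case k of (i, j) \<Rightarrow> (u - l) \<bullet> axis i (axis j 1)))"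
    using lu[OF in_B] by (intro prod.cong refl) (auto simp: inner_axis)
  also have "\<dots> = ennreal (\<Prod>k\<in>UNIV. case k of (i, j) \<Rightarrow> (u - l) \<bullet> axis i (axis j 1))"
    using lu[OF in_B] by (intro prod_ennreal) (auto simp: inner_axis)
  also have "(\<Prod>k\<in>UNIV. case k of (i, j) \<Rightarrow> (u - l) \<bullet> axis i (axis j 1)) = (\<Prod>b\<in>Basis. (u - l) \<bullet> b)"
    using prod.reindex_bij_betw[OF bij_betw_axis2, of "\<lambda>b. (u - l) \<bullet> b"] by (simp add: case_prod_unfold)
  finally show "emeasure (distr (Pi\<^sub>M UNIV (\<lambda>_. lborel)) borel ?f) (box l u) = ennreal (\<Prod>b\<in>Basis. (u - l) \<bullet> b)" .
qed simp

text \<open>Absorbs the rank one correction that an elimination step leaves in the remaining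
  coordinates.\<close>

lemma nn_integral_PiM_lborel_shift:
  fixes w :: "'i \<Rightarrow> real"
  assumes J: "finite J" and [measurable]: "h \<in> borel_measurable (Pi\<^sub>M J (\<lambda>_. lborel))"
  shows "(\<integral>\<^sup>+y. h (\<lambda>k\<in>J. y k - w k) \<partial>Pi\<^sub>M J (\<lambda>_. lborel)) = (\<integral>\<^sup>+y. h y \<partial>Pi\<^sub>M J (\<lambda>_. lborel))"
proof -
  let ?M = "Pi\<^sub>M J (\<lambda>_. lborel :: real measure)"
  let ?T = "\<lambda>y. \<lambda>k\<in>J. y k - w k"
  have m [measurable]: "?T \<in> measurable ?M ?M" by measurable
  have "distr ?M ?M ?T = ?M"
  proof (rule lborel_product.PiM_eqI[OF J])
    fix A :: "'i \<Rightarrow> real set" assume A: "\<And>i. i \<in> J \<Longrightarrow> A i \<in> sets lborel"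
    have sets: "(\<lambda>x. x - w i) -` A i \<in> sets lborel" if "i \<in> J" for i
      using measurable_sets[of "\<lambda>x. x - w i" borel borel "A i"] A[OF that] by simp
    have "emeasure (distr ?M ?M ?T) (Pi\<^sub>E J A) = emeasure ?M (Pi\<^sub>E J (\<lambda>i. (\<lambda>x. x - w i) -` A i))"
      using A J by (subst emeasure_distr[OF m])
        (auto simp: space_PiM PiE_iff intro!: arg_cong2[where f=emeasure] sets_PiM_I_finite)
    also have "\<dots> = (\<Prod>i\<in>J. emeasure lborel ((\<lambda>x. x - w i) -` A i))"
      using sets J by (intro lborel_product.emeasure_PiM) auto
    also have "\<dots> = (\<Prod>i\<in>J. emeasure lborel (A i))"
    proof (intro prod.cong refl)
      fix i assume i: "i \<in> J"
      have "emeasure lborel (A i) = emeasure (distr lborel borel ((+) (- w i))) (A i)"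
        by (simp add: lborel_distr_plus)
      also have "\<dots> = emeasure lborel ((\<lambda>x. x - w i) -` A i)"
        using A[OF i] by (subst emeasure_distr) (auto intro!: arg_cong2[where f=emeasure])
      finally show "emeasure lborel ((\<lambda>x. x - w i) -` A i) = emeasure lborel (A i)" ..
    qed
    finally show "emeasure (distr ?M ?M ?T) (Pi\<^sub>E J A) = (\<Prod>i\<in>J. emeasure lborel (A i))" .
  qed simp
  then have "(\<integral>\<^sup>+y. h y \<partial>?M) = (\<integral>\<^sup>+y. h y \<partial>distr ?M ?M ?T)" by metis
  also have "\<dots> = (\<integral>\<^sup>+y. h (?T y) \<partial>?M)" by (rule nn_integral_distr) measurable
  finally show ?thesis ..
qed

text \<open>\<open>s\<close> stands for the exponent a - p of the densities. It can be natural
  because every Beta parameter in the theorem is a positive multiple of p.\<close>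

definition pd_det_pow :: "nat \<Rightarrow> complex^'p^'p \<Rightarrow> ennreal" where
  "pd_det_pow s X = (if pd X then ennreal (Re (det X) ^ s) else 0)"

lemma measurable_det [measurable]: "(det :: complex^'p^'p \<Rightarrow> complex) \<in> borel_measurable borel"
  unfolding det_def by (intro borel_measurable_continuous_onI continuous_intros)

lemma measurable_pd_det_pow [measurable]:
  "(pd_det_pow s :: complex^'p^'p \<Rightarrow> ennreal) \<in> borel_measurable borel"
  unfolding pd_det_pow_def by measurable

lemma measurable_tr [measurable]: "(tr :: complex^'p^'p \<Rightarrow> real) \<in> borel_measurable borel"
  unfolding tr_def by (intro borel_measurable_continuous_onI continuous_intros)

lemma pd_det_pow_congr:
  assumes "pd R"
  shows "pd_det_pow s (R ** X ** R) = ennreal (Re (det (R ** R)) ^ s) * pd_det_pow s X"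
proof -
  obtain R' where R': "R' ** R = mat 1" using pd_imp_inverse[OF assms] by metis
  have "cadj R = R" using pdD(1)[OF assms] by (simp add: hermitian_def)
  then have iff: "pd (R ** X ** R) \<longleftrightarrow> pd X" using pd_congr_iff[OF R', of X] by simp
  obtain r where r: "det R = complex_of_real r" "r > 0" using det_pd[OF assms] by metis
  have "Re (det (R ** X ** R)) = Re (det (R ** R)) * Re (det X)" if "pd X"
    using det_pd[OF that] r by (simp add: det_mul mult_ac)
  moreover have "0 \<le> Re (det (R ** R))" using r by (simp add: det_mul)
  ultimately show ?thesis
    using det_pd(2)[of X] by (cases "pd X") (simp_all add: pd_det_pow_def iff power_mult_distrib ennreal_mult)
qed

text \<open>Padding with the identity outside \<open>J\<close> keeps submatrices of every size in
  one type and changes neither their determinant nor their positivity.\<close>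

definition herm_on :: "'p::{finite,linorder} set \<Rightarrow> ('p \<times> 'p \<Rightarrow> real) \<Rightarrow> 'p cmat" where
  "herm_on J y = herm_of (\<chi> i j. if i \<in> J \<and> j \<in> J then y (i, j) else if i = j then 1 else 0)"

lemma measurable_herm_on [measurable]:
  "herm_on J \<in> borel_measurable (Pi\<^sub>M (J \<times> J) (\<lambda>_. lborel))"
proof -
  have "(\<lambda>y. \<chi> i j. if i \<in> J \<and> j \<in> J then y (i, j) else if i = j then 1 else 0)
      \<in> borel_measurable (Pi\<^sub>M (J \<times> J) (\<lambda>_. lborel :: real measure))"
  proof (rule measurable_rmat)
    fix i j :: 'a
    show "(\<lambda>y. (\<chi> i j. if i \<in> J \<and> j \<in> J then y (i, j) else if i = j then 1 else 0) $ i $ j)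
      \<in> borel_measurable (Pi\<^sub>M (J \<times> J) (\<lambda>_. lborel :: real measure))"
      by (cases "i \<in> J \<and> j \<in> J") (auto intro!: measurable_component_singleton simp: measurable_lborel1)
  qed
  from measurable_compose[OF this measurable_herm_of] show ?thesis unfolding herm_on_def[abs_def] .
qed

text \<open>The value of the Gamma integral in size \<open>k\<close>. Eliminating one index next to
  \<open>k\<close> others gives \<open>k\<close> complex Gaussian integrals, hence
  \<open>pi ^ k\<close>, and a Gamma integral of order \<open>s + k\<close> over the pivot.\<close>

fun gamH :: "nat \<Rightarrow> nat \<Rightarrow> real" where
  "gamH s 0 = 1"
| "gamH s (Suc k) = gamH s k * (pi ^ k * fact (s + k))"

lemma gamH_pos: "0 < gamH s k"
  by (induction k) simp_all

text \<open>Eliminating the index \<open>q\<close> shifts the remaining coordinates by those of a rank one matrix.\<close>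

definition elim_shift :: "'p::{finite,linorder} \<Rightarrow> ('p \<times> 'p \<Rightarrow> real) \<Rightarrow> 'p \<times> 'p \<Rightarrow> real" where
  "elim_shift q y = (\<lambda>(i, j).
     let c = (\<lambda>i. if i < q then Complex (y (i, q)) (y (q, i)) else Complex (y (q, i)) (- y (i, q)))
     in unherm (\<chi> i j. c i * cnj (c j) / complex_of_real (y (q, q))) $ i $ j)"

lemma elim_shift_cong:
  "(\<And>i. i = q \<or> i \<in> J \<Longrightarrow> y (i, q) = y' (i, q) \<and> y (q, i) = y' (q, i)) \<Longrightarrow> i \<in> J \<Longrightarrow> j \<in> J \<Longrightarrow>
    elim_shift q y (i, j) = elim_shift q y' (i, j)"
  by (simp add: elim_shift_def unherm_def)

lemma elim_shift_diag:
  assumes "i \<noteq> q"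
  shows "elim_shift q y (i, i) = ((y (i, q))\<^sup>2 + (y (q, i))\<^sup>2) / y (q, q)"
  by (simp add: elim_shift_def unherm_def power2_eq_square)

text \<open>A shear clears row and column \<open>q\<close> and leaves the pivot beside the Schur
  complement. The shear has determinant 1, so the pivot factors out of the determinant.\<close>

lemma herm_on_insert:
  fixes J :: "'p::{finite,linorder} set"
  assumes q: "q \<notin> J" and d: "0 < y (q, q)"
  defines "X' \<equiv> herm_on J (\<lambda>k. y k - elim_shift q y k)"
  shows "pd (herm_on (insert q J) y) \<longleftrightarrow> pd X'"
    and "det (herm_on (insert q J) y) = y (q, q) * det X'"
proof -
  define X where "X = herm_on (insert q J) y"
  define c where "c i = (if i < q then Complex (y (i, q)) (y (q, i)) else Complex (y (q, i)) (- y (i, q)))" for i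
  define v :: "(complex, 'p) vec" where "v = (\<chi> i. if i \<in> J then c i / y (q, q) else 0)"
  \<comment> \<open>Congruence with the diagonal matrix \<open>E\<close> replaces the padding entry
    1 of \<open>X'\<close> at \<open>q\<close> by the pivot.\<close>
  define e where "e i = (if i = q then sqrt (y (q, q)) else 1)" for i
  define E :: "'p cmat" where "E = diagm e"
  have Xq: "X $ q $ q = y (q, q)" by (simp add: X_def herm_on_def herm_of_def)
  have Xiq: "X $ i $ q = (if i \<in> J then c i else 0)" "X $ q $ i = (if i \<in> J then cnj (c i) else 0)" if "i \<noteq> q" for i
    using that q by (auto simp: X_def herm_on_def herm_of_def c_def complex_eq_iff)
  have v: "(- v) $ q = 0" using q by (simp add: v_def)
  have X'ij: "X' $ i $ j = (if i \<in> J \<and> j \<in> J then X $ i $ j - c i * cnj (c j) / y (q, q) else if i = j then 1 else 0)" for i j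
    using q
    by (cases i j rule: linorder_cases)
       (auto simp: X'_def X_def herm_on_def herm_of_def elim_shift_def unherm_def complex_eq_iff c_def[symmetric]
         diff_divide_distrib not_le Let_def mult.commute)
  have EX: "(E ** X' ** cadj E) $ i $ j = complex_of_real (e i) * complex_of_real (e j) * X' $ i $ j" for i j
    unfolding E_def cadj_diagm
    by (simp add: diagm_def matrix_matrix_mult_def sum_distrib_right if_distrib[of "\<lambda>x. x * _"]
         if_distrib[of "\<lambda>x. _ * x"] cong: if_cong)
  have sq: "complex_of_real (sqrt (y (q, q))) * complex_of_real (sqrt (y (q, q))) = y (q, q)"
    using d by (simp flip: of_real_mult)
  have Xout: "X $ i $ j = (if i = j then 1 else 0)" if "i \<notin> insert q J \<or> j \<notin> insert q J" for i j
    using that by (auto simp: X_def herm_on_def herm_of_def complex_eq_iff)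
  have "(shear q (- v) ** X ** cadj (shear q (- v))) $ i $ j = (E ** X' ** cadj E) $ i $ j" for i j
    unfolding shear_congr_nth EX X'ij
    using q d Xout[of i j] by (cases "i = q"; cases "j = q") (auto simp: Xq Xiq v_def sq e_def field_simps)
  then have eq: "shear q (- v) ** X ** cadj (shear q (- v)) = E ** X' ** cadj E"
    by (simp add: vec_eq_iff)
  have "diagm (\<lambda>i. if i = q then 1 / sqrt (y (q, q)) else 1) ** E = mat 1"
    using d unfolding E_def diagm_mult diagm_1[symmetric] by (intro arg_cong[where f=diagm]) (auto simp: e_def)
  then have "pd (E ** X' ** cadj E) \<longleftrightarrow> pd X'" by (rule pd_congr_iff)
  then show "pd X \<longleftrightarrow> pd X'" using pd_shear_iff[OF v, of X] by (simp add: eq)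
  have "(\<Prod>i\<in>UNIV. e i) = sqrt (y (q, q))" by (simp add: e_def)
  then have "det E = sqrt (y (q, q))" unfolding E_def det_diagm by simp
  then have "det (E ** X' ** cadj E) = y (q, q) * det X'"
    using sq by (simp add: det_mul E_def mult_ac)
  then show "det X = y (q, q) * det X'"
    using det_shear[OF v] by (simp add: det_mul flip: eq)
qed

text \<open>The normal density of variance d/2 has total mass 1.\<close>

lemma nn_integral_gauss:
  fixes d :: real
  assumes "0 < d"
  shows "(\<integral>\<^sup>+t. ennreal (exp (- (t\<^sup>2 / d))) \<partial>lborel) = ennreal (sqrt (pi * d))"
proof -
  have "(\<integral>\<^sup>+t. ennreal (normal_density 0 (sqrt (d / 2)) t) \<partial>lborel) = 1"
    using assms prob_space.emeasure_space_1[OF prob_space_normal_density[of "sqrt (d / 2)" 0]]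
    by (simp add: emeasure_density)
  moreover have "normal_density 0 (sqrt (d / 2)) t = 1 / sqrt (pi * d) * exp (- (t\<^sup>2 / d))" for t
    using assms by (simp add: normal_density_def)
  moreover have "(\<integral>\<^sup>+t. ennreal (1 / sqrt (pi * d) * exp (- (t\<^sup>2 / d))) \<partial>lborel)
      = ennreal (1 / sqrt (pi * d)) * (\<integral>\<^sup>+t. ennreal (exp (- (t\<^sup>2 / d))) \<partial>lborel)"
    using assms by (subst nn_integral_cmult[symmetric]) (auto simp: ennreal_mult'[symmetric])
  ultimately have 1: "ennreal (1 / sqrt (pi * d)) * (\<integral>\<^sup>+t. ennreal (exp (- (t\<^sup>2 / d))) \<partial>lborel) = 1"
    by simp
  have "(\<integral>\<^sup>+t. ennreal (exp (- (t\<^sup>2 / d))) \<partial>lborel)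
      = ennreal (sqrt (pi * d)) * (ennreal (1 / sqrt (pi * d)) * (\<integral>\<^sup>+t. ennreal (exp (- (t\<^sup>2 / d))) \<partial>lborel))"
    using assms by (simp add: mult.assoc[symmetric] ennreal_mult'[symmetric])
  then show ?thesis by (simp add: 1)
qed

lemma nn_integral_gamma:
  "(\<integral>\<^sup>+d. (if 0 < d then ennreal (d ^ k * exp (- d)) else 0) \<partial>lborel) = ennreal (fact k)"
proof -
  have "(\<integral>\<^sup>+d. (if 0 < d then ennreal (d ^ k * exp (- d)) else 0) \<partial>lborel) =
      (\<integral>\<^sup>+d. ennreal (d ^ k * exp (- d)) * indicator {0..} d \<partial>lborel)"
    using AE_lborel_singleton[of "0::real"] by (intro nn_integral_cong_AE) (auto simp: indicator_def elim!: eventually_mono)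
  then show ?thesis by (simp add: nn_intergal_power_times_exp_Ici)
qed

definition gamma_on :: "nat \<Rightarrow> 'p::{finite,linorder} set \<Rightarrow> ('p \<times> 'p \<Rightarrow> real) \<Rightarrow> ennreal" where
  "gamma_on s J y = pd_det_pow s (herm_on J y) * ennreal (exp (- (\<Sum>i\<in>J. y (i, i))))"

lemma measurable_gamma_on [measurable]:
  "gamma_on s J \<in> borel_measurable (Pi\<^sub>M (J \<times> J) (\<lambda>_. lborel))"
proof -
  have [measurable]: "(\<lambda>y. \<Sum>i\<in>J. y (i, i)) \<in> borel_measurable (Pi\<^sub>M (J \<times> J) (\<lambda>_. lborel :: real measure))"
    by (intro borel_measurable_sum) (auto intro!: measurable_component_singleton simp: measurable_lborel1)
  show ?thesis unfolding gamma_on_def[abs_def] by measurable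
qed

lemma gamma_on_restrict: "gamma_on s J (\<lambda>k\<in>J \<times> J. y k) = gamma_on s J y"
proof -
  have "herm_on J (\<lambda>k\<in>J \<times> J. y k) = herm_on J y"
    by (simp add: herm_on_def herm_of_def vec_eq_iff)
  then show ?thesis by (simp add: gamma_on_def)
qed

lemma gamma_on_cong: "(\<And>k. k \<in> J \<times> J \<Longrightarrow> y k = y' k) \<Longrightarrow> gamma_on s J y = gamma_on s J y'"
proof -
  assume "\<And>k. k \<in> J \<times> J \<Longrightarrow> y k = y' k"
  then have "(\<lambda>k\<in>J \<times> J. y k) = (\<lambda>k\<in>J \<times> J. y' k)" by (simp add: restrict_def fun_eq_iff)
  then show ?thesis by (metis gamma_on_restrict)
qed

text \<open>The trace of the block on \<open>J\<close> exceeds that of its Schur complement by the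
  squares of the entries in row and column \<open>q\<close> over the pivot; these become Gaussian
  factors. A pivot that is not positive excludes definiteness.\<close>

lemma gamma_on_insert:
  assumes q: "q \<notin> J"
  shows "gamma_on s (insert q J) y =
    (if 0 < y (q, q) then ennreal (y (q, q) ^ s * exp (- y (q, q))) *
       ennreal (exp (- (\<Sum>i\<in>J. ((y (i, q))\<^sup>2 + (y (q, i))\<^sup>2) / y (q, q)))) *
       gamma_on s J (\<lambda>k. y k - elim_shift q y k) else 0)"
proof (cases "0 < y (q, q)")
  case True
  define X' where "X' = herm_on J (\<lambda>k. y k - elim_shift q y k)"
  have "(\<Sum>i\<in>J. y (i, i) - elim_shift q y (i, i)) = (\<Sum>i\<in>J. y (i, i)) - (\<Sum>i\<in>J. ((y (i, q))\<^sup>2 + (y (q, i))\<^sup>2) / y (q, q))"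
    using q by (auto simp: sum_subtractf intro!: sum.cong elim_shift_diag)
  then have "exp (- (\<Sum>i\<in>insert q J. y (i, i))) = exp (- y (q, q)) *
      exp (- (\<Sum>i\<in>J. ((y (i, q))\<^sup>2 + (y (q, i))\<^sup>2) / y (q, q))) * exp (- (\<Sum>i\<in>J. y (i, i) - elim_shift q y (i, i)))"
    using q by (simp flip: exp_add)
  moreover have "pd_det_pow s (herm_on (insert q J) y) = ennreal (y (q, q) ^ s) * pd_det_pow s X'"
    using herm_on_insert[OF q, where y=y, OF True] det_pd(2)[of X'] True
    by (cases "pd X'") (simp_all add: pd_det_pow_def X'_def power_mult_distrib ennreal_mult)
  ultimately show ?thesis
    using True by (simp add: gamma_on_def X'_def ennreal_mult mult_ac)
next
  case False
  have "\<not> pd (herm_on (insert q J) y)"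
    using pd_diag_pos(1)[of "herm_on (insert q J) y" q] False by (auto simp: herm_on_def herm_of_def)
  then show ?thesis using False by (simp add: gamma_on_def pd_det_pow_def)
qed

text \<open>For a new index \<open>q\<close> the block on \<open>J\<close> is integrated first,
  where the shift disappears, then row and column \<open>q\<close> as independent Gaussians of
  variance proportional to the pivot, and finally the pivot.\<close>

lemma nn_integral_gamma_on:
  fixes J :: "'p::{finite,linorder} set"
  shows "(\<integral>\<^sup>+y. gamma_on s J y \<partial>Pi\<^sub>M (J \<times> J) (\<lambda>_. lborel)) = ennreal (gamH s (card J))"
proof (induction J rule: infinite_finite_induct)
  case (infinite J) then show ?case by simp
next
  case empty
  have "herm_on {} y = (mat 1 :: 'p cmat)" for y
    by (auto simp: herm_on_def herm_of_def mat_def vec_eq_iff complex_eq_iff)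
  then show ?case by (simp add: gamma_on_def pd_det_pow_def det_I PiM_empty)
next
  case (insert q J)
  let ?PiM = "\<lambda>I. Pi\<^sub>M I (\<lambda>_. lborel :: real measure)"
  \<comment> \<open>Row and column \<open>q\<close> without the pivot.\<close>
  define K where "K = {q} \<times> J \<union> J \<times> {q}"
  have "({q} \<times> J) \<inter> (J \<times> {q}) = {}" using insert(2) by auto
  then have K: "finite K" "(q, q) \<notin> K" "card K = 2 * card J"
    using insert by (simp_all add: K_def card_Un_disjoint card_cartesian_product)
  have fin: "finite (insert (q, q) K)" "finite (J \<times> J)" "insert (q, q) K \<inter> (J \<times> J) = {}"
    using K insert by (auto simp: K_def)
  have split: "insert q J \<times> insert q J = insert (q, q) K \<union> J \<times> J" by (auto simp: K_def)
  \<comment> \<open>What remains after integrating out the coordinates in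
    \<open>J \<times> J\<close>.\<close>
  define g where "g x = (if 0 < x (q, q) then ennreal (x (q, q) ^ s * exp (- x (q, q))) *
       (\<Prod>k\<in>K. ennreal (exp (- ((x k)\<^sup>2 / x (q, q))))) * ennreal (gamH s (card J)) else 0)" for x :: "'p \<times> 'p \<Rightarrow> real"
  have g_meas [measurable]: "g \<in> borel_measurable (?PiM (insert (q, q) K))"
  proof -
    have [measurable]: "(\<lambda>x. x k) \<in> borel_measurable (?PiM (insert (q, q) K))" if "k \<in> insert (q, q) K" for k
      using measurable_component_singleton[OF that, of "\<lambda>_. lborel :: real measure"] by (simp add: measurable_lborel1)
    have [measurable]: "(\<lambda>x. x (q, q)) \<in> borel_measurable (?PiM (insert (q, q) K))" by measurable
    have [measurable]: "(\<lambda>x. \<Prod>k\<in>K. ennreal (exp (- ((x k)\<^sup>2 / x (q, q))))) \<in> borel_measurable (?PiM (insert (q, q) K))"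
      by (rule borel_measurable_prod_ennreal) measurable
    show ?thesis unfolding g_def[abs_def] by measurable
  qed
  have inner: "(\<integral>\<^sup>+y. gamma_on s (insert q J) (merge (insert (q, q) K) (J \<times> J) (x, y)) \<partial>?PiM (J \<times> J)) = g x" for x
  proof (cases "0 < x (q, q)")
    case True
    let ?m = "\<lambda>y. merge (insert (q, q) K) (J \<times> J) (x, y)"
    have mq: "?m y (q, q) = x (q, q)" for y by (simp add: merge_def)
    have mK: "?m y (i, q) = x (i, q)" "?m y (q, i) = x (q, i)" if "i \<in> J" for i y
      using that by (auto simp: merge_def K_def)
    have sumK: "(\<Sum>i\<in>J. ((?m y (i, q))\<^sup>2 + (?m y (q, i))\<^sup>2) / x (q, q)) = (\<Sum>k\<in>K. (x k)\<^sup>2 / x (q, q))" for y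
    proof -
      have "(\<Sum>k\<in>K. (x k)\<^sup>2 / x (q, q)) = (\<Sum>k\<in>{q} \<times> J. (x k)\<^sup>2 / x (q, q)) + (\<Sum>k\<in>J \<times> {q}. (x k)\<^sup>2 / x (q, q))"
        unfolding K_def using insert by (intro sum.union_disjoint) auto
      also have "(\<Sum>k\<in>{q} \<times> J. (x k)\<^sup>2 / x (q, q)) = (\<Sum>i\<in>J. (x (q, i))\<^sup>2 / x (q, q))"
        by (rule sum.reindex_bij_witness[of _ "\<lambda>i. (q, i)" snd]) auto
      also have "(\<Sum>k\<in>J \<times> {q}. (x k)\<^sup>2 / x (q, q)) = (\<Sum>i\<in>J. (x (i, q))\<^sup>2 / x (q, q))"
        by (rule sum.reindex_bij_witness[of _ "\<lambda>i. (i, q)" fst]) auto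
      finally show ?thesis by (simp add: mK sum.distrib add_divide_distrib)
    qed
    have shift: "gamma_on s J (\<lambda>k. ?m y k - elim_shift q (?m y) k) = gamma_on s J (\<lambda>k\<in>J \<times> J. y k - elim_shift q x k)" for y
    proof -
      have "elim_shift q (?m y) (i, j) = elim_shift q x (i, j)" if "i \<in> J" "j \<in> J" for i j
        by (rule elim_shift_cong[where J=J]) (use that mq mK in auto)
      then have "elim_shift q (?m y) k = elim_shift q x k" if "k \<in> J \<times> J" for k
        using that by auto
      moreover have "?m y k = y k" if "k \<in> J \<times> J" for k
        using that insert(2) by (auto simp: merge_def K_def)
      ultimately show ?thesis unfolding gamma_on_restrict by (intro gamma_on_cong) simp
    qed
    have "(\<integral>\<^sup>+y. gamma_on s (insert q J) (?m y) \<partial>?PiM (J \<times> J)) =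
        (\<integral>\<^sup>+y. ennreal (x (q, q) ^ s * exp (- x (q, q))) * ennreal (exp (- (\<Sum>k\<in>K. (x k)\<^sup>2 / x (q, q)))) *
          gamma_on s J (\<lambda>k\<in>J \<times> J. y k - elim_shift q x k) \<partial>?PiM (J \<times> J))"
      using True by (simp only: gamma_on_insert[OF insert(2)] mq sumK shift if_True)
    also have "\<dots> = ennreal (x (q, q) ^ s * exp (- x (q, q))) * ennreal (exp (- (\<Sum>k\<in>K. (x k)\<^sup>2 / x (q, q)))) *
        (\<integral>\<^sup>+y. gamma_on s J (\<lambda>k\<in>J \<times> J. y k - elim_shift q x k) \<partial>?PiM (J \<times> J))"
      by (rule nn_integral_cmult) measurable
    also have "(\<integral>\<^sup>+y. gamma_on s J (\<lambda>k\<in>J \<times> J. y k - elim_shift q x k) \<partial>?PiM (J \<times> J)) = ennreal (gamH s (card J))"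
      using insert(3) fin(2) by (subst nn_integral_PiM_lborel_shift) auto
    also have "ennreal (exp (- (\<Sum>k\<in>K. (x k)\<^sup>2 / x (q, q)))) = (\<Prod>k\<in>K. ennreal (exp (- ((x k)\<^sup>2 / x (q, q)))))"
      using K(1) by (simp add: prod_ennreal exp_sum sum_negf[symmetric] del: sum_negf)
    finally show ?thesis using True by (simp add: g_def)
  next
    case False
    then show ?thesis by (simp add: gamma_on_insert[OF insert(2)] g_def merge_def)
  qed
  have "(\<integral>\<^sup>+y. gamma_on s (insert q J) y \<partial>?PiM (insert q J \<times> insert q J)) = (\<integral>\<^sup>+x. g x \<partial>?PiM (insert (q, q) K))"
    unfolding split inner[symmetric]
    by (rule lborel_product.product_nn_integral_fold[OF fin(3) fin(1,2)])
       (unfold split[symmetric], rule measurable_gamma_on)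
  also have "\<dots> = (\<integral>\<^sup>+d. (\<integral>\<^sup>+x. g (x((q, q) := d)) \<partial>?PiM K) \<partial>lborel)"
    by (rule lborel_product.product_nn_integral_insert_rev[OF K(1,2) g_meas])
  also have "\<dots> = (\<integral>\<^sup>+d. ennreal (pi ^ card J * gamH s (card J)) * (if 0 < d then ennreal (d ^ (s + card J) * exp (- d)) else 0) \<partial>lborel)"
  proof (rule nn_integral_cong)
    fix d :: real
    show "(\<integral>\<^sup>+x. g (x((q, q) := d)) \<partial>?PiM K) =
        ennreal (pi ^ card J * gamH s (card J)) * (if 0 < d then ennreal (d ^ (s + card J) * exp (- d)) else 0)"
    proof (cases "0 < d")
      case True
      have "(\<integral>\<^sup>+x. g (x((q, q) := d)) \<partial>?PiM K) = (\<integral>\<^sup>+x. ennreal (d ^ s * exp (- d)) * ennreal (gamH s (card J)) *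
          (\<Prod>k\<in>K. ennreal (exp (- ((x k)\<^sup>2 / d)))) \<partial>?PiM K)"
      proof (rule nn_integral_cong)
        fix x :: "'p \<times> 'p \<Rightarrow> real"
        have "(\<Prod>k\<in>K. ennreal (exp (- (((x((q, q) := d)) k)\<^sup>2 / d)))) = (\<Prod>k\<in>K. ennreal (exp (- ((x k)\<^sup>2 / d))))"
          using K(2) by (intro prod.cong) auto
        then show "g (x((q, q) := d)) = ennreal (d ^ s * exp (- d)) * ennreal (gamH s (card J)) *
          (\<Prod>k\<in>K. ennreal (exp (- ((x k)\<^sup>2 / d))))"
          using True by (simp add: g_def mult_ac del: fun_upd_apply) (simp add: mult_ac)
      qed
      also have "\<dots> = ennreal (d ^ s * exp (- d)) * ennreal (gamH s (card J)) *
          (\<integral>\<^sup>+x. (\<Prod>k\<in>K. ennreal (exp (- ((x k)\<^sup>2 / d)))) \<partial>?PiM K)"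
        by (intro nn_integral_cmult borel_measurable_prod_ennreal) simp
      also have "(\<integral>\<^sup>+x. (\<Prod>k\<in>K. ennreal (exp (- ((x k)\<^sup>2 / d)))) \<partial>?PiM K) = (\<Prod>k\<in>K. \<integral>\<^sup>+t. ennreal (exp (- (t\<^sup>2 / d))) \<partial>lborel)"
        by (rule lborel_product.product_nn_integral_prod[OF K(1)]) simp
      \<comment> \<open>\<open>K\<close> has \<open>2 * card J\<close> real coordinates, each
        contributing \<open>sqrt (pi * d)\<close>; the power of \<open>d\<close> raises the order of
        the last integral.\<close>
      also have "\<dots> = ennreal ((pi * d) ^ card J)"
        using True by (simp add: nn_integral_gauss K(3) power_mult ennreal_power)
      also have "ennreal (d ^ s * exp (- d)) * ennreal (gamH s (card J)) * ennreal ((pi * d) ^ card J) =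
          ennreal (pi ^ card J * gamH s (card J)) * (if 0 < d then ennreal (d ^ (s + card J) * exp (- d)) else 0)"
        using True gamH_pos[of s "card J"] by (simp add: ennreal_mult'[symmetric] power_mult_distrib power_add mult_ac)
      finally show ?thesis .
    next
      case False then show ?thesis by (simp add: g_def)
    qed
  qed
  also have "\<dots> = ennreal (pi ^ card J * gamH s (card J)) * ennreal (fact (s + card J))"
    unfolding nn_integral_gamma[symmetric] by (rule nn_integral_cmult) measurable
  also have "\<dots> = ennreal (gamH s (card (insert q J)))"
    using insert gamH_pos[of s "card J"] by (simp add: ennreal_mult'[symmetric] mult_ac)
  finally show ?case .
qed

lemma nn_integral_gammaH:
  "(\<integral>\<^sup>+X. pd_det_pow s X * ennreal (exp (- tr X)) \<partial>(lebH :: 'p::{finite,linorder} cmat measure))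
    = ennreal (gamH s CARD('p))"
proof -
  have "(\<integral>\<^sup>+X. pd_det_pow s X * ennreal (exp (- tr X)) \<partial>(lebH :: 'p cmat measure)) =
      (\<integral>\<^sup>+Y. pd_det_pow s (herm_of Y :: 'p cmat) * ennreal (exp (- tr (herm_of Y))) \<partial>lborel)"
    by (rule nn_integral_lebH) measurable
  also have "\<dots> = (\<integral>\<^sup>+y. gamma_on s (UNIV :: 'p set) y \<partial>Pi\<^sub>M UNIV (\<lambda>_. lborel))"
  proof -
    define F where "F Y = pd_det_pow s (herm_of Y :: 'p cmat) * ennreal (exp (- tr (herm_of Y)))" for Y
    have m: "F \<in> borel_measurable borel" unfolding F_def[abs_def] by measurable
    have F: "F (\<chi> i j. y (i, j)) = gamma_on s UNIV y" for y
      by (simp add: F_def gamma_on_def herm_on_def) (simp add: tr_def herm_of_def)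
    have "(\<integral>\<^sup>+Y. F Y \<partial>lborel) = (\<integral>\<^sup>+y. F (\<chi> i j. y (i, j)) \<partial>Pi\<^sub>M UNIV (\<lambda>_. lborel))"
      by (subst lborel_rmat_eq_PiM, rule nn_integral_distr) (auto intro!: measurable_rmat m)
    then have "(\<integral>\<^sup>+Y. F Y \<partial>lborel) = (\<integral>\<^sup>+y. gamma_on s (UNIV :: 'p set) y \<partial>Pi\<^sub>M UNIV (\<lambda>_. lborel))" by (simp only: F)
    then show ?thesis by (simp only: F_def)
  qed
  also have "\<dots> = ennreal (gamH s CARD('p))"
    using nn_integral_gamma_on[where J="UNIV :: 'p set" and s=s] by simp
  finally show ?thesis .
qed

text \<open>Factor \<open>i\<close> of the product is elimination stage \<open>p - i\<close>, and
  the powers of pi add up to p(p-1)/2.\<close>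

lemma gamH_eq_mGamma2: "gamH s p = mGamma2 p (real (s + p))"
proof -
  have "(\<Prod>i=1..p. Gamma (real (s + p) - real i + 1)) = (\<Prod>k<p. fact (s + k))"
  proof (rule prod.reindex_bij_witness[of _ "\<lambda>k. p - k" "\<lambda>i. p - i"])
    fix k assume "k \<in> {1..p}"
    then show "fact (s + (p - k)) = Gamma (real (s + p) - real k + 1)"
      using Gamma_fact[of "s + (p - k)", where 'a=real] by (simp add: of_nat_diff algebra_simps)
  qed auto
  moreover have "gamH s p = pi ^ (\<Sum>k<p. k) * (\<Prod>k<p. fact (s + k))"
    by (induction p) (simp_all add: power_add mult_ac)
  moreover have "pi ^ (\<Sum>k<p. k) = pi powr (real (p * (p - 1)) / 2)"
  proof -
    have "2 * real (\<Sum>k<p. k) = real p * real p - real p" by (induction p) (auto simp: algebra_simps)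
    moreover have "real (p * (p - 1)) = real p * real p - real p" by (cases p) (auto simp: algebra_simps)
    ultimately have "real (\<Sum>k<p. k) = real (p * (p - 1)) / 2" by linarith
    then show ?thesis by (metis pi_gt_zero powr_realpow)
  qed
  ultimately show ?thesis by (simp add: mGamma2_def)
qed

subsection \<open>The matrix Beta integral\<close>

text \<open>In the product of two Gamma integrals the sum \<open>Z\<close> is made the outer
  variable. Scaling \<open>X\<close> by the square root of \<open>Z\<close> turns the inner integral
  into the Beta integral times a power of det Z, where the Jacobian supplies the extra p in
  \<open>?r\<close>; the outer integral is again of Gamma type.\<close>

lemma nn_integral_betaH:
  fixes s t :: nat
  shows "(\<integral>\<^sup>+X. pd_det_pow s X * pd_det_pow t (mat 1 - X) \<partial>(lebH :: 'p::{finite,linorder} cmat measure))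
    = ennreal (mBeta2 CARD('p) (real (s + CARD('p))) (real (t + CARD('p))))"
proof -
  let ?L = "lebH :: 'p cmat measure"
  let ?e = "\<lambda>X :: 'p cmat. ennreal (exp (- tr X))"
  let ?B = "\<integral>\<^sup>+X. pd_det_pow s X * pd_det_pow t (mat 1 - X) \<partial>?L"
  let ?r = "s + t + CARD('p)"
  interpret pair_sigma_finite ?L ?L by (intro pair_sigma_finite.intro sigma_finite_lebH)
  have e: "?e X * ?e (Z - X) = ?e Z" for X Z
    by (simp add: tr_diff ennreal_mult'[symmetric] exp_add[symmetric])
  have "ennreal (gamH s CARD('p)) * ennreal (gamH t CARD('p)) =
      (\<integral>\<^sup>+X. pd_det_pow s X * ?e X * ennreal (gamH t CARD('p)) \<partial>?L)"
    by (simp add: nn_integral_multc nn_integral_gammaH)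
  also have "\<dots> = (\<integral>\<^sup>+X. (\<integral>\<^sup>+Z. pd_det_pow s X * pd_det_pow t (Z - X) * ?e Z \<partial>?L) \<partial>?L)"
  proof (rule nn_integral_cong)
    fix X :: "'p cmat"
    show "pd_det_pow s X * ?e X * ennreal (gamH t CARD('p)) = (\<integral>\<^sup>+Z. pd_det_pow s X * pd_det_pow t (Z - X) * ?e Z \<partial>?L)"
    proof (cases "pd X")
      case True
      have "ennreal (gamH t CARD('p)) = (\<integral>\<^sup>+Z. pd_det_pow t (- X + Z) * ?e (- X + Z) \<partial>?L)"
        using True by (subst nn_integral_lebH_shift[where f="\<lambda>Z. pd_det_pow t Z * ?e Z"])
          (auto simp: nn_integral_gammaH dest!: pdD(1) intro: hermitian_diff[of 0, simplified])
      then have "pd_det_pow s X * ?e X * ennreal (gamH t CARD('p)) =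
          (\<integral>\<^sup>+Z. pd_det_pow s X * ?e X * (pd_det_pow t (Z - X) * ?e (Z - X)) \<partial>?L)"
        by (simp add: nn_integral_cmult)
      also have "\<dots> = (\<integral>\<^sup>+Z. pd_det_pow s X * pd_det_pow t (Z - X) * (?e X * ?e (Z - X)) \<partial>?L)"
        by (simp only: mult_ac)
      finally show ?thesis by (simp only: e)
    next
      case False then show ?thesis by (simp add: pd_det_pow_def[of s])
    qed
  qed
  also have "\<dots> = (\<integral>\<^sup>+Z. (\<integral>\<^sup>+X. pd_det_pow s X * pd_det_pow t (Z - X) * ?e Z \<partial>?L) \<partial>?L)"
    by (rule Fubini'[symmetric]) measurable
  also have "\<dots> = (\<integral>\<^sup>+Z. pd_det_pow ?r Z * ?e Z * ?B \<partial>?L)"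
  proof (rule nn_integral_cong)
    fix Z :: "'p cmat"
    have "(\<integral>\<^sup>+X. pd_det_pow s X * pd_det_pow t (Z - X) \<partial>?L) = pd_det_pow ?r Z * ?B"
    proof (cases "pd Z")
      case True
      define R where "R = msqrt Z"
      have R: "pd R" "R ** R = Z" using msqrt[OF True] by (simp_all add: R_def)
      have ZR: "Z - R ** X ** R = R ** (mat 1 - X) ** R" for X
        by (simp add: matrix_mult_diff_left matrix_mult_diff_right R)
      have "(\<integral>\<^sup>+X. pd_det_pow s X * pd_det_pow t (Z - X) \<partial>?L) =
          ennreal (Re (det Z) ^ CARD('p)) * (\<integral>\<^sup>+X. pd_det_pow s (R ** X ** R) * pd_det_pow t (Z - R ** X ** R) \<partial>?L)"
        using nn_integral_pd_congr[OF R(1), of "\<lambda>X. pd_det_pow s X * pd_det_pow t (Z - X)"] by (simp add: R(2))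
      also have "\<dots> = ennreal (Re (det Z) ^ CARD('p)) *
          (\<integral>\<^sup>+X. ennreal (Re (det Z) ^ s) * ennreal (Re (det Z) ^ t) * (pd_det_pow s X * pd_det_pow t (mat 1 - X)) \<partial>?L)"
        by (simp add: ZR pd_det_pow_congr[OF R(1)] R(2) mult_ac)
      also have "\<dots> = ennreal (Re (det Z) ^ CARD('p)) * (ennreal (Re (det Z) ^ s) * ennreal (Re (det Z) ^ t) * ?B)"
        by (subst nn_integral_cmult) measurable
      also have "\<dots> = pd_det_pow ?r Z * ?B"
        using True det_pd(2)[OF True] by (simp add: pd_det_pow_def power_add ennreal_mult mult_ac)
      finally show ?thesis .
    next
      case False
      \<comment> \<open>\<open>Z\<close> would be definite if both \<open>X\<close> and
        \<open>Z - X\<close> were.\<close>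
      have z: "pd_det_pow s X * pd_det_pow t (Z - X) = 0" for X
        using False pd_add_psd[of X "Z - X"] pd_imp_psd[of "Z - X"] by (auto simp: pd_det_pow_def)
      show ?thesis unfolding z using False by (simp add: pd_det_pow_def[of ?r])
    qed
    then show "(\<integral>\<^sup>+X. pd_det_pow s X * pd_det_pow t (Z - X) * ?e Z \<partial>?L) = pd_det_pow ?r Z * ?e Z * ?B"
      by (subst nn_integral_multc) (auto simp: mult_ac)
  qed
  also have "\<dots> = ennreal (gamH ?r CARD('p)) * ?B"
    by (subst nn_integral_multc) (auto simp: nn_integral_gammaH)
  finally have *: "ennreal (gamH s CARD('p)) * ennreal (gamH t CARD('p)) = ennreal (gamH ?r CARD('p)) * ?B" .
  have "mBeta2 CARD('p) (real (s + CARD('p))) (real (t + CARD('p)))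
      = gamH s CARD('p) * gamH t CARD('p) / gamH ?r CARD('p)"
    by (simp add: mBeta2_def gamH_eq_mGamma2 add_ac)
  then have "ennreal (mBeta2 CARD('p) (real (s + CARD('p))) (real (t + CARD('p))))
      = ennreal (1 / gamH ?r CARD('p)) * (ennreal (gamH s CARD('p)) * ennreal (gamH t CARD('p)))"
    using gamH_pos[of s "CARD('p)"] gamH_pos[of t "CARD('p)"] gamH_pos[of ?r "CARD('p)"]
    by (simp add: ennreal_mult'[symmetric])
  also have "\<dots> = (ennreal (1 / gamH ?r CARD('p)) * ennreal (gamH ?r CARD('p))) * ?B"
    by (simp add: * mult.assoc)
  also have "ennreal (1 / gamH ?r CARD('p)) * ennreal (gamH ?r CARD('p)) = 1"
    using gamH_pos[of ?r "CARD('p)"] by (simp add: ennreal_mult'[symmetric])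
  finally show ?thesis by simp
qed

lemma mBeta2_pos: "0 < mBeta2 p (real (s + p)) (real (t + p))"
proof -
  have "mGamma2 p (real (s + p) + real (t + p)) = gamH (s + t + p) p"
    by (simp add: gamH_eq_mGamma2 add_ac)
  then show ?thesis
    using gamH_pos[of s p] gamH_pos[of t p] gamH_pos[of "s + t + p" p]
    by (simp add: mBeta2_def del: of_nat_add flip: gamH_eq_mGamma2)
qed

subsection \<open>Schur complements in a ring\<close>

text \<open>Lets a rule for a product rewrite inside right-nested products as well.\<close>

lemma assoc_rule: "a * b = c \<Longrightarrow> a * (b * x) = c * x" for a b c x :: "'a::semigroup_mult"
  by (simp flip: mult.assoc)

text \<open>In the lemmas below \<open>e\<close> and \<open>f\<close> are orthogonal idempotents marking the leading corner and the
  last block of a matrix.\<close>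

lemma schur_inverse:
  fixes e :: "'a::ring_1"
  assumes K: "K * B = e" "B * K = e" and B: "B * e = B" "e * B = B"
    and h: "e * h = h" "h * f = h" and r: "f * r = r" "r * e = r"
    and L: "L * M = f" "M * L = f" and M: "f * M = M" "M * f = M" and ef: "e * f = 0" "f * e = 0"
    and Ke: "K * e = K" "e * K = K" and Lf: "f * L = L" "L * f = L"
  defines "X \<equiv> K + h + r + (L + r * B * h)"
    and "N \<equiv> B + B * h * M * r * B - B * h * M - M * r * B + M"
  shows "X * N = e + f" "N * X = e + f"
proof -
  \<comment> \<open>A factor ending in the corner \<open>e\<close> annihilates one beginning in the
    corner \<open>f\<close>.\<close>
  have z: "a * b = 0" if "a * e = a" "f * b = b" for a b
    using that ef by (metis mult.assoc mult_zero_left mult_zero_right)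
  have z': "a * b = 0" if "a * f = a" "e * b = b" for a b
    using that ef by (metis mult.assoc mult_zero_left mult_zero_right)
  have zs: "K * M = 0" "K * r = 0" "h * B = 0" "h * h = 0" "L * B = 0" "M * K = 0" "M * h = 0" "B * r = 0"
      "B * L = 0" "B * M = 0" "r * r = 0" "r * M = 0" "r * L = 0" "h * K = 0" "L * K = 0" "L * h = 0" "M * B = 0" "K * L = 0"
    using z z' assms by blast+
  note rules = K B h r L M Ke Lf zs
  note all = rules rules[THEN assoc_rule]
  show "X * N = e + f" unfolding X_def N_def by (simp add: all algebra_simps)
  show "N * X = e + f" unfolding X_def N_def by (simp add: all algebra_simps)
qed

text \<open>\<open>G\<close> is the parallel sum of \<open>K\<close> and \<open>K'\<close>: with
  \<open>H = K + K'\<close> it equals both \<open>K' * Hi * K\<close> and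
  \<open>K * Hi * K'\<close>, hence inverts \<open>Ki + Ki'\<close>. The unit is the idempotent
  \<open>e\<close>.\<close>

lemma parallel_inverse:
  fixes e :: "'a::ring_1"
  assumes K: "K * Ki = e" "Ki * K = e" and K': "K' * Ki' = e" "Ki' * K' = e"
    and H: "(K + K') * Hi = e" "Hi * (K + K') = e" and Hi: "e * Hi = Hi" "Hi * e = Hi"
    and Ke: "K * e = K" "e * K = K"
  defines "G \<equiv> K - K * Hi * K"
  shows "G * Ki = K' * Hi" "G * Ki' = K * Hi" "Ki * G = Hi * K'" "Ki' * G = Hi * K"
    "G * (Ki + Ki') = e" "(Ki + Ki') * G = e"
proof -
  have H1: "K' * Hi = e - K * Hi" "Hi * K' = e - Hi * K"
    using H by (simp_all add: algebra_simps eq_diff_eq)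
  have G: "G = K' * Hi * K" "G = K * Hi * K'"
    by (simp_all add: G_def H1 Ke algebra_simps mult.assoc)
  show a: "G * Ki = K' * Hi" by (simp add: G(1) mult.assoc K Hi)
  show b: "G * Ki' = K * Hi" by (simp add: G(2) mult.assoc K' Hi)
  show c: "Ki * G = Hi * K'" by (simp add: G(2) mult.assoc[symmetric] K Hi)
  show d: "Ki' * G = Hi * K" by (simp add: G(1) mult.assoc[symmetric] K' Hi)
  show "G * (Ki + Ki') = e" using H(1) by (simp add: distrib_left a b) (simp add: algebra_simps)
  show "(Ki + Ki') * G = e" using H(2) by (simp add: distrib_right c d) (simp add: algebra_simps)
qed

text \<open>The last block column of \<open>G * Gi = e + f\<close> consists of two equations;
  solving the upper one with \<open>B\<close> and inserting it in the lower one leaves the Schur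
  complement times the last block of \<open>Gi\<close>.\<close>

lemma schur_of_inverse:
  fixes e :: "'a::ring_1"
  assumes G: "G * Gi = e + f" "G * (e + f) = G" and B: "B * (e * G * e) = e"
    and ef: "e * e = e" "f * f = f" "e * f = 0" "f * e = 0"
  shows "(f * G * f - f * G * e * B * e * G * f) * (f * Gi * f) = f"
proof -
  have split: "x * G * e * Gi * f + x * G * f * Gi * f = x * (e + f) * f" for x
  proof -
    have "x * G * e * Gi * f + x * G * f * Gi * f = x * (G * (e + f)) * Gi * f" by (simp add: algebra_simps)
    also have "\<dots> = x * (G * Gi) * f" by (simp only: G mult.assoc)
    finally show ?thesis by (simp only: G mult.assoc)
  qed
  have 0: "e * G * f * Gi * f = - (e * G * e * Gi * f)"
    using split[of e] by (simp add: eq_neg_iff_add_eq_0 add.commute distrib_left distrib_right ef mult.assoc ef[THEN assoc_rule])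
  have "(f * G * f - f * G * e * B * e * G * f) * (f * Gi * f) =
      f * G * f * Gi * f - f * G * e * B * (e * G * f * Gi * f)"
    by (simp add: algebra_simps ef[THEN assoc_rule])
  also have "\<dots> = f * G * f * Gi * f + f * G * e * (B * (e * G * e)) * Gi * f"
    unfolding 0 by (simp add: mult.assoc)
  also have "\<dots> = f * G * e * Gi * f + f * G * f * Gi * f"
    unfolding B by (simp add: algebra_simps ef[THEN assoc_rule])
  also have "\<dots> = f * (e + f) * f" by (rule split)
  finally show ?thesis by (simp add: distrib_left ef)
qed

text \<open>\<open>h0\<close>, \<open>r0\<close>, \<open>d0\<close> border the array of
  \<open>K + K'\<close>, and \<open>h1\<close>, \<open>r1\<close> border that of \<open>K\<close>.
  By the shift relations the parallel sum \<open>G\<close> of \<open>K\<close> and \<open>K'\<close>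
  differs from \<open>Hb\<close> only in its last block, by \<open>L\<close>. With \<open>c\<close>
  the last block of \<open>Ki + Ki'\<close>, the wanted range is \<open>L - L * c * L\<close>, while
  the last block \<open>Ri\<close> of the inverse of \<open>Hb\<close> satisfies
  \<open>Ri = c + c * L * Ri\<close>; these two relations combine to the claim.\<close>

lemma parallel_schur_even:
  fixes e :: "'a::ring_1"
  assumes K: "K * Ki = e" "Ki * K = e" and K': "K' * Ki' = e" "Ki' * K' = e"
    and H: "(K + K') * Hi = e" "Hi * (K + K') = e" and Hi: "e * Hi = Hi" "Hi * e = Hi"
    and Ke: "K * e = K" "e * K = K"
    and Hb: "Hb * Hbi = e" "e * Hbi = Hbi"
    and Kie: "Ki * e = Ki" "Ki' * e = Ki'" "e * Ki = Ki" "e * Ki' = Ki'"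
    and E: "e * E = E" "E * f = E" and N: "N * e = N" "e * N' = N'"
    and KN: "K = N * (K + K') + E * r0" "K = (K + K') * N' + h0 * Et"
    and h0: "h0 = K * E" and r0: "r0 = Et * K"
    and h1: "h1 = N * h0 + E * d0" and r1: "r1 = r0 * N' + d0 * Et"
    and F2: "Hb = K - (N * K + E * r1)"
    and h1e: "e * h1 = h1" "r1 * e = r1"
    and L: "L = d0 - r0 * Hi * h0" "L * Li = f" and Ri: "Et * Hbi * E = Ri"
  shows "(d0 - (r0 - r1) * Ki' * (h0 - h1) - r1 * Ki * h1) * (Li + Ri) = f"
proof -
  define G where "G = K - K * Hi * K"
  define Gi where "Gi = Ki + Ki'"
  note par = parallel_inverse[OF K K' H Hi Ke, folded G_def Gi_def]
  have KHi: "K * Hi = N + E * r0 * Hi"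
  proof -
    have "K * Hi = (N * (K + K') + E * r0) * Hi" using KN(1) by simp
    also have "\<dots> = N * ((K + K') * Hi) + E * r0 * Hi" by (simp only: distrib_right mult.assoc)
    finally show ?thesis by (simp only: H N)
  qed
  have HiK: "Hi * K = N' + Hi * h0 * Et"
  proof -
    have "Hi * K = Hi * ((K + K') * N' + h0 * Et)" using KN(2) by simp
    also have "\<dots> = (Hi * (K + K')) * N' + Hi * h0 * Et" by (simp add: algebra_simps)
    finally show ?thesis by (simp only: H N)
  qed
  have EL: "h1 - K * Hi * h0 = E * L"
    by (simp add: KHi h1 L algebra_simps)
  have LEt: "r1 - r0 * Hi * K = L * Et"
    by (simp add: HiK r1 L algebra_simps)
  have GHb: "G = Hb + E * L * Et"
    unfolding G_def KHi F2 mult.assoc LEt[symmetric] by (simp add: algebra_simps)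
  \<comment> \<open>\<open>z\<close> and \<open>zr\<close> solve \<open>G * z = E * L\<close> and
    \<open>zr * G = L * Et\<close>. Evaluating \<open>zr * G * z\<close> in two ways gives
    \<open>L * c * L\<close> and \<open>L - D\<close>.\<close>
  define z where "z = Ki * h1 - Ki' * (h0 - h1)"
  define zr where "zr = r1 * Ki - (r0 - r1) * Ki'"
  have Gz: "G * z = E * L"
  proof -
    have "G * z = (K + K') * Hi * h1 - K * Hi * h0"
      by (simp add: z_def right_diff_distrib mult.assoc[symmetric] par) (simp add: algebra_simps)
    then show ?thesis by (simp add: H h1e EL)
  qed
  have zG: "zr * G = L * Et"
  proof -
    have "zr * G = r1 * (Hi * (K + K')) - r0 * Hi * K"
      by (simp add: zr_def left_diff_distrib mult.assoc par) (simp add: algebra_simps)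
    then show ?thesis by (simp add: H h1e LEt)
  qed
  have "e * z = z"
    by (simp add: z_def right_diff_distrib Kie mult.assoc[symmetric])
  then have z: "z = Gi * E * L"
    using par(6) Gz by (metis mult.assoc)
  define c where "c = Et * Gi * E"
  define D where "D = d0 - (r0 - r1) * Ki' * (h0 - h1) - r1 * Ki * h1"
  have Q: "zr * (G * z) = L * c * L"
    by (simp add: mult.assoc[symmetric] zG) (simp add: z c_def mult.assoc)
  have "Ki' * K * Hi * h0 = Ki' * h0 - Hi * h0"
  proof -
    have "Ki' * K * Hi * h0 = Ki' * ((K + K') * Hi) * h0 - (Ki' * K') * Hi * h0"
      by (simp add: algebra_simps)
    then show ?thesis by (simp add: H K' Kie Hi)
  qed
  note a = this
  have "zr * (G * z) = zr * (h1 - K * Hi * h0)" by (simp add: Gz EL)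
  also have "\<dots> = r1 * Ki * h1 - r1 * (Ki * K * Hi * h0) - (r0 - r1) * Ki' * h1 + (r0 - r1) * (Ki' * K * Hi * h0)"
    by (simp add: zr_def algebra_simps)
  also have "\<dots> = r1 * Ki * h1 - r1 * (Hi * h0) - (r0 - r1) * Ki' * h1 + (r0 - r1) * (Ki' * h0 - Hi * h0)"
    by (simp only: a K Hi)
  also have "\<dots> = L - D" by (simp add: L D_def algebra_simps)
  finally have D: "D = L - L * c * L" using Q by (simp add: algebra_simps)
  have "Gi * G * Hbi = Gi * (Hb * Hbi) + Gi * E * L * Et * Hbi"
    by (simp add: GHb algebra_simps)
  moreover have "Gi * e = Gi" by (simp add: Gi_def Kie distrib_right)
  ultimately have Gi: "Hbi = Gi + Gi * E * L * Et * Hbi"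
    by (simp only: par(6) Hb)
  \<comment> \<open>The resolvent identity for the inverses of \<open>G\<close> and
    \<open>Hb\<close>, compressed to the last block.\<close>
  have c: "Ri = c + c * L * Ri"
    unfolding Ri[symmetric] c_def by (subst Gi) (simp add: algebra_simps)
  have cf: "c * f = c" by (simp add: c_def E mult.assoc)
  have "D * (Li + Ri) = f + L * Ri - L * (c * (L * Li)) - L * c * L * Ri"
    unfolding D by (simp add: algebra_simps L(2)[symmetric])
  also have "\<dots> = f + L * (Ri - c - c * L * Ri)" by (simp add: L(2) cf algebra_simps)
  also have "Ri - c - c * L * Ri = Ri - (c + c * L * Ri)" by (rule diff_diff_eq)
  also have "\<dots> = 0" by (simp only: c[symmetric] diff_self)
  finally show ?thesis by (simp add: D_def)
qed

subsection \<open>Block matrices as additive operators on block columns\<close>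

text \<open>Additive maps under composition form a ring with unit whatever the sizes of the blocks,
  which arrays of a fixed size would not.\<close>

typedef (overloaded) 'p bop = "{f :: (nat \<Rightarrow> 'p::finite cmat) \<Rightarrow> (nat \<Rightarrow> 'p cmat).
    \<forall>x y. f (\<lambda>i. x i + y i) = (\<lambda>i. f x i + f y i)}"
  morphisms app_bop Bop
  by (rule exI[of _ "\<lambda>x. x"]) simp

setup_lifting type_definition_bop

instantiation bop :: (finite) ring_1
begin

lift_definition zero_bop :: "'a bop" is "\<lambda>x i. 0" by simp
lift_definition one_bop :: "'a bop" is "\<lambda>x. x" by simp
lift_definition plus_bop :: "'a bop \<Rightarrow> 'a bop \<Rightarrow> 'a bop" is "\<lambda>f g x i. f x i + g x i"
  by (auto simp: algebra_simps)
lift_definition minus_bop :: "'a bop \<Rightarrow> 'a bop \<Rightarrow> 'a bop" is "\<lambda>f g x i. f x i - g x i"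
  by (auto simp: algebra_simps)
lift_definition uminus_bop :: "'a bop \<Rightarrow> 'a bop" is "\<lambda>f x i. - f x i"
  by (auto simp: algebra_simps)
lift_definition times_bop :: "'a bop \<Rightarrow> 'a bop \<Rightarrow> 'a bop" is "\<lambda>f g x. f (g x)"
  by auto

instance
proof
  fix a b c :: "'a bop"
  show "a * b * c = a * (b * c)" by transfer simp
  show "1 * a = a" by transfer simp
  show "a * 1 = a" by transfer simp
  show "a + b + c = a + (b + c)" by transfer (simp add: add.assoc)
  show "a + b = b + a" by transfer (simp add: add.commute)
  show "0 + a = a" by transfer simp
  show "- a + a = 0" by transfer simp
  show "a - b = a + - b" by transfer simp
  show "(a + b) * c = a * c + b * c" by transfer simp
  show "a * (b + c) = a * b + a * c" by transfer (simp add: fun_eq_iff)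
  have "app_bop 0 (\<lambda>_. mat 1) 0 \<noteq> app_bop 1 (\<lambda>_. mat 1 :: 'a cmat) 0"
    by transfer (simp add: mat_def vec_eq_iff)
  then show "0 \<noteq> (1 :: 'a bop)" by metis
qed

end

text \<open>The array \<open>K\<close> cut down to the rows in \<open>I\<close> and the columns in \<open>J\<close>, so that blocks of different
  sizes live in one ring.\<close>

lift_definition mo :: "nat set \<Rightarrow> nat set \<Rightarrow> (nat \<Rightarrow> nat \<Rightarrow> 'p::finite cmat) \<Rightarrow> 'p bop"
  is "\<lambda>I J K x r. if r \<in> I then \<Sum>s\<in>J. K r s ** x s else 0"
  by (auto simp: fun_eq_iff matrix_add_ldistrib sum.distrib)

definition one_arr :: "nat \<Rightarrow> nat \<Rightarrow> 'p::finite cmat" where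
  "one_arr r s = (if r = s then mat 1 else 0)"

lemma mo_add: "mo I J K + mo I J L = mo I J (\<lambda>r s. K r s + L r s)"
  and mo_diff: "mo I J K - mo I J L = mo I J (\<lambda>r s. K r s - L r s)"
  by (transfer; auto simp: fun_eq_iff matrix_mult_add_right matrix_mult_diff_right sum.distrib sum_subtractf)+

lemma mo_minus: "- mo I J D = mo I J (\<lambda>i j. - D i j)"
  by transfer (auto simp: fun_eq_iff matrix_mult_minus_left sum_negf)

lemma mo_mult:
  assumes "finite J"
  shows "mo I J K * mo J L M = mo I L (\<lambda>r s. \<Sum>t\<in>J. K r t ** M t s)"
proof (transfer fixing: I J L K M, intro ext)
  fix x :: "nat \<Rightarrow> 'a cmat" and r
  have "(\<Sum>s\<in>J. K r s ** (if s \<in> J then \<Sum>u\<in>L. M s u ** x u else 0)) = (\<Sum>s\<in>J. \<Sum>u\<in>L. K r s ** M s u ** x u)"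
    by (intro sum.cong refl) (simp add: matrix_mult_sum_right matrix_mul_assoc)
  also have "\<dots> = (\<Sum>u\<in>L. \<Sum>s\<in>J. K r s ** M s u ** x u)" by (rule sum.swap)
  finally show "(if r \<in> I then \<Sum>s\<in>J. K r s ** (if s \<in> J then \<Sum>u\<in>L. M s u ** x u else 0) else 0) =
    (if r \<in> I then \<Sum>s\<in>L. (\<Sum>t\<in>J. K r t ** M t s) ** x s else 0)"
    by (simp add: matrix_mult_sum_left)
qed

lemma mo_mult_disjoint: "J \<inter> J' = {} \<Longrightarrow> mo I J K * mo J' L M = 0"
  by (transfer, intro ext) (auto intro!: sum.neutral)

lemma mo_cong: "(\<And>r s. r \<in> I \<Longrightarrow> s \<in> J \<Longrightarrow> K r s = L r s) \<Longrightarrow> mo I J K = mo I J L"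
  by transfer (auto simp: fun_eq_iff intro!: sum.cong)

lemma mo_eq_iff:
  assumes "finite J"
  shows "mo I J K = mo I J L \<longleftrightarrow> (\<forall>r\<in>I. \<forall>s\<in>J. K r s = L r s)"
proof
  assume eq: "mo I J K = mo I J L"
  show "\<forall>r\<in>I. \<forall>s\<in>J. K r s = L r s"
  proof (intro ballI)
    fix r s assume rs: "r \<in> I" "s \<in> J"
    \<comment> \<open>Applying the operator to a unit block column reads off a column of the
      array.\<close>
    have "app_bop (mo I J K) (one_arr s) r = K r s" for K
      using rs assms by transfer (simp add: one_arr_def if_distrib[of "\<lambda>x. _ ** x"] cong: if_cong)
    then show "K r s = L r s" by (metis eq)
  qed
qed (auto intro: mo_cong)

lemma mo_one_left: "finite I \<Longrightarrow> mo I I one_arr * mo I J K = mo I J K"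
  by (subst mo_mult) (auto intro!: mo_cong simp: one_arr_def if_distrib[of "\<lambda>x. x ** _"] cong: if_cong)

lemma mo_one_right: "finite J \<Longrightarrow> mo I J K * mo J J one_arr = mo I J K"
  by (subst mo_mult) (auto intro!: mo_cong simp: one_arr_def if_distrib[of "\<lambda>x. _ ** x"] cong: if_cong)

lemma mo_Suc:
  "mo {..<Suc m} {..<Suc m} K =
    mo {..<m} {..<m} K + mo {..<m} {m} K + mo {m} {..<m} K + mo {m} {m} K"
  by transfer (auto simp: fun_eq_iff lessThan_Suc add.commute)

lemma mo_one_Suc: "mo {..<Suc m} {..<Suc m} one_arr = mo {..<m} {..<m} one_arr + mo {m} {m} one_arr"
  by transfer (auto simp: fun_eq_iff lessThan_Suc one_arr_def)

section \<open>Block inverses, Schur complements and block forms\<close>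

definition is_blockinv :: "nat \<Rightarrow> (nat \<Rightarrow> nat \<Rightarrow> 'p::finite cmat) \<Rightarrow> (nat \<Rightarrow> nat \<Rightarrow> 'p cmat) \<Rightarrow> bool" where
  "is_blockinv m K B \<longleftrightarrow> (\<forall>i j. (m \<le> i \<or> m \<le> j) \<longrightarrow> B i j = 0) \<and>
      (\<forall>i<m. \<forall>j<m. blockmult m K B i j = (if i = j then mat 1 else 0)
                  \<and> blockmult m B K i j = (if i = j then mat 1 else 0))"

abbreviation "moc m \<equiv> mo {..<m} {..<m}"

lemma is_blockinv_iff:
  "is_blockinv m K B \<longleftrightarrow> (\<forall>i j. (m \<le> i \<or> m \<le> j) \<longrightarrow> B i j = 0) \<and>
    moc m K * moc m B = moc m one_arr \<and> moc m B * moc m K = moc m one_arr"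
  unfolding is_blockinv_def by (simp add: mo_mult mo_eq_iff blockmult_def one_arr_def) auto

text \<open>The zero padding in \<open>is_blockinv\<close> extends uniqueness from the leading block
  to the whole array, as the \<open>THE\<close> in \<open>blockinv\<close> requires.\<close>

lemma is_blockinv_unique:
  assumes "is_blockinv m K B" "is_blockinv m K B'"
  shows "B = B'"
proof -
  have "moc m B = moc m B * moc m one_arr" by (simp add: mo_one_right)
  also have "\<dots> = (moc m B * moc m K) * moc m B'"
    using assms(2) by (metis is_blockinv_iff mult.assoc)
  also have "\<dots> = moc m one_arr * moc m B'"
    using assms(1) by (metis is_blockinv_iff)
  also have "\<dots> = moc m B'" by (simp add: mo_one_left)
  finally have "\<forall>r<m. \<forall>s<m. B r s = B' r s" by (simp add: mo_eq_iff)
  moreover have "B r s = 0" "B' r s = 0" if "\<not> (r < m \<and> s < m)" for r s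
    using that assms by (auto simp: is_blockinv_def not_less)
  ultimately show ?thesis by (intro ext) metis
qed

lemma blockinv_eqI: "is_blockinv m K B \<Longrightarrow> blockinv m K = B"
  unfolding blockinv_def is_blockinv_def[symmetric]
  by (rule the_equality) (auto intro: is_blockinv_unique)

lemma is_blockinvI:
  assumes "moc m K * moc m B = moc m one_arr" "moc m B * moc m K = moc m one_arr"
  shows "is_blockinv m K (\<lambda>i j. if i < m \<and> j < m then B i j else 0)"
proof -
  have "moc m (\<lambda>i j. if i < m \<and> j < m then B i j else 0) = moc m B" by (rule mo_cong) simp
  then show ?thesis using assms by (auto simp: is_blockinv_iff)
qed

text \<open>The Schur complement of the leading \<open>m\<close> blocks inside the leading
  \<open>Suc m\<close> blocks, that is, pivot number \<open>m\<close> of block elimination.\<close>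

definition schur :: "nat \<Rightarrow> (nat \<Rightarrow> nat \<Rightarrow> 'p::finite cmat) \<Rightarrow> 'p cmat" where
  "schur m K = K m m - (\<Sum>r<m. \<Sum>s<m. K m r ** blockinv m K r s ** K s m)"

lemma mo_schur:
  "mo {m} {m} (\<lambda>_ _. schur m K) =
    mo {m} {m} K - mo {m} {..<m} K * moc m (blockinv m K) * mo {..<m} {m} K"
proof -
  have "(\<Sum>r<m. \<Sum>s<m. K m r ** blockinv m K r s ** K s m) = (\<Sum>s<m. (\<Sum>r<m. K m r ** blockinv m K r s) ** K s m)"
    by (subst sum.swap) (simp add: matrix_mult_sum_left)
  then show ?thesis
    by (simp add: mo_mult mo_diff schur_def mo_eq_iff)
qed

text \<open>The bordered inverse of \<open>schur_inverse\<close>; its last block is the inverse of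
  the Schur complement.\<close>

lemma is_blockinv_Suc:
  assumes inv: "is_blockinv m K (blockinv m K)" and M: "schur m K ** M = mat 1" "M ** schur m K = mat 1"
  shows "is_blockinv (Suc m) K (blockinv (Suc m) K)" "blockinv (Suc m) K m m = M"
proof -
  define e f where "e = moc m (one_arr :: nat \<Rightarrow> nat \<Rightarrow> 'a cmat)" and "f = mo {m} {m} (one_arr :: nat \<Rightarrow> nat \<Rightarrow> 'a cmat)"
  define A h r B L M' where "A = moc m K" and "h = mo {..<m} {m} K" and "r = mo {m} {..<m} K"
    and "B = moc m (blockinv m K)" and "L = mo {m} {m} (\<lambda>_ _. schur m K)" and "M' = mo {m} {m} (\<lambda>_ _. M)"
  note defs = e_def f_def A_def h_def r_def B_def L_def M'_def
  have AB: "A * B = e" "B * A = e" using inv by (simp_all add: is_blockinv_iff defs)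
  have LM: "L * M' = f" "M' * L = f"
    using M by (simp_all add: defs mo_mult mo_eq_iff one_arr_def)
  have corner: "B * e = B" "e * B = B" "e * h = h" "h * f = h" "f * r = r" "r * e = r"
      "f * M' = M'" "M' * f = M'" "e * f = 0" "f * e = 0" "A * e = A" "e * A = A" "f * L = L" "L * f = L"
    by (simp_all add: defs mo_one_left mo_one_right mo_mult_disjoint)
  have K: "moc (Suc m) K = A + h + r + (L + r * B * h)"
    by (simp add: defs mo_Suc mo_schur)
  define N where "N = B + B * h * M' * r * B - B * h * M' - M' * r * B + M'"
  have XN: "moc (Suc m) K * N = moc (Suc m) one_arr" "N * moc (Suc m) K = moc (Suc m) one_arr"
    unfolding K N_def mo_one_Suc e_def[symmetric] f_def[symmetric]
    by (rule schur_inverse[OF AB corner(1-6) LM corner(7-14)])+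
  have N_moc: "\<exists>C. N = moc (Suc m) C \<and> C m m = M"
  proof -
    \<comment> \<open>The ring element \<open>N\<close> has to be written as an array again before
      it can serve as a block inverse.\<close>
    define C where "C i j = (if i < m \<and> j < m then blockinv m K i j + (\<Sum>s<m. (\<Sum>t<m. blockinv m K i t ** K t m) ** M ** K m s ** blockinv m K s j)
        else if i < m then - ((\<Sum>t<m. blockinv m K i t ** K t m) ** M)
        else if j < m then - (M ** (\<Sum>t<m. K m t ** blockinv m K t j)) else M)" for i j
    have 1: "B * h * M' = mo {..<m} {m} (\<lambda>i j. (\<Sum>t<m. blockinv m K i t ** K t m) ** M)"
      by (simp add: defs mo_mult)
    have 2: "M' * r * B = mo {m} {..<m} (\<lambda>i j. M ** (\<Sum>t<m. K m t ** blockinv m K t j))"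
      by (simp add: defs mo_mult) (auto intro!: mo_cong simp: matrix_mult_sum_right matrix_mul_assoc)
    have 3: "B * h * M' * r * B = moc m (\<lambda>i j. \<Sum>s<m. (\<Sum>t<m. blockinv m K i t ** K t m) ** M ** K m s ** blockinv m K s j)"
      unfolding 1 by (simp add: defs mo_mult)
    have "moc m C = B + B * h * M' * r * B" unfolding 3 unfolding B_def mo_add by (rule mo_cong) (simp add: C_def)
    moreover have "mo {..<m} {m} C = - (B * h * M')" unfolding 1 mo_minus by (rule mo_cong) (simp add: C_def)
    moreover have "mo {m} {..<m} C = - (M' * r * B)" unfolding 2 mo_minus by (rule mo_cong) (simp add: C_def)
    moreover have "mo {m} {m} C = M'" unfolding M'_def by (rule mo_cong) (simp add: C_def)
    ultimately have "N = moc (Suc m) C" by (simp add: N_def mo_Suc)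
    then show ?thesis by (auto simp: C_def)
  qed
  then obtain C where C: "N = moc (Suc m) C" "C m m = M" by blast
  define C' where "C' i j = (if i < Suc m \<and> j < Suc m then C i j else 0)" for i j
  have "is_blockinv (Suc m) K C'"
    unfolding C'_def using XN by (intro is_blockinvI) (simp_all add: C)
  moreover from this have "blockinv (Suc m) K = C'" by (rule blockinv_eqI)
  ultimately show "is_blockinv (Suc m) K (blockinv (Suc m) K)" "blockinv (Suc m) K m m = M"
    by (simp_all add: C'_def C)
qed

lemma mo_restrict_left: "finite I' \<Longrightarrow> I \<subseteq> I' \<Longrightarrow> mo I I one_arr * mo I' J K = mo I J K"
proof (transfer fixing: I I' J K, intro ext)
  fix x :: "nat \<Rightarrow> 'a cmat" and r assume *: "finite I'" "I \<subseteq> I'"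
  have "(\<Sum>s\<in>I. one_arr r s ** (if s \<in> I' then \<Sum>t\<in>J. K s t ** x t else 0)) = (\<Sum>s\<in>I. if s = r then \<Sum>t\<in>J. K r t ** x t else 0)"
    using * by (intro sum.cong refl) (auto simp: one_arr_def)
  then show "(if r \<in> I then \<Sum>s\<in>I. one_arr r s ** (if s \<in> I' then \<Sum>t\<in>J. K s t ** x t else 0) else 0) =
      (if r \<in> I then \<Sum>t\<in>J. K r t ** x t else 0)"
    using * finite_subset[of I I'] by simp
qed

lemma mo_restrict_right: "finite J' \<Longrightarrow> J \<subseteq> J' \<Longrightarrow> mo I J' K * mo J J one_arr = mo I J K"
proof (transfer fixing: I J J' K, intro ext)
  fix x :: "nat \<Rightarrow> 'a cmat" and r assume *: "finite J'" "J \<subseteq> J'"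
  have 1: "(\<Sum>t\<in>J. one_arr s t ** x t) = x s" if "s \<in> J" for s
  proof -
    have "(\<Sum>t\<in>J. one_arr s t ** x t) = (\<Sum>t\<in>J. if t = s then x s else 0)"
      by (intro sum.cong refl) (auto simp: one_arr_def)
    then show ?thesis using that * finite_subset[of J J'] by simp
  qed
  have "(\<Sum>s\<in>J'. K r s ** (if s \<in> J then \<Sum>t\<in>J. one_arr s t ** x t else 0)) = (\<Sum>s\<in>J. K r s ** x s)"
    using * by (intro sum.mono_neutral_cong_right) (auto simp: 1)
  then show "(if r \<in> I then \<Sum>s\<in>J'. K r s ** (if s \<in> J then \<Sum>t\<in>J. one_arr s t ** x t else 0) else 0) =
      (if r \<in> I then \<Sum>s\<in>J. K r s ** x s else 0)" by simp
qed

lemma is_blockinv_0: "is_blockinv 0 K (blockinv 0 K)"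
proof -
  have "is_blockinv 0 K (\<lambda>_ _. 0)" by (simp add: is_blockinv_def)
  then show ?thesis using blockinv_eqI by metis
qed

text \<open>Invertible pivots let the inverse grow by one block at a time.\<close>

lemma is_blockinv_schur_pd:
  assumes "\<And>j. j < m \<Longrightarrow> pd (schur j K)"
  shows "is_blockinv m K (blockinv m K)"
  using assms
proof (induction m)
  case 0 show ?case by (rule is_blockinv_0)
next
  case (Suc m)
  obtain M where "schur m K ** M = mat 1" "M ** schur m K = mat 1"
    using pd_imp_inverse[OF Suc.prems[of m]] by auto
  then show ?case using Suc by (intro is_blockinv_Suc(1)) auto
qed

lemma blockinv_last:
  assumes "\<And>j. j \<le> m \<Longrightarrow> pd (schur j K)"
  shows "schur m K ** blockinv (Suc m) K m m = mat 1" "blockinv (Suc m) K m m ** schur m K = mat 1"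
proof -
  obtain M where M: "schur m K ** M = mat 1" "M ** schur m K = mat 1"
    using pd_imp_inverse[OF assms[of m]] by auto
  moreover have "is_blockinv m K (blockinv m K)" using assms by (intro is_blockinv_schur_pd) simp
  ultimately have "blockinv (Suc m) K m m = M" by (intro is_blockinv_Suc(2))
  then show "schur m K ** blockinv (Suc m) K m m = mat 1" "blockinv (Suc m) K m m ** schur m K = mat 1"
    using M by simp_all
qed

definition herm_arr :: "(nat \<Rightarrow> nat \<Rightarrow> 'p::finite cmat) \<Rightarrow> bool" where
  "herm_arr K \<longleftrightarrow> (\<forall>i j. cadj (K i j) = K j i)"

text \<open>The adjoint of the inverse is also an inverse, and inverses are unique.\<close>

lemma blockinv_hermitian:
  assumes inv: "is_blockinv m K (blockinv m K)" and K: "herm_arr K"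
  shows "herm_arr (blockinv m K)"
proof -
  let ?B = "blockinv m K" and ?B' = "\<lambda>i j. cadj (blockinv m K j i)"
  have 1: "blockmult m K ?B' i j = cadj (blockmult m ?B K j i)"
    "blockmult m ?B' K i j = cadj (blockmult m K ?B j i)" for i j
    using K by (simp_all add: blockmult_def cadj_sum cadj_mult herm_arr_def)
  have "is_blockinv m K ?B'"
    using inv unfolding is_blockinv_def 1 by auto
  then have "?B = ?B'" by (rule blockinv_eqI)
  then show ?thesis unfolding herm_arr_def by (metis cadj_cadj)
qed

definition block_form :: "nat \<Rightarrow> (nat \<Rightarrow> nat \<Rightarrow> 'p::finite cmat) \<Rightarrow> (nat \<Rightarrow> 'p cmat) \<Rightarrow> 'p cmat" where
  "block_form m K x = (\<Sum>i<m. \<Sum>j<m. cadj (x i) ** K i j ** x j)"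

text \<open>Completing the square in the last block variable; \<open>c\<close> solves the leading
  system with the last column as right-hand side.\<close>

lemma block_form_Suc:
  assumes inv: "is_blockinv m K (blockinv m K)" and K: "herm_arr K"
  defines "c \<equiv> \<lambda>i. \<Sum>j<m. blockinv m K i j ** K j m"
  shows "block_form (Suc m) K x =
    block_form m K (\<lambda>i. x i + c i ** x m) + cadj (x m) ** schur m K ** x m"
proof -
  let ?B = "blockinv m K"
  have Kc: "(\<Sum>j<m. K i j ** c j) = K i m" if "i < m" for i
  proof -
    have "(\<Sum>j<m. K i j ** c j) = (\<Sum>l<m. \<Sum>j<m. K i j ** ?B j l ** K l m)"
      unfolding c_def by (subst sum.swap) (simp add: matrix_mult_sum_right matrix_mul_assoc)
    also have "\<dots> = (\<Sum>l<m. blockmult m K ?B i l ** K l m)"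
      by (simp add: blockmult_def matrix_mult_sum_left)
    also have "\<dots> = (\<Sum>l<m. if l = i then K i m else 0)"
      using inv that by (intro sum.cong refl) (auto simp: is_blockinv_def)
    finally show ?thesis using that by simp
  qed
  have cK: "(\<Sum>i<m. cadj (c i) ** K i j) = K m j" if "j < m" for j
  proof -
    have "(\<Sum>i<m. cadj (c i) ** K i j) = cadj (\<Sum>i<m. K j i ** c i)"
      using K by (simp add: cadj_sum cadj_mult herm_arr_def)
    then show ?thesis using Kc[OF that] K by (simp add: herm_arr_def)
  qed
  have cKm: "(\<Sum>i<m. cadj (c i) ** K i m) = K m m - schur m K"
  proof -
    have "(\<Sum>i<m. cadj (c i) ** K i m) = (\<Sum>i<m. \<Sum>j<m. K m j ** ?B j i ** K i m)"
      using K blockinv_hermitian[OF inv K]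
      by (simp add: c_def cadj_sum cadj_mult herm_arr_def matrix_mult_sum_left)
    also have "\<dots> = (\<Sum>r<m. \<Sum>s<m. K m r ** ?B r s ** K s m)" by (rule sum.swap)
    finally show ?thesis by (simp add: schur_def)
  qed
  define y where "y i = x i + c i ** x m" for i
  define g where "g i = (\<Sum>j<m. K i j ** x j) + K i m ** x m" for i
  have Ky: "(\<Sum>j<m. K i j ** y j) = g i" if "i < m" for i
    using Kc[OF that, symmetric]
    by (simp add: y_def g_def matrix_add_ldistrib sum.distrib matrix_mult_sum_left matrix_mul_assoc)
  have cg: "(\<Sum>i<m. cadj (c i) ** g i) = (\<Sum>j<m. K m j ** x j) + (K m m - schur m K) ** x m"
  proof -
    have "(\<Sum>i<m. cadj (c i) ** g i) = (\<Sum>i<m. \<Sum>j<m. cadj (c i) ** K i j ** x j) + (\<Sum>i<m. cadj (c i) ** K i m) ** x m"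
      by (simp add: g_def matrix_add_ldistrib sum.distrib matrix_mult_sum_left matrix_mult_sum_right matrix_mul_assoc)
    also have "(\<Sum>i<m. \<Sum>j<m. cadj (c i) ** K i j ** x j) = (\<Sum>j<m. (\<Sum>i<m. cadj (c i) ** K i j) ** x j)"
      by (subst sum.swap) (simp add: matrix_mult_sum_left)
    finally show ?thesis by (simp add: cK cKm)
  qed
  have "block_form m K y = (\<Sum>i<m. cadj (y i) ** (\<Sum>j<m. K i j ** y j))"
    by (simp add: block_form_def matrix_mult_sum_right matrix_mul_assoc)
  also have "\<dots> = (\<Sum>i<m. cadj (x i) ** g i) + cadj (x m) ** (\<Sum>i<m. cadj (c i) ** g i)"
    by (simp add: Ky) (simp add: y_def cadj_add cadj_mult matrix_mult_add_right sum.distrib matrix_mult_sum_right matrix_mul_assoc)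
  finally have "block_form m K y + cadj (x m) ** schur m K ** x m =
      (\<Sum>i<m. cadj (x i) ** g i) + cadj (x m) ** g m"
    by (simp add: cg g_def[of m] matrix_ring_simps)
  also have "\<dots> = block_form (Suc m) K x"
    by (simp add: block_form_def g_def matrix_add_ldistrib matrix_mult_sum_right matrix_mul_assoc sum.distrib)
  finally show ?thesis by (simp add: y_def[abs_def])
qed

lemma psd_block_form:
  assumes "\<And>j. j < m \<Longrightarrow> pd (schur j K)" and K: "herm_arr K"
  shows "psd (block_form m K x)"
  using assms(1)
proof (induction m arbitrary: x)
  case 0 show ?case by (simp add: block_form_def)
next
  case (Suc m)
  have "psd (cadj (x m) ** schur m K ** x m)"
    using psd_congr[OF pd_imp_psd[OF Suc.prems[of m]], of "cadj (x m)"] by simp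
  moreover have "is_blockinv m K (blockinv m K)" using Suc.prems by (intro is_blockinv_schur_pd) simp
  ultimately show ?case using Suc by (subst block_form_Suc[OF _ K]) (auto intro!: psd_add)
qed

text \<open>The block column \<open>- c\<close> with last entry 1 annihilates the completed square,
  so the form takes the Schur complement as its value there.\<close>

lemma psd_schur:
  assumes inv: "is_blockinv m K (blockinv m K)" and K: "herm_arr K"
    and psd: "\<And>x. psd (block_form (Suc m) K x)"
  shows "psd (schur m K)"
proof -
  define c where "c i = (\<Sum>j<m. blockinv m K i j ** K j m)" for i
  define x where "x i = (if i = m then mat 1 else - c i)" for i
  have "block_form m K (\<lambda>i. x i + c i ** x m) = 0"
    unfolding block_form_def by (intro sum.neutral ballI) (simp add: x_def)
  then have "block_form (Suc m) K x = schur m K"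
    using block_form_Suc[OF inv K, of x] by (simp add: c_def[symmetric] x_def)
  then show ?thesis using psd by metis
qed

subsection \<open>The range of the next moment\<close>

text \<open>If \<open>T\<close> are the moments of mu, this is the Hankel array of x^a d mu, and
  \<open>hd' T a\<close> is that of x^a (1 - x) d mu.\<close>

definition hk :: "(nat \<Rightarrow> 'p::finite cmat) \<Rightarrow> nat \<Rightarrow> nat \<Rightarrow> nat \<Rightarrow> 'p cmat" where
  "hk T a i j = T (i + j + a)"

definition hd' :: "(nat \<Rightarrow> 'p::finite cmat) \<Rightarrow> nat \<Rightarrow> nat \<Rightarrow> nat \<Rightarrow> 'p cmat" where
  "hd' T a i j = T (i + j + a) - T (i + j + a + 1)"

text \<open>Here \<open>T = Sx S\<close>: the lengths \<open>S\<^sub>k - S\<^sub>k\<^sup>-\<close> and \<open>S\<^sub>k\<^sup>+ - S\<^sub>k\<close> are the last Schur complements \<open>Lk T k\<close>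
  and \<open>Rk T k\<close> of the Hankel matrices of the moments and of their differences.\<close>

definition Lk :: "(nat \<Rightarrow> 'p::finite cmat) \<Rightarrow> nat \<Rightarrow> 'p cmat" where
  "Lk T k = schur (k div 2) (hk T (k mod 2))"

definition Rk :: "(nat \<Rightarrow> 'p::finite cmat) \<Rightarrow> nat \<Rightarrow> 'p cmat" where
  "Rk T k = schur ((k - 1) div 2) (hd' T (1 - k mod 2))"

text \<open>In terms of the ranges \<open>D\<^sub>k = S\<^sub>k\<^sup>+ - S\<^sub>k\<^sup>-\<close>, the odd and even step both say
  \<open>D\<^sub>k\<^sub>+\<^sub>1 (L\<^sub>k\<^sup>-\<^sup>1 + R\<^sub>k\<^sup>-\<^sup>1) = 1\<close>, because the inverse of a last Schur complement is the last block of the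
  inverse matrix.\<close>

lemma range_step_odd:
  fixes T :: "nat \<Rightarrow> 'p::finite cmat"
  assumes inv: "is_blockinv (Suc m) (hk T 0) (blockinv (Suc m) (hk T 0))"
    "is_blockinv (Suc m) (hk T 1) (blockinv (Suc m) (hk T 1))"
    "is_blockinv (Suc m) (hd' T 0) (blockinv (Suc m) (hd' T 0))"
    "is_blockinv m (hd' T 1) (blockinv m (hd' T 1))"
  shows "(schur (Suc m) (hk T 0) + schur m (hd' T 1)) **
    (blockinv (Suc m) (hk T 1) m m + blockinv (Suc m) (hd' T 0) m m) = mat 1"
proof -
  let ?one = "one_arr :: nat \<Rightarrow> nat \<Rightarrow> 'p cmat"
  define e f g where "e = moc m ?one" and "f = mo {m} {m} ?one" and "g = moc (Suc m) ?one"
  define K K' Hi B where "K = moc (Suc m) (hk T 1)" and "K' = moc (Suc m) (hd' T 0)"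
    and "Hi = moc (Suc m) (blockinv (Suc m) (hk T 0))" and "B = moc m (blockinv m (hd' T 1))"
  define Ki Ki' where "Ki = moc (Suc m) (blockinv (Suc m) (hk T 1))"
    and "Ki' = moc (Suc m) (blockinv (Suc m) (hd' T 0))"
  note defs = e_def f_def g_def K_def K'_def Hi_def B_def Ki_def Ki'_def
  have gef: "g = e + f" by (simp add: defs mo_one_Suc)
  have H: "K + K' = moc (Suc m) (hk T 0)"
    by (simp add: defs mo_add mo_eq_iff hk_def hd'_def)
  have invs: "K * Ki = g" "Ki * K = g" "K' * Ki' = g" "Ki' * K' = g" "(K + K') * Hi = g" "Hi * (K + K') = g"
    using inv unfolding H by (simp_all add: is_blockinv_iff defs)
  have c: "g * Hi = Hi" "Hi * g = Hi" "K * g = K" "g * K = K"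
    by (simp_all add: defs mo_one_left mo_one_right)
  define G where "G = K - K * Hi * K"
  have GGi: "G * (Ki + Ki') = g"
    unfolding G_def by (rule parallel_inverse(5)[OF invs c])
  have Gg: "G * g = G" by (simp add: G_def left_diff_distrib mult.assoc c)
  have ef: "e * e = e" "f * f = f" "e * f = 0" "f * e = 0"
    by (simp_all add: defs mo_one_left mo_mult_disjoint)
  \<comment> \<open>Shifts by one block: the first \<open>m\<close> rows of \<open>K\<close> are
    later rows of \<open>K + K'\<close>. Hence \<open>Hi\<close> cancels there, and all of
    \<open>G\<close> except its last block agrees with \<open>hd' T 1\<close>.\<close>
  define N N' where "N = mo {..<m} {..<Suc m} (\<lambda>r s. if s = Suc r then mat 1 else (0 :: 'p cmat))"
    and "N' = mo {..<Suc m} {..<m} (\<lambda>r s. if r = Suc s then mat 1 else (0 :: 'p cmat))"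
  have eK: "e * K = N * (K + K')" and Ke: "K * e = (K + K') * N'"
    unfolding H by (simp_all add: defs N_def N'_def mo_restrict_left mo_restrict_right mo_mult)
      (auto intro!: mo_cong simp: hk_def if_distrib[of "\<lambda>x. x ** _"] if_distrib[of "\<lambda>x. _ ** x"] cong: if_cong)
  have Ng: "N * g = N" "g * N' = N'" by (simp_all add: defs N_def N'_def mo_one_left mo_one_right)
  have "e * G = e * K - (e * K) * Hi * K" by (simp add: G_def right_diff_distrib mult.assoc)
  also have "\<dots> = e * K - N * K"
    by (simp add: eK mult.assoc assoc_rule[OF invs(5)] c)
  also have "\<dots> = mo {..<m} {..<Suc m} (hd' T 1)"
    by (simp add: defs N_def mo_restrict_left mo_mult mo_diff)
      (auto intro!: mo_cong simp: hk_def hd'_def if_distrib[of "\<lambda>x. x ** _"] cong: if_cong)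
  finally have eG: "e * G = mo {..<m} {..<Suc m} (hd' T 1)" .
  have "G * e = K * e - K * (Hi * (K * e))" by (simp add: G_def left_diff_distrib mult.assoc)
  also have "\<dots> = K * e - K * N'"
    by (simp add: Ke assoc_rule[OF invs(6)] Ng)
  also have "\<dots> = mo {..<Suc m} {..<m} (hd' T 1)"
    by (simp add: defs N'_def mo_restrict_right mo_mult mo_diff)
      (auto intro!: mo_cong simp: hk_def hd'_def if_distrib[of "\<lambda>x. _ ** x"] cong: if_cong)
  finally have Ge: "G * e = mo {..<Suc m} {..<m} (hd' T 1)" .
  have eGe: "e * G * e = moc m (hd' T 1)" and eGf: "e * G * f = mo {..<m} {m} (hd' T 1)"
    unfolding eG by (simp_all add: defs mo_restrict_right)
  have fGe: "f * G * e = mo {m} {..<m} (hd' T 1)"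
    unfolding mult.assoc Ge by (simp add: defs mo_restrict_left)
  have "B * (e * G * e) = e" unfolding eGe using inv(4) by (simp add: defs is_blockinv_iff)
  from schur_of_inverse[OF GGi[unfolded gef] Gg[unfolded gef] this ef]
  have D: "(f * G * f - f * G * e * B * e * G * f) * (f * (Ki + Ki') * f) = f" .
  \<comment> \<open>\<open>w\<close> is the lower bound of order \<open>2 * m + 2\<close>; both the
    last block of \<open>G\<close> and \<open>schur (Suc m) (hk T 0)\<close> are a moment minus
    \<open>w\<close>.\<close>
  define w where "w = (\<Sum>r<Suc m. \<Sum>s<Suc m. hk T 1 m r ** blockinv (Suc m) (hk T 0) r s ** hk T 1 s m)"
  have fGf: "f * G * f = mo {m} {m} (\<lambda>_ _. T (2 * m + 1) - w)"
  proof -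
    have w': "w = (\<Sum>s<Suc m. (\<Sum>r<Suc m. hk T 1 m r ** blockinv (Suc m) (hk T 0) r s) ** hk T 1 s m)"
      unfolding w_def by (subst sum.swap) (simp only: matrix_mult_sum_left)
    have "f * G * f = f * K * f - (f * K) * Hi * (K * f)"
      by (simp add: G_def algebra_simps)
    also have "f * K = mo {m} {..<Suc m} (hk T 1)" by (simp add: defs mo_restrict_left)
    also have "K * f = mo {..<Suc m} {m} (hk T 1)" by (simp add: defs mo_restrict_right)
    also have "mo {m} {..<Suc m} (hk T 1) * f = mo {m} {m} (hk T 1)" by (simp add: defs mo_restrict_right)
    finally show ?thesis
      by (simp add: Hi_def mo_mult mo_diff w' mo_eq_iff hk_def mult_2 del: sum.lessThan_Suc)
  qed
  have u: "f * G * e * B * e * G * f = mo {m} {m} (hd' T 1) - mo {m} {m} (\<lambda>_ _. schur m (hd' T 1))"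
    unfolding mo_schur mult.assoc[symmetric] fGe
    by (simp add: mult.assoc eGf[unfolded mult.assoc] B_def)
  have "schur (Suc m) (hk T 0) = T (2 * m + 2) - w"
    by (simp add: schur_def w_def hk_def mult_2 del: sum.lessThan_Suc)
  then have "f * G * f - f * G * e * B * e * G * f = mo {m} {m} (\<lambda>_ _. schur (Suc m) (hk T 0) + schur m (hd' T 1))"
    by (simp add: fGf u mo_diff mo_add mo_eq_iff hd'_def mult_2)
  moreover have "f * (Ki + Ki') * f = mo {m} {m} (\<lambda>_ _. blockinv (Suc m) (hk T 1) m m + blockinv (Suc m) (hd' T 0) m m)"
    by (simp add: defs mo_add mo_restrict_left mo_restrict_right mo_eq_iff)
  ultimately show ?thesis
    using D by (simp add: f_def mo_mult mo_eq_iff one_arr_def)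
qed

text \<open>For even order the right length comes from a smaller array than the left one: its
  inverse is the last block, with index \<open>m - 1\<close>, of the inverse of the array
  \<open>hd' T 1\<close> of size \<open>m\<close>. Hence the separate algebraic identity
  \<open>parallel_schur_even\<close>.\<close>

lemma range_step_even:
  fixes T :: "nat \<Rightarrow> 'p::finite cmat"
  assumes inv: "is_blockinv m (hk T 0) (blockinv m (hk T 0))"
    "is_blockinv m (hk T 1) (blockinv m (hk T 1))"
    "is_blockinv m (hd' T 0) (blockinv m (hd' T 0))"
    "is_blockinv m (hd' T 1) (blockinv m (hd' T 1))"
    and Li: "schur m (hk T 0) ** Li = mat 1" and m: "0 < m"
  shows "(schur m (hk T 1) + schur m (hd' T 0)) ** (Li + blockinv m (hd' T 1) (m - 1) (m - 1)) = mat 1"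
proof -
  let ?one = "one_arr :: nat \<Rightarrow> nat \<Rightarrow> 'p cmat"
  define e f where "e = moc m ?one" and "f = mo {m} {m} ?one"
  define K K' Hi Hb Hbi where "K = moc m (hk T 1)" and "K' = moc m (hd' T 0)"
    and "Hi = moc m (blockinv m (hk T 0))" and "Hb = moc m (hd' T 1)" and "Hbi = moc m (blockinv m (hd' T 1))"
  define Ki Ki' where "Ki = moc m (blockinv m (hk T 1))" and "Ki' = moc m (blockinv m (hd' T 0))"
  \<comment> \<open>\<open>E\<close> carries the border block \<open>m\<close> into the last row
    \<open>m - 1\<close> of the corner, and \<open>Et\<close> is its transpose.\<close>
  define E Et where "E = mo {..<m} {m} (\<lambda>r s. if r = m - 1 then mat 1 else (0 :: 'p cmat))"
    and "Et = mo {m} {..<m} (\<lambda>r s. if s = m - 1 then mat 1 else (0 :: 'p cmat))"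
  define N N' where "N = moc m (\<lambda>r s. if s = Suc r then mat 1 else (0 :: 'p cmat))"
    and "N' = moc m (\<lambda>r s. if r = Suc s then mat 1 else (0 :: 'p cmat))"
  define h0 h1 r0 r1 d0 where "h0 = mo {..<m} {m} (hk T 0)" and "h1 = mo {..<m} {m} (hk T 1)"
    and "r0 = mo {m} {..<m} (hk T 0)" and "r1 = mo {m} {..<m} (hk T 1)" and "d0 = mo {m} {m} (hk T 0)"
  define L Lim Ri where "L = mo {m} {m} (\<lambda>_ _. schur m (hk T 0))" and "Lim = mo {m} {m} (\<lambda>_ _. Li)"
    and "Ri = mo {m} {m} (\<lambda>_ _. blockinv m (hd' T 1) (m - 1) (m - 1))"
  note defs = e_def f_def K_def K'_def Hi_def Hb_def Hbi_def Ki_def Ki'_def E_def Et_def N_def N'_def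
    h0_def h1_def r0_def r1_def d0_def L_def Lim_def Ri_def
  note ifs = if_distrib[of "\<lambda>x. x ** _"] if_distrib[of "\<lambda>x. _ ** x"]
  have H: "K + K' = moc m (hk T 0)"
    by (simp add: defs mo_add mo_eq_iff hk_def hd'_def)
  have invs: "K * Ki = e" "Ki * K = e" "K' * Ki' = e" "Ki' * K' = e" "(K + K') * Hi = e" "Hi * (K + K') = e" "Hb * Hbi = e"
    using inv unfolding H by (simp_all add: is_blockinv_iff defs)
  have c: "e * Hi = Hi" "Hi * e = Hi" "K * e = K" "e * K = K" "e * Hbi = Hbi" "Ki * e = Ki" "Ki' * e = Ki'"
      "e * Ki = Ki" "e * Ki' = Ki'" "e * E = E" "E * f = E" "N * e = N" "e * N' = N'" "e * h1 = h1" "r1 * e = r1"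
    by (simp_all add: defs mo_one_left mo_one_right)
  have KN: "K = N * (K + K') + E * r0" "K = (K + K') * N' + h0 * Et"
    unfolding H using m by (simp_all add: defs mo_mult mo_add)
      (auto intro!: mo_cong simp: hk_def ifs le_less_Suc_eq cong: if_cong)
  have hr: "h0 = K * E" "r0 = Et * K"
    using m by (simp_all add: defs mo_mult)
      (auto intro!: mo_cong simp: hk_def ifs cong: if_cong)
  have hr1: "h1 = N * h0 + E * d0" "r1 = r0 * N' + d0 * Et"
    using m by (simp_all add: defs mo_mult mo_add)
      (auto intro!: mo_cong simp: hk_def ifs cong: if_cong)
  have Hb: "Hb = K - (N * K + E * r1)"
    using m by (simp add: defs mo_mult mo_add mo_diff)
      (auto intro!: mo_cong simp: hk_def hd'_def ifs cong: if_cong)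
  have L: "L = d0 - r0 * Hi * h0" by (simp add: defs mo_schur)
  have LL: "L * Lim = f"
    using Li by (simp add: L_def Lim_def f_def mo_mult mo_eq_iff one_arr_def)
  have Ri: "Et * Hbi * E = Ri"
    using m by (simp add: defs mo_mult mo_eq_iff ifs cong: if_cong)
  have dr: "h0 - h1 = mo {..<m} {m} (hd' T 0)" "r0 - r1 = mo {m} {..<m} (hd' T 0)"
    by (simp_all add: defs mo_diff mo_eq_iff hk_def hd'_def)
  have "(d0 - (r0 - r1) * Ki' * (h0 - h1) - r1 * Ki * h1) * (Lim + Ri) = f"
    by (rule parallel_schur_even[OF invs(1-6) c(1-4) invs(7) c(5-13) KN hr hr1 Hb c(14,15) L LL Ri])
  moreover have "d0 - (r0 - r1) * Ki' * (h0 - h1) - r1 * Ki * h1 =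
      mo {m} {m} (\<lambda>_ _. schur m (hk T 1) + schur m (hd' T 0))"
  proof -
    have "mo {m} {m} (\<lambda>_ _. schur m (hk T 1) + schur m (hd' T 0)) =
        mo {m} {m} (\<lambda>_ _. schur m (hk T 1)) + mo {m} {m} (\<lambda>_ _. schur m (hd' T 0))"
      by (simp add: mo_add)
    also have "\<dots> = (mo {m} {m} (hk T 1) + mo {m} {m} (hd' T 0)) - (r0 - r1) * Ki' * (h0 - h1) - r1 * Ki * h1"
      unfolding mo_schur dr by (simp add: defs)
    also have "mo {m} {m} (hk T 1) + mo {m} {m} (hd' T 0) = d0"
      by (simp add: defs mo_add mo_eq_iff hk_def hd'_def)
    finally show ?thesis ..
  qed
  ultimately show ?thesis
    by (simp add: defs mo_mult mo_add mo_eq_iff one_arr_def)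
qed

lemma schur_0 [simp]: "schur 0 K = K 0 0"
  by (simp add: schur_def)

lemma hermitian_schur:
  assumes inv: "is_blockinv m K (blockinv m K)" and K: "herm_arr K"
  shows "hermitian (schur m K)"
proof -
  have "cadj (\<Sum>r<m. \<Sum>s<m. K m r ** blockinv m K r s ** K s m) =
      (\<Sum>r<m. \<Sum>s<m. K m s ** blockinv m K s r ** K r m)"
    using K blockinv_hermitian[OF inv K]
    by (simp add: cadj_sum cadj_mult herm_arr_def matrix_mul_assoc)
  also have "\<dots> = (\<Sum>r<m. \<Sum>s<m. K m r ** blockinv m K r s ** K s m)" by (rule sum.swap)
  finally show ?thesis using K by (simp add: hermitian_def schur_def cadj_diff herm_arr_def)
qed

lemma herm_arr_hk: "(\<And>k. hermitian (T k)) \<Longrightarrow> herm_arr (hk T a)"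
  and herm_arr_hd': "(\<And>k. hermitian (T k)) \<Longrightarrow> herm_arr (hd' T a)"
  by (simp_all add: herm_arr_def hk_def hd'_def hermitian_def cadj_diff add.commute)

text \<open>Pivot \<open>i\<close> of \<open>hk T 0\<close> belongs to order \<open>2 * i\<close>,
  of \<open>hk T 1\<close> and \<open>hd' T 0\<close> to order \<open>2 * i + 1\<close>, and of
  \<open>hd' T 1\<close> to order \<open>2 * i + 2\<close>. Pivot 0 of \<open>hk T 0\<close> is
  \<open>T 0\<close> itself.\<close>

lemma pd_schurs:
  fixes T :: "nat \<Rightarrow> 'p::finite cmat"
  assumes T: "T 0 = mat 1" and pos: "\<forall>j\<in>{1..k}. pd (Lk T j) \<and> pd (Rk T j)"
  shows "2 * i \<le> k \<Longrightarrow> pd (schur i (hk T 0))"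
    and "2 * i + 1 \<le> k \<Longrightarrow> pd (schur i (hk T 1))"
    and "2 * i + 1 \<le> k \<Longrightarrow> pd (schur i (hd' T 0))"
    and "2 * i + 2 \<le> k \<Longrightarrow> pd (schur i (hd' T 1))"
proof -
  show "pd (schur i (hk T 0))" if "2 * i \<le> k"
    using T bspec[OF pos, of "2 * i"] that by (cases "i = 0") (auto simp: Lk_def hk_def)
  show "pd (schur i (hk T 1))" if "2 * i + 1 \<le> k"
    using bspec[OF pos, of "2 * i + 1"] that by (simp add: Lk_def)
  show "pd (schur i (hd' T 0))" if "2 * i + 1 \<le> k"
    using bspec[OF pos, of "2 * i + 1"] that by (simp add: Rk_def)
  have "(2 * i + 2 - 1) div 2 = i" by simp
  then show "pd (schur i (hd' T 1))" if "2 * i + 2 \<le> k"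
    using bspec[OF pos, of "2 * i + 2"] that by (simp add: Rk_def)
qed

lemma range_step:
  fixes T :: "nat \<Rightarrow> 'p::finite cmat"
  assumes T: "T 0 = mat 1" and pos: "\<forall>j\<in>{1..k}. pd (Lk T j) \<and> pd (Rk T j)" and k: "1 \<le> k"
  obtains Li Ri where "Lk T k ** Li = mat 1" "Rk T k ** Ri = mat 1"
    "(Lk T (Suc k) + Rk T (Suc k)) ** (Li + Ri) = mat 1"
proof (cases "even k")
  case True
  then obtain m where m: "k = 2 * m" by auto
  then have "0 < m" using k by simp
  note pds = pd_schurs[OF T pos]
  have inv: "is_blockinv m (hk T 0) (blockinv m (hk T 0))" "is_blockinv m (hk T 1) (blockinv m (hk T 1))"
    "is_blockinv m (hd' T 0) (blockinv m (hd' T 0))" "is_blockinv m (hd' T 1) (blockinv m (hd' T 1))"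
  proof -
    show "is_blockinv m (hk T 0) (blockinv m (hk T 0))"
      by (rule is_blockinv_schur_pd) (auto intro!: pds(1) simp: m)
    show "is_blockinv m (hk T 1) (blockinv m (hk T 1))"
      by (rule is_blockinv_schur_pd, rule pds(2)) (auto simp: m)
    show "is_blockinv m (hd' T 0) (blockinv m (hd' T 0))"
      by (rule is_blockinv_schur_pd, rule pds(3)) (auto simp: m)
    show "is_blockinv m (hd' T 1) (blockinv m (hd' T 1))"
      by (rule is_blockinv_schur_pd, rule pds(4)) (auto simp: m)
  qed
  obtain Li where Li: "schur m (hk T 0) ** Li = mat 1"
    using pd_imp_inverse[OF pds(1)[of m]] m by auto
  obtain m' where m': "m = Suc m'" using \<open>0 < m\<close> gr0_conv_Suc by blast
  have Ri: "schur m' (hd' T 1) ** blockinv m (hd' T 1) m' m' = mat 1"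
    unfolding m' by (rule blockinv_last, rule pds(4)) (auto simp: m m')
  have "(Suc (2 * m') div 2) = m'" by simp
  then have "Rk T k = schur m' (hd' T 1)" "Lk T k = schur m (hk T 0)"
    "Lk T (Suc k) = schur m (hk T 1)" "Rk T (Suc k) = schur m (hd' T 0)"
    by (simp_all add: m Lk_def Rk_def) (simp add: m')
  then show ?thesis
    using that[of Li "blockinv m (hd' T 1) m' m'"] Li Ri range_step_even[OF inv Li \<open>0 < m\<close>]
    by (simp add: m')
next
  case False
  then obtain m where m: "k = 2 * m + 1" using oddE by blast
  note pds = pd_schurs[OF T pos]
  have inv: "is_blockinv (Suc m) (hk T 0) (blockinv (Suc m) (hk T 0))" "is_blockinv (Suc m) (hk T 1) (blockinv (Suc m) (hk T 1))"
    "is_blockinv (Suc m) (hd' T 0) (blockinv (Suc m) (hd' T 0))" "is_blockinv m (hd' T 1) (blockinv m (hd' T 1))"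
  proof -
    show "is_blockinv (Suc m) (hk T 0) (blockinv (Suc m) (hk T 0))"
      by (rule is_blockinv_schur_pd) (auto intro!: pds(1) simp: m)
    show "is_blockinv (Suc m) (hk T 1) (blockinv (Suc m) (hk T 1))"
      by (rule is_blockinv_schur_pd, rule pds(2)) (auto simp: m)
    show "is_blockinv (Suc m) (hd' T 0) (blockinv (Suc m) (hd' T 0))"
      by (rule is_blockinv_schur_pd, rule pds(3)) (auto simp: m)
    show "is_blockinv m (hd' T 1) (blockinv m (hd' T 1))"
      by (rule is_blockinv_schur_pd, rule pds(4)) (auto simp: m)
  qed
  have LR: "schur m (hk T 1) ** blockinv (Suc m) (hk T 1) m m = mat 1"
    "schur m (hd' T 0) ** blockinv (Suc m) (hd' T 0) m m = mat 1"
  proof -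
    show "schur m (hk T 1) ** blockinv (Suc m) (hk T 1) m m = mat 1"
      by (rule blockinv_last, rule pds(2)) (auto simp: m)
    show "schur m (hd' T 0) ** blockinv (Suc m) (hd' T 0) m m = mat 1"
      by (rule blockinv_last, rule pds(3)) (auto simp: m)
  qed
  have "Lk T k = schur m (hk T 1)" "Rk T k = schur m (hd' T 0)"
    "Lk T (Suc k) = schur (Suc m) (hk T 0)" "Rk T (Suc k) = schur m (hd' T 1)"
    by (simp_all add: m Lk_def Rk_def)
  then show ?thesis
    using that[of "blockinv (Suc m) (hk T 1) m m" "blockinv (Suc m) (hd' T 0) m m"] LR range_step_odd[OF inv] by simp
qed

text \<open>\<open>D\<close> inverts a sum of definite matrices. Expanding
  \<open>L ** (Li + Ri) ** R = L + R\<close> turns this into the determinant identity.\<close>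

lemma parallel_sum:
  fixes L R D :: "complex^'p^'p"
  assumes L: "pd L" and R: "pd R" and inv: "L ** Li = mat 1" "R ** Ri = mat 1" and D: "D ** (Li + Ri) = mat 1"
  shows "pd D" "Re (det D) * Re (det (L + R)) = Re (det L) * Re (det R)"
proof -
  obtain Li' where Li': "L ** Li' = mat 1" "Li' ** L = mat 1" "pd Li'" using pd_imp_inverse[OF L] by metis
  obtain Ri' where Ri': "R ** Ri' = mat 1" "Ri' ** R = mat 1" "pd Ri'" using pd_imp_inverse[OF R] by metis
  have Li: "Li' = Li" by (metis Li'(2) inv(1) matrix_mul_assoc matrix_mul_lid matrix_mul_rid)
  have Ri: "Ri' = Ri" by (metis Ri'(2) inv(2) matrix_mul_assoc matrix_mul_lid matrix_mul_rid)
  have "pd (Li + Ri)" using Li'(3) Ri'(3) by (intro pd_add_psd pd_imp_psd) (simp_all add: Li Ri)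
  then obtain D' where D': "(Li + Ri) ** D' = mat 1" "D' ** (Li + Ri) = mat 1" "pd D'" using pd_imp_inverse by metis
  have "D' = D" by (metis D D'(1) matrix_mul_assoc matrix_mul_lid matrix_mul_rid)
  then show pdD: "pd D" using D' by simp
  have "L ** (Li + Ri) ** R = (L ** Li) ** R + L ** (Ri ** R)"
    by (simp add: matrix_ring_simps)
  also have "\<dots> = L + R" using Ri'(2) by (simp add: inv Ri add.commute)
  finally have 1: "det (L + R) = det L * det (Li + Ri) * det R" by (metis det_mul)
  have 2: "det D * det (Li + Ri) = 1" by (metis D det_mul det_I)
  have "det D * det (L + R) = (det D * det (Li + Ri)) * (det L * det R)"
    by (simp add: 1 mult_ac)
  then have "det D * det (L + R) = det L * det R" by (simp add: 2)
  moreover have "pd (L + R)" using L R by (intro pd_add_psd pd_imp_psd)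
  ultimately show "Re (det D) * Re (det (L + R)) = Re (det L) * Re (det R)"
    using det_pd(1)[OF pdD] det_pd(1)[OF L] det_pd(1)[OF R] det_pd(1)[of "L + R"]
    by (metis Re_complex_of_real of_real_mult)
qed

section \<open>The bounds as Schur complements and the interior of the moment space\<close>

lemma blockinv_cong:
  assumes "\<And>i j. i < m \<Longrightarrow> j < m \<Longrightarrow> K i j = K' i j"
  shows "blockinv m K = blockinv m K'"
proof -
  have "is_blockinv m K = is_blockinv m K'"
    using assms by (auto simp: fun_eq_iff is_blockinv_def blockmult_def intro!: sum.cong)
  then show ?thesis unfolding blockinv_def is_blockinv_def fun_eq_iff by simp
qed

text \<open>Every moment index that enters is below \<open>k\<close>. With \<open>Splus_cong\<close>
  this makes the map to canonical moments triangular.\<close>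

lemma Sminus_cong:
  assumes "\<And>j. 1 \<le> j \<Longrightarrow> j < k \<Longrightarrow> S j = S' j"
  shows "Sminus S k = Sminus S' k"
proof (cases "k \<le> 1")
  case False
  have T: "Sx S j = Sx S' j" if "j < k" for j using assms that by (simp add: Sx_def)
  have H: "blockinv (k div 2) (Hlow S (k - 1 - 1)) = blockinv (k div 2) (Hlow S' (k - 1 - 1))"
  proof (rule blockinv_cong)
    fix i j assume "i < k div 2" "j < k div 2"
    moreover have "(k - 1 - 1) mod 2 < 2" "2 * (k div 2) \<le> k" by simp_all
    ultimately have "i + j + (k - 1 - 1) mod 2 < k" using False by linarith
    then show "Hlow S (k - 1 - 1) i j = Hlow S' (k - 1 - 1) i j" unfolding Hlow_def by (rule T)
  qed
  have h: "hlow S (k - 1) r = hlow S' (k - 1) r" if "r < k div 2" for r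
  proof -
    have "2 * (k div 2) \<le> k" "2 * ((k - 1) div 2) \<le> k - 1" by simp_all
    then have "(k - 1) div 2 + 1 + r < k" using False that by linarith
    then show ?thesis unfolding hlow_def by (rule T)
  qed
  have "(k - 1 + 1) div 2 = k div 2" using False by simp
  then show ?thesis using False unfolding Sminus_def Let_def
    by (simp only: if_False H) (auto intro!: sum.cong simp: h[unfolded One_nat_def])
qed (simp add: Sminus_def)

lemma Splus_cong:
  assumes "\<And>j. 1 \<le> j \<Longrightarrow> j < k \<Longrightarrow> S j = S' j"
  shows "Splus S k = Splus S' k"
proof (cases "k \<le> 1")
  case False
  have T: "Sx S j = Sx S' j" if "j < k" for j using assms that by (simp add: Sx_def)
  have H: "blockinv ((k - 1) div 2) (Hup S (k - 1 - 1)) = blockinv ((k - 1) div 2) (Hup S' (k - 1 - 1))"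
  proof (rule blockinv_cong)
    fix i j assume "i < (k - 1) div 2" "j < (k - 1) div 2"
    moreover have "1 - (k - 1 - 1) mod 2 \<le> 1" "2 * ((k - 1) div 2) \<le> k - 1" by simp_all
    ultimately have "i + j + (1 - (k - 1 - 1) mod 2) < k" "i + j + (1 - (k - 1 - 1) mod 2) + 1 < k"
      using False by linarith+
    then show "Hup S (k - 1 - 1) i j = Hup S' (k - 1 - 1) i j" unfolding Hup_def by (simp only: T)
  qed
  have h: "hup S (k - 1) r = hup S' (k - 1) r" if "r < (k - 1) div 2" for r
  proof -
    have "2 * (k div 2) \<le> k" "2 * ((k - 1) div 2) \<le> k - 1" "(k - 1 + 1) div 2 = k div 2"
      using False by simp_all
    then have "(k - 1 + 1) div 2 + r < k" "(k - 1 + 1) div 2 + r + 1 < k" using False that by linarith+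
    then show ?thesis unfolding hup_def by (simp only: T)
  qed
  have "S (k - 1) = S' (k - 1)" using False by (intro assms) auto
  then show ?thesis using False unfolding Splus_def Let_def
    by (simp only: if_False H) (auto intro!: arg_cong2[where f="(-)"] sum.cong simp: h[unfolded One_nat_def])
qed (simp add: Splus_def)

lemma half_pred:
  fixes k :: nat
  assumes "2 \<le> k"
  shows "(k - 1 - 1) mod 2 = k mod 2" "(k - 1) div 2 + 1 = k div 2 + k mod 2"
proof -
  obtain l where l: "k = Suc (Suc l)" using assms by (metis add_2_eq_Suc le_Suc_ex)
  show "(k - 1 - 1) mod 2 = k mod 2" by (simp add: l)
  show "(k - 1) div 2 + 1 = k div 2 + k mod 2"
    by (cases "even l") (auto simp: l elim!: evenE oddE)
qed

text \<open>\<open>S k\<close> is the corner of the Hankel array and \<open>hlow\<close> its last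
  column; hermitian moments make the adjoint of that column the last row.\<close>

lemma moment_minus_Sminus:
  assumes herm: "\<And>j. hermitian (Sx S j)" and k: "1 \<le> k"
  shows "S k - Sminus S k = Lk (Sx S) k"
proof (cases "k = 1")
  case True then show ?thesis by (simp add: Sminus_def Lk_def hk_def Sx_def)
next
  case False
  then have k2: "2 \<le> k" using k by simp
  have H: "Hlow S (k - 1 - 1) = hk (Sx S) (k mod 2)"
  proof -
    have "(k - 1 - 1) mod 2 = k mod 2" by (rule half_pred[OF k2])
    then show ?thesis by (intro ext) (simp add: Hlow_def hk_def)
  qed
  have m: "(k - 1 + 1) div 2 = k div 2" using k2 by simp
  from half_pred(2)[OF k2] have i: "(k - 1) div 2 + 1 + r = k div 2 + r + k mod 2" "(k - 1) div 2 + 1 + r = r + k div 2 + k mod 2" for r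
    by linarith+
  have hc: "hlow S (k - 1) r = hk (Sx S) (k mod 2) r (k div 2)" for r
    unfolding hlow_def hk_def i(2) ..
  have hr: "cadj (hk (Sx S) (k mod 2) r (k div 2)) = hk (Sx S) (k mod 2) (k div 2) r" for r
    using herm_arr_hk[OF herm] by (simp add: herm_arr_def)
  have d: "S k = hk (Sx S) (k mod 2) (k div 2) (k div 2)"
  proof -
    have "k div 2 + k div 2 + k mod 2 = k" using div_mult_mod_eq[of k 2] by linarith
    then show ?thesis using k by (simp add: hk_def Sx_def)
  qed
  have n1: "\<not> k \<le> 1" using k2 by simp
  show ?thesis
    unfolding Sminus_def Let_def H m hc hr Lk_def schur_def if_not_P[OF n1] d[symmetric] ..
qed

text \<open>The corner of the array of differences is \<open>S (k - 1) - S k\<close>, which accounts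
  for the leading moment of order \<open>k - 1\<close> in the upper bound.\<close>

lemma Splus_minus_moment:
  assumes herm: "\<And>j. hermitian (Sx S j)" and k: "1 \<le> k"
  shows "Splus S k - S k = Rk (Sx S) k"
proof (cases "k = 1")
  case True then show ?thesis by (simp add: Splus_def Rk_def hd'_def Sx_def)
next
  case False
  then have k2: "2 \<le> k" using k by simp
  define m a where "m = (k - 1) div 2" and "a = 1 - k mod 2"
  have H: "Hup S (k - 1 - 1) = hd' (Sx S) a"
  proof -
    have "(k - 1 - 1) mod 2 = k mod 2" by (rule half_pred[OF k2])
    then show ?thesis by (intro ext) (simp add: Hup_def hd'_def a_def)
  qed
  have "k mod 2 < 2" by simp
  with half_pred(2)[OF k2] have ma: "k div 2 = m + a" unfolding m_def a_def by linarith
  then have "(k - 1 + 1) div 2 = m + a" using k2 by simp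
  then have i: "(k - 1 + 1) div 2 + r = m + r + a" "(k - 1 + 1) div 2 + r = r + m + a" for r
    by linarith+
  have hc: "hup S (k - 1) r = hd' (Sx S) a r m" for r
    unfolding hup_def hd'_def i(2) ..
  have hr: "cadj (hd' (Sx S) a r m) = hd' (Sx S) a m r" for r
    using herm_arr_hd'[OF herm] by (simp add: herm_arr_def)
  have d: "hd' (Sx S) a m m = S (k - 1) - S k"
  proof -
    have "k mod 2 < 2" by simp
    then have "m + m + a = k - 1"
      using half_pred(2)[OF k2] div_mult_mod_eq[of k 2] unfolding m_def a_def by linarith
    then show ?thesis using k2 by (simp add: hd'_def Sx_def)
  qed
  have n1: "\<not> k \<le> 1" using k2 by simp
  show ?thesis
    unfolding Splus_def Let_def H hc hr Rk_def schur_def if_not_P[OF n1] m_def[symmetric] a_def[symmetric] d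
    by (simp add: algebra_simps)
qed

text \<open>The interior of the moment space, described by the strict inequalities for orders up to
  \<open>n\<close>.\<close>

definition posS :: "nat \<Rightarrow> (nat \<Rightarrow> 'p::finite cmat) \<Rightarrow> bool" where
  "posS n S \<longleftrightarrow> (\<forall>k\<in>{1..n}. hermitian (S k) \<and> pd (S k - Sminus S k) \<and> pd (Splus S k - S k))"

lemma posS_0 [simp]: "posS 0 S"
  by (simp add: posS_def)

lemma posS_Suc: "posS (Suc n) S \<longleftrightarrow> posS n S \<and> hermitian (S (Suc n)) \<and>
    pd (S (Suc n) - Sminus S (Suc n)) \<and> pd (Splus S (Suc n) - S (Suc n))"
  by (auto simp: posS_def atLeastAtMostSuc_conv)

text \<open>When \<open>posS n S\<close> holds, zeros above order \<open>n\<close> make all of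
  \<open>Sx (trunc n S)\<close> hermitian, while the bounds up to order \<open>n + 1\<close> stay
  the same.\<close>

definition trunc :: "nat \<Rightarrow> (nat \<Rightarrow> 'p::finite cmat) \<Rightarrow> nat \<Rightarrow> 'p cmat" where
  "trunc n S j = (if j \<le> n then S j else 0)"

lemma posS_cong:
  assumes "\<And>j. 1 \<le> j \<Longrightarrow> j \<le> n \<Longrightarrow> S j = S' j"
  shows "posS n S \<longleftrightarrow> posS n S'"
proof -
  have "Sminus S k = Sminus S' k" "Splus S k = Splus S' k" "S k = S' k" if "k \<in> {1..n}" for k
    using that assms by (auto intro!: Sminus_cong Splus_cong)
  then show ?thesis by (simp add: posS_def)
qed

lemma posS_Lk_Rk:
  assumes herm: "\<And>j. hermitian (Sx S j)"
  shows "posS n S \<longleftrightarrow> (\<forall>k\<in>{1..n}. pd (Lk (Sx S) k) \<and> pd (Rk (Sx S) k))"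
proof -
  have "hermitian (S k)" if "1 \<le> k" for k using herm[of k] that by (simp add: Sx_def)
  then show ?thesis by (auto simp: posS_def moment_minus_Sminus[OF herm] Splus_minus_moment[OF herm])
qed

lemma posS_hermitian_trunc: "posS n S \<Longrightarrow> hermitian (Sx (trunc n S) j)"
  by (auto simp: Sx_def trunc_def posS_def)

text \<open>These are the blocks that the bounds of order \<open>n + 1\<close> invert; all their
  pivots belong to orders at most \<open>n\<close>.\<close>

lemma is_blockinv_Lk_Rk:
  assumes T: "T 0 = mat 1" and pos: "\<forall>j\<in>{1..n}. pd (Lk T j) \<and> pd (Rk T j)"
  shows "is_blockinv (Suc n div 2) (hk T (Suc n mod 2)) (blockinv (Suc n div 2) (hk T (Suc n mod 2)))"
    "is_blockinv (n div 2) (hd' T (1 - Suc n mod 2)) (blockinv (n div 2) (hd' T (1 - Suc n mod 2)))"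
proof -
  note pds = pd_schurs[OF T pos]
  show "is_blockinv (Suc n div 2) (hk T (Suc n mod 2)) (blockinv (Suc n div 2) (hk T (Suc n mod 2)))"
  proof (rule is_blockinv_schur_pd)
    fix j assume j: "j < Suc n div 2"
    show "pd (schur j (hk T (Suc n mod 2)))"
    proof (cases "even (Suc n)")
      case True
      then have "Suc n mod 2 = 0" "2 * j \<le> n" using j by (auto elim!: evenE)
      then show ?thesis using pds(1)[of j] by simp
    next
      case False
      then have "Suc n mod 2 = 1" "2 * j + 1 \<le> n" using j by (auto elim!: evenE)
      then show ?thesis using pds(2)[of j] by simp
    qed
  qed
  show "is_blockinv (n div 2) (hd' T (1 - Suc n mod 2)) (blockinv (n div 2) (hd' T (1 - Suc n mod 2)))"
  proof (rule is_blockinv_schur_pd)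
    fix j assume j: "j < n div 2"
    show "pd (schur j (hd' T (1 - Suc n mod 2)))"
    proof (cases "even (Suc n)")
      case True
      then have "1 - Suc n mod 2 = 1" "2 * j + 2 \<le> n" using j by (auto elim!: oddE)
      then show ?thesis using pds(4)[of j] by simp
    next
      case False
      then have "1 - Suc n mod 2 = 0" "2 * j + 1 \<le> n" using j by (auto elim!: evenE)
      then show ?thesis using pds(3)[of j] by simp
    qed
  qed
qed

lemma posS_range:
  fixes S :: "nat \<Rightarrow> 'p::finite cmat"
  assumes pos: "posS n S"
  shows "hermitian (Sminus S (Suc n))" "hermitian (Splus S (Suc n))"
    "pd (Splus S (Suc n) - Sminus S (Suc n))"
    "n = 0 \<Longrightarrow> Splus S (Suc n) - Sminus S (Suc n) = mat 1"
    "1 \<le> n \<Longrightarrow> Re (det (Splus S (Suc n) - Sminus S (Suc n))) * Re (det (Splus S n - Sminus S n)) =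
      Re (det (S n - Sminus S n)) * Re (det (Splus S n - S n))"
proof -
  define S' where "S' = trunc n S"
  define T where "T = Sx S'"
  have herm: "hermitian (Sx S' j)" for j unfolding S'_def by (rule posS_hermitian_trunc[OF pos])
  have "posS n S'" using pos posS_cong[of n S S'] by (simp add: S'_def trunc_def)
  then have LR: "\<forall>j\<in>{1..n}. pd (Lk T j) \<and> pd (Rk T j)"
    unfolding posS_Lk_Rk[OF herm] T_def by simp
  have T: "T 0 = mat 1" by (simp add: T_def Sx_def)
  have cong: "Sminus S k = Sminus S' k" "Splus S k = Splus S' k" if "k \<le> Suc n" for k
    using that by (auto intro!: Sminus_cong Splus_cong simp: S'_def trunc_def)
  \<comment> \<open>With the moment of order \<open>n + 1\<close> set to zero, the Schur complements
    are the bounds themselves, up to sign.\<close>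
  have S'Suc: "S' (Suc n) = 0" by (simp add: S'_def trunc_def)
  have eq: "- Sminus S (Suc n) = Lk T (Suc n)" "Splus S (Suc n) = Rk T (Suc n)"
    using moment_minus_Sminus[OF herm, of "Suc n"] Splus_minus_moment[OF herm, of "Suc n"]
    by (simp_all add: cong S'Suc T_def)
  have hT: "hermitian (T k)" for k unfolding T_def by (rule herm)
  have hermLR: "hermitian (Lk T (Suc n))" "hermitian (Rk T (Suc n))"
    unfolding Lk_def Rk_def diff_Suc_1
    using is_blockinv_Lk_Rk[OF T LR] herm_arr_hk[OF hT] herm_arr_hd'[OF hT] by (auto intro: hermitian_schur)
  show "hermitian (Sminus S (Suc n))"
    using hermLR(1) hermitian_diff[OF hermitian_zero hermLR(1)] by (simp flip: eq)
  show "hermitian (Splus S (Suc n))" using hermLR(2) by (simp flip: eq)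
  have D: "Splus S (Suc n) - Sminus S (Suc n) = Lk T (Suc n) + Rk T (Suc n)" by (simp flip: eq)
  show n0: "Splus S (Suc n) - Sminus S (Suc n) = mat 1" if "n = 0"
    using that by (simp add: Splus_def Sminus_def)
  have "pd (Lk T (Suc n) + Rk T (Suc n)) \<and>
      Re (det (Lk T (Suc n) + Rk T (Suc n))) * Re (det (Lk T n + Rk T n)) = Re (det (Lk T n)) * Re (det (Rk T n))"
    if n: "1 \<le> n"
  proof -
    obtain Li Ri where LiRi: "Lk T n ** Li = mat 1" "Rk T n ** Ri = mat 1"
      "(Lk T (Suc n) + Rk T (Suc n)) ** (Li + Ri) = mat 1"
      using range_step[OF T LR n] by metis
    show ?thesis using parallel_sum[OF _ _ LiRi] LR n by auto
  qed
  note step = this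
  show "pd (Splus S (Suc n) - Sminus S (Suc n))"
  proof (cases "n = 0")
    case True show ?thesis unfolding n0[OF True] by simp
  next
    case False then show ?thesis unfolding D using step by simp
  qed
  show "Re (det (Splus S (Suc n) - Sminus S (Suc n))) * Re (det (Splus S n - Sminus S n)) =
      Re (det (S n - Sminus S n)) * Re (det (Splus S n - S n))" if n: "1 \<le> n"
  proof -
    have "S' n = S n" by (simp add: S'_def trunc_def)
    then have "S n - Sminus S n = Lk T n" "Splus S n - S n = Rk T n"
      using moment_minus_Sminus[OF herm n] Splus_minus_moment[OF herm n] by (simp_all add: cong T_def)
    moreover have "Splus S n - Sminus S n = (S n - Sminus S n) + (Splus S n - S n)" by simp
    ultimately show ?thesis using step[OF n] by (simp only: D)
  qed
qed

subsection \<open>Finitely atomic matrix measures\<close>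

text \<open>One equation is solved for an unknown \<open>k\<close> and substituted into the
  others.\<close>

lemma homogeneous_system_nontrivial:
  fixes a :: "'e \<Rightarrow> 'i \<Rightarrow> real"
  assumes "finite E" "finite I" "card E < card I"
  shows "\<exists>c. (\<exists>i\<in>I. c i \<noteq> 0) \<and> (\<forall>e\<in>E. (\<Sum>i\<in>I. a e i * c i) = 0)"
  using assms
proof (induction E arbitrary: I a rule: finite_induct)
  case empty
  then have "I \<noteq> {}" by auto
  then show ?case by (intro exI[of _ "\<lambda>_. 1"]) auto
next
  case (insert e E)
  show ?case
  proof (cases "\<forall>i\<in>I. a e i = 0")
    case True
    have "card E < card I" using insert by simp
    from insert.IH[OF insert.prems(1) this, of a] obtain c where
      "(\<exists>i\<in>I. c i \<noteq> 0) \<and> (\<forall>e\<in>E. (\<Sum>i\<in>I. a e i * c i) = 0)" by blast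
    then show ?thesis using True by (intro exI[of _ c]) (simp add: sum.neutral)
  next
    case False
    then obtain k where k: "k \<in> I" "a e k \<noteq> 0" by blast
    define b where "b e' i = a e' i - a e i * a e' k / a e k" for e' i
    have "card E < card (I - {k})" using insert k by (simp add: card_Diff_singleton)
    from insert.IH[OF _ this, of b] insert.prems(1) obtain c where
      c: "\<exists>i\<in>I - {k}. c i \<noteq> 0" "\<forall>e'\<in>E. (\<Sum>i\<in>I - {k}. b e' i * c i) = 0" by auto
    define s where "s = (\<Sum>i\<in>I - {k}. a e i * c i)"
    define c' where "c' i = (if i = k then - s / a e k else c i)" for i
    have sum: "(\<Sum>i\<in>I. a e' i * c' i) = - a e' k * s / a e k + (\<Sum>i\<in>I - {k}. a e' i * c i)" for e'
    proof -
      have "(\<Sum>i\<in>I. a e' i * c' i) = a e' k * c' k + (\<Sum>i\<in>I - {k}. a e' i * c' i)"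
        using k insert.prems(1) by (intro sum.remove)
      moreover have "(\<Sum>i\<in>I - {k}. a e' i * c' i) = (\<Sum>i\<in>I - {k}. a e' i * c i)"
        by (intro sum.cong) (auto simp: c'_def)
      ultimately show ?thesis by (simp add: c'_def)
    qed
    have "(\<Sum>i\<in>I. a e i * c' i) = 0"
      unfolding sum using k by (simp add: s_def[symmetric])
    moreover have "(\<Sum>i\<in>I. a e' i * c' i) = 0" if "e' \<in> E" for e'
    proof -
      have "(\<Sum>i\<in>I - {k}. b e' i * c i) = (\<Sum>i\<in>I - {k}. a e' i * c i) - a e' k / a e k * s"
      proof -
        have "b e' i * c i = a e' i * c i - a e' k / a e k * (a e i * c i)" for i
          by (simp add: b_def algebra_simps)
        then show ?thesis by (simp add: s_def sum_subtractf sum_distrib_left)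
      qed
      then show ?thesis using c(2) that unfolding sum by simp
    qed
    moreover have "\<exists>i\<in>I. c' i \<noteq> 0" using c(1) by (auto simp: c'_def)
    ultimately show ?thesis by (intro exI[of _ c']) auto
  qed
qed

definition amom :: "'i set \<Rightarrow> ('i \<Rightarrow> real) \<Rightarrow> ('i \<Rightarrow> 'p::finite cmat) \<Rightarrow> nat \<Rightarrow> 'p cmat" where
  "amom I x A k = (\<Sum>i\<in>I. (x i ^ k) *\<^sub>R A i)"

text \<open>A real linear relation \<open>c\<close> between the contributions of the atoms allows
  scaling atom \<open>i\<close> by \<open>1 - c i / c i0\<close> without changing the moments. With
  the absolute value of \<open>c i0\<close> maximal all factors are nonnegative, and atom
  \<open>i0\<close> disappears.\<close>

lemma reduce_atom:
  fixes A :: "'i \<Rightarrow> 'p::finite cmat"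
  assumes I: "finite I" "2 * (Suc n * (CARD('p) * CARD('p))) < card I" and A: "\<And>i. i \<in> I \<Longrightarrow> psd (A i)"
  obtains i0 A' where "i0 \<in> I" "\<And>i. i \<in> I \<Longrightarrow> psd (A' i)" "\<And>k. k \<le> n \<Longrightarrow> amom (I - {i0}) x A' k = amom I x A k"
proof -
  \<comment> \<open>One equation for the real and one for the imaginary part of each entry of each
    moment.\<close>
  define E :: "(bool \<times> nat \<times> 'p \<times> 'p) set" where "E = UNIV \<times> {..n} \<times> UNIV \<times> UNIV"
  have E: "finite E" "card E < card I" using I by (simp_all add: E_def card_cartesian_product)
  define a where "a = (\<lambda>(b, k, r, s) i. x i ^ k * (if b then Re (A i $ r $ s) else Im (A i $ r $ s)))"
  obtain c where c: "\<exists>i\<in>I. c i \<noteq> 0" "\<forall>e\<in>E. (\<Sum>i\<in>I. a e i * c i) = 0"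
    using homogeneous_system_nontrivial[OF E(1) I(1) E(2), of a] by blast
  have sum0: "(\<Sum>i\<in>I. (x i ^ k * c i) *\<^sub>R A i) = 0" if k: "k \<le> n" for k
  proof -
    have "Re (\<Sum>i\<in>I. (x i ^ k * c i) *\<^sub>R A i $ r $ s) = 0" "Im (\<Sum>i\<in>I. (x i ^ k * c i) *\<^sub>R A i $ r $ s) = 0" for r s
      using bspec[OF c(2), of "(True, k, r, s)"] bspec[OF c(2), of "(False, k, r, s)"] k
      by (simp_all add: E_def a_def mult_ac)
    then show ?thesis by (simp add: vec_eq_iff complex_eq_iff)
  qed
  obtain i0 where i0: "i0 \<in> I" "\<And>i. i \<in> I \<Longrightarrow> \<bar>c i\<bar> \<le> \<bar>c i0\<bar>"
  proof -
    have "Max ((\<lambda>i. \<bar>c i\<bar>) ` I) \<in> (\<lambda>i. \<bar>c i\<bar>) ` I" using I(1) c(1) by (intro Max_in) auto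
    then obtain i0 where i0: "i0 \<in> I" "Max ((\<lambda>i. \<bar>c i\<bar>) ` I) = \<bar>c i0\<bar>" by blast
    then have "\<bar>c i\<bar> \<le> \<bar>c i0\<bar>" if "i \<in> I" for i
      using Max_ge[of "(\<lambda>i. \<bar>c i\<bar>) ` I" "\<bar>c i\<bar>"] I(1) that by simp
    with i0(1) that show ?thesis by blast
  qed
  have c0: "c i0 \<noteq> 0" using c(1) i0(2) by (metis abs_le_zero_iff abs_zero)
  define A' where "A' i = (1 - c i / c i0) *\<^sub>R A i" for i
  have "psd (A' i)" if "i \<in> I" for i
  proof -
    have "c i / c i0 \<le> \<bar>c i\<bar> / \<bar>c i0\<bar>" by (metis abs_divide abs_ge_self)
    also have "\<dots> \<le> 1" using i0(2)[OF that] c0 by simp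
    finally show ?thesis using A[OF that] by (simp add: A'_def psd_scaleR)
  qed
  moreover have "amom (I - {i0}) x A' k = amom I x A k" if "k \<le> n" for k
  proof -
    have "A' i0 = 0" using c0 by (simp add: A'_def)
    then have "amom (I - {i0}) x A' k = amom I x A' k"
      using I(1) i0(1) by (simp add: amom_def sum.remove)
    also have "\<dots> = (\<Sum>i\<in>I. (x i ^ k) *\<^sub>R A i - (1 / c i0) *\<^sub>R ((x i ^ k * c i) *\<^sub>R A i))"
      unfolding amom_def by (intro sum.cong refl) (simp add: A'_def algebra_simps)
    also have "\<dots> = amom I x A k - (1 / c i0) *\<^sub>R (\<Sum>i\<in>I. (x i ^ k * c i) *\<^sub>R A i)"
      by (simp add: sum_subtractf scaleR_sum_right amom_def)
    finally show ?thesis by (simp add: sum0[OF that])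
  qed
  ultimately show ?thesis using that i0(1) by blast
qed

lemma reduce_atoms:
  fixes A :: "'i \<Rightarrow> 'p::finite cmat"
  assumes I: "finite I" and A: "\<And>i. i \<in> I \<Longrightarrow> psd (A i)"
  shows "\<exists>J A'. J \<subseteq> I \<and> card J \<le> 2 * (Suc n * (CARD('p) * CARD('p))) \<and> (\<forall>i\<in>J. psd (A' i)) \<and>
    (\<forall>k\<le>n. amom J x A' k = amom I x A k)"
proof -
  let ?P = "\<lambda>I A J A'. J \<subseteq> I \<and> card J \<le> 2 * (Suc n * (CARD('p) * CARD('p))) \<and> (\<forall>i\<in>J. psd (A' i)) \<and>
    (\<forall>k\<le>n. amom J x A' k = amom I x A k)"
  show "\<exists>J A'. ?P I A J A'" using I A
  proof (induction "card I" arbitrary: I A rule: less_induct)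
    case less
    show ?case
    proof (cases "card I \<le> 2 * (Suc n * (CARD('p) * CARD('p)))")
      case True
      then show ?thesis using less.prems by (intro exI[of _ I] exI[of _ A]) auto
    next
      case False
      obtain i0 A1 where i0: "i0 \<in> I" "\<And>i. i \<in> I \<Longrightarrow> psd (A1 i)"
        "\<And>k. k \<le> n \<Longrightarrow> amom (I - {i0}) x A1 k = amom I x A k"
        using reduce_atom[of I n A x] less.prems False by auto
      have "card (I - {i0}) < card I" using i0(1) less.prems(1) by (rule card_Diff1_less[rotated])
      from less.hyps[OF this, of A1] obtain J A' where "?P (I - {i0}) A1 J A'" using less.prems(1) i0(2) by auto
      then have "?P I A J A'" using i0(3) by auto
      then show ?thesis by (intro exI)
    qed
  qed
qed

text \<open>The radius p^3 is the factor p^2 of \<open>norm_le_tr\<close> times the total trace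
  p.\<close>

definition atom_par :: "nat \<Rightarrow> (nat \<Rightarrow> real \<times> 'p::finite cmat) set" where
  "atom_par d = {\<theta>. (\<forall>i. \<theta> i \<in> {0..1} \<times> ({A. psd A} \<inter> cball 0 (real CARD('p) ^ 3)))} \<inter>
     {\<theta>. (\<Sum>i<d. snd (\<theta> i)) = mat 1}"

definition atom_map :: "nat \<Rightarrow> nat \<Rightarrow> (nat \<Rightarrow> real \<times> 'p::finite cmat) \<Rightarrow> nat \<Rightarrow> 'p cmat" where
  "atom_map n d \<theta> = (\<lambda>k\<in>{1..n}. \<Sum>i<d. (fst (\<theta> i) ^ k) *\<^sub>R snd (\<theta> i))"

text \<open>By Caratheodory's argument this many atoms suffice; \<open>2 (n + 1) p\<^sup>2\<close> counts the real coordinates of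
  the moments of orders 0 to \<open>n\<close>.\<close>

definition atomic_moments :: "nat \<Rightarrow> (nat \<Rightarrow> 'p::finite cmat) set" where
  "atomic_moments n = atom_map n (2 * (Suc n * (CARD('p) * CARD('p)))) `
     atom_par (2 * (Suc n * (CARD('p) * CARD('p))))"

text \<open>Tychonoff's theorem in the function space topology.\<close>

lemma compact_functions:
  assumes "compact K" shows "compact {\<theta> :: nat \<Rightarrow> 'a::topological_space. \<forall>i. \<theta> i \<in> K}"
proof -
  have "compactin (product_topology (\<lambda>_::nat. euclidean :: 'a topology) UNIV) (Pi\<^sub>E UNIV (\<lambda>_. K))"
    using assms by (auto simp: compactin_PiE)
  moreover have "Pi\<^sub>E UNIV (\<lambda>_. K) = {\<theta> :: nat \<Rightarrow> 'a. \<forall>i. \<theta> i \<in> K}" by (auto simp: PiE_def)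
  ultimately show ?thesis by (simp add: euclidean_product_topology)
qed

text \<open>A fixed number of atoms makes the parameter set compact, and the moments depend
  continuously on the parameters.\<close>

lemma compact_atomic_moments: "compact (atomic_moments n :: (nat \<Rightarrow> 'p::finite cmat) set)"
proof -
  define d where "d = 2 * (Suc n * (CARD('p) * CARD('p)))"
  have fs: "continuous_on UNIV (\<lambda>\<theta>. fst (\<theta> i))" "continuous_on UNIV (\<lambda>\<theta>. snd (\<theta> i))" for i and \<theta> :: "nat \<Rightarrow> real \<times> 'p cmat"
    by (intro continuous_on_fst continuous_on_snd continuous_on_product_coordinates)+
  have "closed {\<theta> :: nat \<Rightarrow> real \<times> 'p cmat. (\<Sum>i<d. snd (\<theta> i)) = mat 1}"
    by (intro closed_Collect_eq continuous_intros continuous_on_snd continuous_on_product_coordinates)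
  moreover have "compact ({0..1::real} \<times> ({A :: 'p cmat. psd A} \<inter> cball 0 (real CARD('p) ^ 3)))"
    by (intro compact_Times closed_Int_compact closed_psd) auto
  ultimately have c: "compact (atom_par d :: (nat \<Rightarrow> real \<times> 'p cmat) set)"
    unfolding atom_par_def by (intro compact_Int_closed compact_functions)
  have "continuous_on UNIV (atom_map n d :: _ \<Rightarrow> nat \<Rightarrow> 'p cmat)"
  proof (rule continuous_on_coordinatewise_then_product)
    fix k
    show "continuous_on UNIV (\<lambda>\<theta> :: nat \<Rightarrow> real \<times> 'p cmat. atom_map n d \<theta> k)"
      by (cases "k \<in> {1..n}")
         (auto simp: atom_map_def intro!: continuous_intros continuous_on_fst continuous_on_snd continuous_on_product_coordinates)
  qed
  then show ?thesis
    unfolding atomic_moments_def d_def[symmetric]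
    by (intro compact_continuous_image c) (rule continuous_on_subset, auto)
qed

lemma atomic_momentsI:
  fixes A :: "'i \<Rightarrow> 'p::finite cmat"
  assumes I: "finite I" and A: "\<And>i. i \<in> I \<Longrightarrow> psd (A i)" and x: "\<And>i. i \<in> I \<Longrightarrow> x i \<in> {0..1}" and one: "sum A I = mat 1"
  shows "(\<lambda>k\<in>{1..n}. amom I x A k) \<in> atomic_moments n"
proof -
  define d where "d = 2 * (Suc n * (CARD('p) * CARD('p)))"
  have "\<exists>J A'. J \<subseteq> I \<and> card J \<le> d \<and> (\<forall>i\<in>J. psd (A' i)) \<and> (\<forall>k\<le>n. amom J x A' k = amom I x A k)"
    unfolding d_def by (rule reduce_atoms[OF I A])
  then obtain J A' where J0: "J \<subseteq> I \<and> card J \<le> d \<and> (\<forall>i\<in>J. psd (A' i)) \<and> (\<forall>k\<le>n. amom J x A' k = amom I x A k)"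
    by (elim exE)
  then have J: "J \<subseteq> I" "card J \<le> d" "\<And>i. i \<in> J \<Longrightarrow> psd (A' i)"
    "\<And>k. k \<le> n \<Longrightarrow> amom J x A' k = amom I x A k" by simp_all
  have finJ: "finite J" using J(1) I finite_subset by blast
  obtain h where h: "bij_betw h {0..<card J} J" using ex_bij_betw_nat_finite[OF finJ] by blast
  \<comment> \<open>Positions past \<open>card J\<close> carry weight 0 at the point 0, which fills
    up to \<open>d\<close> atoms.\<close>
  define \<theta> where "\<theta> i = (if i < card J then (x (h i), A' (h i)) else (0, 0))" for i
  have reindex: "(\<Sum>i<d. g (fst (\<theta> i)) *\<^sub>R snd (\<theta> i)) = (\<Sum>j\<in>J. g (x j) *\<^sub>R A' j)" for g
  proof -
    have "(\<Sum>i<d. g (fst (\<theta> i)) *\<^sub>R snd (\<theta> i)) = (\<Sum>i\<in>{0..<card J}. g (x (h i)) *\<^sub>R A' (h i))"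
      using J(2) by (intro sum.mono_neutral_cong_right) (auto simp: \<theta>_def)
    also have "\<dots> = (\<Sum>j\<in>J. g (x j) *\<^sub>R A' j)" by (rule sum.reindex_bij_betw[OF h])
    finally show ?thesis .
  qed
  have one': "(\<Sum>j\<in>J. A' j) = mat 1"
    using J(4)[of 0] one by (simp add: amom_def)
  have hJ: "h i \<in> J" if "i < card J" for i using h that by (auto simp: bij_betw_def)
  have nrm: "norm (A' j) \<le> real CARD('p) ^ 3" if j: "j \<in> J" for j
  proof -
    have "tr (A' j) \<le> (\<Sum>j\<in>J. tr (A' j))"
      using finJ j J(3) by (intro member_le_sum) (auto intro: psd_tr_nonneg)
    also have "\<dots> = real CARD('p)" using one' tr_mat_1 by (metis tr_sum)
    finally have "(real CARD('p))\<^sup>2 * tr (A' j) \<le> (real CARD('p))\<^sup>2 * real CARD('p)"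
      by (intro mult_left_mono) auto
    with norm_le_tr[OF J(3)[OF j]] have "norm (A' j) \<le> (real CARD('p))\<^sup>2 * real CARD('p)" by (rule order_trans)
    then show ?thesis by (simp add: power2_eq_square power3_eq_cube)
  qed
  have "\<theta> \<in> atom_par d"
  proof -
    have "\<theta> i \<in> {0..1} \<times> ({A. psd A} \<inter> cball 0 (real CARD('p) ^ 3))" for i
      using hJ[of i] x J(1) J(3)[of "h i"] nrm[of "h i"] by (cases "i < card J") (auto simp: \<theta>_def)
    moreover have "(\<Sum>i<d. snd (\<theta> i)) = mat 1" using reindex[of "\<lambda>_. 1"] one' by simp
    ultimately show ?thesis by (auto simp: atom_par_def)
  qed
  moreover have "(\<lambda>k\<in>{1..n}. amom I x A k) = atom_map n d \<theta>"
  proof -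
    have "(\<Sum>i<d. fst (\<theta> i) ^ k *\<^sub>R snd (\<theta> i)) = amom J x A' k" for k
      using reindex[of "\<lambda>y. y ^ k"] by (simp add: amom_def)
    then show ?thesis unfolding atom_map_def using J(4) by (intro restrict_ext) simp
  qed
  ultimately show ?thesis unfolding atomic_moments_def d_def by blast
qed

lemma atomic_momentsE:
  fixes S :: "nat \<Rightarrow> 'p::finite cmat"
  assumes "S \<in> atomic_moments n"
  obtains d :: nat and x A where "\<And>i. i < d \<Longrightarrow> psd (A i)" "\<And>i. i < d \<Longrightarrow> x i \<in> {0..1}" "(\<Sum>i<d. A i) = mat 1"
    "S = (\<lambda>k\<in>{1..n}. amom {..<d} x A k)"
proof -
  define d where "d = 2 * (Suc n * (CARD('p) * CARD('p)))"
  obtain \<theta> where \<theta>: "\<theta> \<in> atom_par d" "S = atom_map n d \<theta>"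
    using assms unfolding atomic_moments_def d_def by blast
  show ?thesis
  proof (rule that[of d "\<lambda>i. snd (\<theta> i)" "\<lambda>i. fst (\<theta> i)"])
    show "S = (\<lambda>k\<in>{1..n}. amom {..<d} (\<lambda>i. fst (\<theta> i)) (\<lambda>i. snd (\<theta> i)) k)"
      by (simp add: \<theta>(2) atom_map_def amom_def)
    show "(\<Sum>i<d. snd (\<theta> i)) = mat 1" using \<theta>(1) by (simp add: atom_par_def)
    fix i
    have "\<theta> i \<in> {0..1} \<times> ({A. psd A} \<inter> cball 0 (real CARD('p) ^ 3))" using \<theta>(1) by (simp add: atom_par_def)
    then show "psd (snd (\<theta> i))" "fst (\<theta> i) \<in> {0..1}" by (auto simp: mem_Times_iff)
  qed
qed

lemma atomic_moments_limit:
  fixes S :: "nat \<Rightarrow> 'p::finite cmat"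
  assumes V: "\<And>N. V N \<in> atomic_moments n" and lim: "\<And>k. k \<in> {1..n} \<Longrightarrow> (\<lambda>N. V N k) \<longlonglongrightarrow> S k"
    and S: "S \<in> extensional {1..n}"
  shows "S \<in> atomic_moments n"
proof (rule closed_sequentially[OF compact_imp_closed[OF compact_atomic_moments]])
  show "V N \<in> atomic_moments n" for N by (rule V)
  have "(\<lambda>N. V N k) \<longlonglongrightarrow> S k" for k
  proof (cases "k \<in> {1..n}")
    case False
    \<comment> \<open>Off the index set every member of the moment space is
      \<open>undefined\<close>.\<close>
    then have "V N k = undefined" for N using V[of N] by (auto simp: atomic_moments_def atom_map_def)
    moreover have "S k = undefined" using S False by (auto simp: extensional_def)
    ultimately show ?thesis by simp
  qed (rule lim)
  then have "limitin (product_topology (\<lambda>_. euclidean) UNIV) V S sequentially"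
    unfolding limitin_componentwise by simp
  then show "V \<longlonglongrightarrow> S"
    by (simp add: euclidean_product_topology)
qed

subsection \<open>The moment space\<close>

definition cell :: "nat \<Rightarrow> nat \<Rightarrow> real set" where
  "cell N j = {real j / real N ..< real (Suc j) / real N}"

lemma cell_iff: "0 < N \<Longrightarrow> x \<in> cell N j \<longleftrightarrow> 0 \<le> x \<and> j = nat \<lfloor>x * real N\<rfloor>"
proof -
  assume N: "0 < N"
  have "x \<in> cell N j \<longleftrightarrow> real j \<le> x * real N \<and> x * real N < real j + 1"
    using N by (simp add: cell_def field_simps)
  also have "\<dots> \<longleftrightarrow> \<lfloor>x * real N\<rfloor> = int j" by (simp add: floor_eq_iff)
  also have "\<dots> \<longleftrightarrow> 0 \<le> x \<and> j = nat \<lfloor>x * real N\<rfloor>"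
    using N by (auto simp: zero_le_mult_iff)
      (metis N floor_less_zero mult_neg_pos not_le of_nat_0_less_iff of_nat_less_0_iff)
  finally show ?thesis .
qed

lemma cell_refine:
  assumes "0 < N" "0 < M"
  shows "cell N j = (\<Union>l\<in>{j * M..<j * M + M}. cell (N * M) l)"
proof -
  have "x \<in> cell N j \<longleftrightarrow> 0 \<le> x \<and> nat \<lfloor>x * real (N * M)\<rfloor> \<in> {j * M..<j * M + M}" for x
  proof -
    have "x \<in> cell N j \<longleftrightarrow> real (j * M) \<le> x * real (N * M) \<and> x * real (N * M) < real (j * M + M)"
    proof -
      have "real (j * M) \<le> x * real (N * M) \<longleftrightarrow> real j * real M \<le> (x * real N) * real M"
        by (simp add: mult_ac)
      moreover have "x * real (N * M) < real (j * M + M) \<longleftrightarrow> (x * real N) * real M < (real j + 1) * real M"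
        by (simp add: algebra_simps)
      ultimately show ?thesis using assms by (simp add: cell_def pos_divide_le_eq pos_less_divide_eq add.commute)
    qed
    also have "\<dots> \<longleftrightarrow> int (j * M) \<le> \<lfloor>x * real (N * M)\<rfloor> \<and> \<lfloor>x * real (N * M)\<rfloor> < int (j * M + M)"
      by (simp only: le_floor_iff floor_less_iff of_int_of_nat_eq)
    also have "\<dots> \<longleftrightarrow> 0 \<le> x \<and> nat \<lfloor>x * real (N * M)\<rfloor> \<in> {j * M..<j * M + M}"
    proof (cases "0 \<le> x")
      case True
      define f where "f = \<lfloor>x * real (N * M)\<rfloor>"
      have "0 \<le> f" using True by (simp add: f_def)
      then obtain g where g: "f = int g" by (rule nonneg_int_cases)
      show ?thesis using True unfolding f_def[symmetric] g
        by (simp only: of_nat_le_iff of_nat_less_iff nat_int atLeastLessThan_iff simp_thms)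
    next
      case False
      then have "x * real (N * M) < 0" using assms by (simp add: mult_neg_pos)
      then have "\<lfloor>x * real (N * M)\<rfloor> < 0" by simp
      then have "\<not> int (j * M) \<le> \<lfloor>x * real (N * M)\<rfloor>" using of_nat_0_le_iff[of "j * M"] by linarith
      then show ?thesis using False by simp
    qed
    finally show ?thesis .
  qed
  then show ?thesis using cell_iff[of "N * M"] assms by auto
qed

lemma cell_disjoint: "0 < N \<Longrightarrow> i \<noteq> j \<Longrightarrow> cell N i \<inter> cell N j = {}"
  using cell_iff[of N] by auto

lemma cell_sub: "j < N \<Longrightarrow> cell N j \<subseteq> {0..<1}"
  by (auto simp: cell_def field_simps)

lemma cell_union: "0 < N \<Longrightarrow> (\<Union>j<N. cell N j) = {0..<1}"
proof
  assume N: "0 < N"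
  show "(\<Union>j<N. cell N j) \<subseteq> {0..<1}" using cell_sub by blast
  show "{0..<1} \<subseteq> (\<Union>j<N. cell N j)"
  proof
    fix x :: real assume x: "x \<in> {0..<1}"
    then have "x * real N < real N" using N by simp
    then have "nat \<lfloor>x * real N\<rfloor> < N" using N x by (simp add: nat_less_iff floor_less_iff)
    moreover have "x \<in> cell N (nat \<lfloor>x * real N\<rfloor>)" using cell_iff[OF N] x by simp
    ultimately show "x \<in> (\<Union>j<N. cell N j)" by blast
  qed
qed

lemma matrix_measure_finite_additive:
  assumes \<mu>: "matrix_measure \<mu>" and I: "finite I"
    and A: "\<And>i. i \<in> I \<Longrightarrow> A i \<in> sets borel" "\<And>i. i \<in> I \<Longrightarrow> A i \<subseteq> {0..1}" and disj: "disjoint_family_on A I"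
  shows "\<mu> (\<Union>i\<in>I. A i) = (\<Sum>i\<in>I. \<mu> (A i))"
proof -
  have ca: "(\<lambda>i. \<mu> (B i)) sums \<mu> (\<Union>i. B i)" if "\<And>i. B i \<in> sets borel \<and> B i \<subseteq> {0..1}" "disjoint_family B" for B :: "nat \<Rightarrow> real set"
    using \<mu> that by (auto simp: matrix_measure_def)
  \<comment> \<open>A convergent series with constant terms has zero terms.\<close>
  have "(\<lambda>_::nat. \<mu> {}) sums \<mu> {}" using ca[of "\<lambda>_. {}"] by (simp add: disjoint_family_on_def)
  then have "(\<lambda>_::nat. \<mu> {}) \<longlonglongrightarrow> 0" by (intro summable_LIMSEQ_zero) (rule sums_summable)
  then have empty: "\<mu> {} = 0" by (simp add: LIMSEQ_const_iff)
  have binary: "\<mu> (B \<union> C) = \<mu> B + \<mu> C"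
    if B: "B \<in> sets borel" "B \<subseteq> {0..1}" and C: "C \<in> sets borel" "C \<subseteq> {0..1}" and BC: "B \<inter> C = {}" for B C
  proof -
    define D where "D i = (if i = 0 then B else if i = 1 then C else {})" for i :: nat
    have "(\<lambda>i. \<mu> (D i)) sums \<mu> (\<Union>i. D i)"
      using B C BC by (intro ca) (auto simp: D_def disjoint_family_on_def)
    moreover have "(\<Union>i. D i) = B \<union> C" by (auto simp: D_def split: if_splits)
    moreover have "(\<lambda>i. \<mu> (D i)) sums (\<Sum>i\<in>{0, 1}. \<mu> (D i))"
      by (rule sums_finite) (auto simp: D_def empty)
    ultimately have "\<mu> (B \<union> C) = (\<Sum>i\<in>{0, 1}. \<mu> (D i))" using sums_unique2 by metis
    then show ?thesis by (simp add: D_def)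
  qed
  show ?thesis using I A disj
  proof (induction I rule: finite_induct)
    case empty show ?case by (simp add: \<open>\<mu> {} = 0\<close>)
  next
    case (insert i I)
    have "\<mu> (A i \<union> (\<Union>j\<in>I. A j)) = \<mu> (A i) + \<mu> (\<Union>j\<in>I. A j)"
    proof (rule binary)
      show "(\<Union>j\<in>I. A j) \<in> sets borel" using insert by (intro sets.finite_UN) auto
      show "A i \<inter> (\<Union>j\<in>I. A j) = {}" using insert by (auto simp: disjoint_family_on_def)
    qed (use insert in auto)
    then show ?case using insert by (auto simp: disjoint_family_on_def)
  qed
qed

lemma borel_cell [simp]: "cell N j \<in> sets borel"
  by (simp add: cell_def)

lemma mm_rsum_cell: "mm_rsum \<mu> k N = (\<Sum>j<N. (real j / real N) ^ k *\<^sub>R \<mu> (cell N j)) + \<mu> {1}"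
  by (simp add: mm_rsum_def cell_def)

lemma matrix_measure_cells:
  assumes \<mu>: "matrix_measure \<mu>" and N: "0 < N"
  shows "(\<Sum>j<N. \<mu> (cell N j)) + \<mu> {1} = mat 1" "j < N \<Longrightarrow> psd (\<mu> (cell N j))" "psd (\<mu> {1})"
proof -
  have sub: "cell N j \<subseteq> {0..1}" if "j < N" for j using cell_sub[OF that] by fastforce
  have "\<mu> (\<Union>b\<in>{False, True}. if b then {1} else {0..<1}) = (\<Sum>b\<in>{False, True}. \<mu> (if b then {1} else {0..<1}))"
    by (rule matrix_measure_finite_additive[OF \<mu>]) (auto simp: disjoint_family_on_def)
  moreover have "(\<Union>b\<in>{False, True}. if b then {1} else {0..<1}) = {0..1::real}" by auto
  moreover have "\<mu> (\<Union>j<N. cell N j) = (\<Sum>j<N. \<mu> (cell N j))"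
    using N sub cell_disjoint by (intro matrix_measure_finite_additive[OF \<mu>]) (auto simp: disjoint_family_on_def)
  ultimately show "(\<Sum>j<N. \<mu> (cell N j)) + \<mu> {1} = mat 1"
    using \<mu> by (simp add: cell_union[OF N] matrix_measure_def add.commute)
  show "j < N \<Longrightarrow> psd (\<mu> (cell N j))" "psd (\<mu> {1})" using \<mu> sub by (auto simp: matrix_measure_def)
qed

text \<open>Refining moves each evaluation point by at most 1/N, hence its k-th power by at most
  k/N. The masses of the cells are bounded through their traces, which add up to at most p.\<close>

lemma mm_rsum_refine:
  fixes \<mu> :: "real set \<Rightarrow> 'p::finite cmat"
  assumes \<mu>: "matrix_measure \<mu>" and N: "0 < N" and M: "0 < M"
  shows "norm (mm_rsum \<mu> k N - mm_rsum \<mu> k (N * M)) \<le> real k * real CARD('p) ^ 3 / real N"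
proof -
  let ?a = "\<lambda>j. real j / real N" and ?b = "\<lambda>l. real l / real (N * M)"
  have NM: "0 < N * M" using N M by simp
  have sub: "cell (N * M) l \<subseteq> {0..1}" if "l < N * M" for l using cell_sub[OF that] by fastforce
  have lt: "l < N * M" if "j < N" "l \<in> {j * M..<j * M + M}" for j l
  proof -
    have "Suc j * M \<le> N * M" using that by (intro mult_right_mono) auto
    then show ?thesis using that by simp
  qed
  have c: "\<mu> (cell N j) = (\<Sum>l\<in>{j * M..<j * M + M}. \<mu> (cell (N * M) l))" if j: "j < N" for j
    unfolding cell_refine[OF N M] using sub lt[OF j] cell_disjoint[OF NM]
    by (intro matrix_measure_finite_additive[OF \<mu>]) (auto simp: disjoint_family_on_def)
  have "mm_rsum \<mu> k N - mm_rsum \<mu> k (N * M) =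
      (\<Sum>j<N. \<Sum>l\<in>{j * M..<j * M + M}. (?a j ^ k) *\<^sub>R \<mu> (cell (N * M) l)) -
      (\<Sum>j<N. \<Sum>l\<in>{j * M..<j * M + M}. (?b l ^ k) *\<^sub>R \<mu> (cell (N * M) l))"
    unfolding sum.nat_group by (simp add: mm_rsum_cell c scaleR_sum_right)
  also have "\<dots> = (\<Sum>j<N. \<Sum>l\<in>{j * M..<j * M + M}. (?a j ^ k - ?b l ^ k) *\<^sub>R \<mu> (cell (N * M) l))"
    by (simp add: sum_subtractf[symmetric] scaleR_diff_left)
  finally have "norm (mm_rsum \<mu> k N - mm_rsum \<mu> k (N * M)) =
      norm (\<Sum>j<N. \<Sum>l\<in>{j * M..<j * M + M}. (?a j ^ k - ?b l ^ k) *\<^sub>R \<mu> (cell (N * M) l))"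
    by (simp only:)
  also have "\<dots> \<le> (\<Sum>j<N. \<Sum>l\<in>{j * M..<j * M + M}. real k / real N * ((real CARD('p))\<^sup>2 * tr (\<mu> (cell (N * M) l))))"
  proof (intro sum_norm_le)
    fix j l assume j: "j \<in> {..<N}" and l: "l \<in> {j * M..<j * M + M}"
    have lNM: "l < N * M" using lt j l by auto
    have ab: "norm (?a j) \<le> 1" "norm (?b l) \<le> 1" using j lNM NM by (simp_all add: divide_le_eq_1 del: of_nat_mult)
    have "\<bar>?a j - ?b l\<bar> \<le> 1 / real N"
    proof -
      have "?a j = real (j * M) / real (N * M)" "1 / real N = real M / real (N * M)" using M by simp_all
      then have "?a j - ?b l = (real (j * M) - real l) / real (N * M)" by (simp only: diff_divide_distrib)
      moreover have "\<bar>real (j * M) - real l\<bar> \<le> real M"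
      proof -
        have "real (j * M) \<le> real l" "real l < real (j * M + M)"
          using l by (simp_all only: of_nat_le_iff of_nat_less_iff atLeastLessThan_iff)
        then show ?thesis by (simp only: of_nat_add)
      qed
      ultimately show ?thesis using NM \<open>1 / real N = real M / real (N * M)\<close>
        by (simp only: abs_divide abs_of_nat) (intro divide_right_mono, auto)
    qed
    then have "\<bar>?a j ^ k - ?b l ^ k\<bar> \<le> real k * (1 / real N)"
      using norm_power_diff[OF ab, of k] by (smt (verit) mult_left_mono of_nat_0_le_iff real_norm_def)
    moreover have "norm (\<mu> (cell (N * M) l)) \<le> (real CARD('p))\<^sup>2 * tr (\<mu> (cell (N * M) l))"
      by (intro norm_le_tr matrix_measure_cells(2)[OF \<mu> NM lNM])
    ultimately show "norm ((?a j ^ k - ?b l ^ k) *\<^sub>R \<mu> (cell (N * M) l)) \<le> real k / real N * ((real CARD('p))\<^sup>2 * tr (\<mu> (cell (N * M) l)))"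
      by (simp only: norm_scaleR) (intro mult_mono, auto)
  qed
  also have "\<dots> = (\<Sum>l<N * M. real k / real N * ((real CARD('p))\<^sup>2 * tr (\<mu> (cell (N * M) l))))"
    by (rule sum.nat_group)
  also have "\<dots> = real k / real N * ((real CARD('p))\<^sup>2 * tr (\<Sum>l<N * M. \<mu> (cell (N * M) l)))"
    by (simp only: sum_distrib_left tr_sum)
  also have "\<dots> \<le> real k / real N * ((real CARD('p))\<^sup>2 * real CARD('p))"
  proof -
    have "tr (\<Sum>l<N * M. \<mu> (cell (N * M) l)) + tr (\<mu> {1}) = real CARD('p)"
      using matrix_measure_cells(1)[OF \<mu> NM] tr_mat_1 by (metis tr_add)
    then have "tr (\<Sum>l<N * M. \<mu> (cell (N * M) l)) \<le> real CARD('p)"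
      using psd_tr_nonneg[OF matrix_measure_cells(3)[OF \<mu> NM]] by linarith
    then show ?thesis by (intro mult_left_mono) auto
  qed
  finally show ?thesis by (simp add: power2_eq_square power3_eq_cube)
qed

text \<open>Two sums are compared through the common refinement into \<open>Suc m * Suc n\<close>
  cells; the successors keep the number of cells positive.\<close>

lemma convergent_mm_rsum:
  fixes \<mu> :: "real set \<Rightarrow> 'p::finite cmat"
  assumes \<mu>: "matrix_measure \<mu>"
  shows "mm_rsum \<mu> k \<longlonglongrightarrow> mm_moment \<mu> k"
proof -
  define C where "C = real k * real CARD('p) ^ 3"
  have C0: "0 \<le> C" by (simp add: C_def)
  have "Cauchy (\<lambda>N. mm_rsum \<mu> k (Suc N))"
  proof (rule metric_CauchyI)
    fix e :: real assume e: "0 < e"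
    obtain N0 :: nat where N0: "2 * C / e < real N0" using reals_Archimedean2 by blast
    show "\<exists>N0. \<forall>m\<ge>N0. \<forall>n\<ge>N0. dist (mm_rsum \<mu> k (Suc m)) (mm_rsum \<mu> k (Suc n)) < e"
    proof (intro exI[of _ N0] allI impI)
      fix m n assume mn: "N0 \<le> m" "N0 \<le> n"
      have b: "C / real (Suc l) < e / 2" if "N0 \<le> l" for l
      proof -
        have "2 * C / e < real (Suc l)" using N0 that by linarith
        then show ?thesis using e by (simp add: field_simps)
      qed
      have "norm (mm_rsum \<mu> k (Suc m) - mm_rsum \<mu> k (Suc m * Suc n)) \<le> C / real (Suc m)"
        "norm (mm_rsum \<mu> k (Suc n) - mm_rsum \<mu> k (Suc m * Suc n)) \<le> C / real (Suc n)"
        using mm_rsum_refine[OF \<mu>, of "Suc m" "Suc n" k] mm_rsum_refine[OF \<mu>, of "Suc n" "Suc m" k]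
        by (simp_all add: C_def mult.commute del: mult_Suc mult_Suc_right)
      then have "dist (mm_rsum \<mu> k (Suc m)) (mm_rsum \<mu> k (Suc m * Suc n)) < e / 2"
        "dist (mm_rsum \<mu> k (Suc n)) (mm_rsum \<mu> k (Suc m * Suc n)) < e / 2"
        using b[OF mn(1)] b[OF mn(2)] unfolding dist_norm by linarith+
      then show "dist (mm_rsum \<mu> k (Suc m)) (mm_rsum \<mu> k (Suc n)) < e"
        by (rule dist_triangle_half_l)
    qed
  qed
  then have "convergent (\<lambda>N. mm_rsum \<mu> k (Suc N))" by (rule Cauchy_convergent)
  then have "convergent (mm_rsum \<mu> k)" by (rule convergent_Suc_iff[THEN iffD1])
  then show ?thesis by (simp add: convergent_LIMSEQ_iff mm_moment_def)
qed

text \<open>Each Riemann sum is the moment of an atomic measure, and the compact set of atomic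
  moments contains the limit.\<close>

lemma moment_space_subset_atomic: "moment_space n \<subseteq> atomic_moments n"
proof
  fix S :: "nat \<Rightarrow> 'p::finite cmat" assume "S \<in> moment_space n"
  then obtain \<mu> where S: "S \<in> extensional {1..n}" and \<mu>: "matrix_measure \<mu>" and Sk: "\<And>k. k \<in> {1..n} \<Longrightarrow> S k = mm_moment \<mu> k"
    by (auto simp: moment_space_def PiE_def)
  show "S \<in> atomic_moments n"
  proof (rule atomic_moments_limit)
    fix N
    define x where "x j = real j / real (Suc N)" for j
    \<comment> \<open>The additional last atom sits at \<open>x (Suc N) = 1\<close> and carries the
      mass of the endpoint, which no cell contains.\<close>
    define A where "A j = (if j < Suc N then \<mu> (cell (Suc N) j) else \<mu> {1})" for j
    have am: "amom {..Suc N} x A k = mm_rsum \<mu> k (Suc N)" for k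
      by (simp add: amom_def mm_rsum_cell lessThan_Suc_atMost[symmetric] x_def A_def del: of_nat_Suc)
    have "(\<lambda>k\<in>{1..n}. amom {..Suc N} x A k) \<in> atomic_moments n"
    proof (rule atomic_momentsI)
      show "psd (A i)" for i using matrix_measure_cells[OF \<mu>, of "Suc N"] by (simp add: A_def)
      show "x i \<in> {0..1}" if "i \<in> {..Suc N}" for i using that by (simp add: x_def)
      show "sum A {..Suc N} = mat 1" using am[of 0] matrix_measure_cells(1)[OF \<mu>, of "Suc N"]
        by (simp add: amom_def mm_rsum_cell)
    qed simp
    then show "(\<lambda>k\<in>{1..n}. mm_rsum \<mu> k (Suc N)) \<in> atomic_moments n" by (simp only: am)
  next
    fix k assume "k \<in> {1..n}"
    then show "(\<lambda>N. (\<lambda>k\<in>{1..n}. mm_rsum \<mu> k (Suc N)) k) \<longlonglongrightarrow> S k"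
      using LIMSEQ_Suc[OF convergent_mm_rsum[OF \<mu>, of k]] by (simp add: Sk)
  qed (rule S)
qed

text \<open>For an atomic measure the Riemann sums converge atom by atom, so the limit in
  \<open>mm_moment\<close> is the exact moment.\<close>

lemma atomic_subset_moment_space: "atomic_moments n \<subseteq> moment_space n"
proof
  fix S :: "nat \<Rightarrow> 'p::finite cmat" assume "S \<in> atomic_moments n"
  then obtain d :: nat and x A where A: "\<And>i. i < d \<Longrightarrow> psd (A i)" and x: "\<And>i. i < d \<Longrightarrow> x i \<in> {0..1}"
    and one: "(\<Sum>i<d. A i) = mat 1" and S: "S = (\<lambda>k\<in>{1..n}. amom {..<d} x A k)"
    using atomic_momentsE by metis
  define \<mu> where "\<mu> B = (\<Sum>i<d. indicator B (x i) *\<^sub>R A i)" for B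
  have "matrix_measure \<mu>" unfolding matrix_measure_def
  proof (intro conjI ballI allI impI)
    fix B show "psd (\<mu> B)" unfolding \<mu>_def using A by (intro psd_sum psd_scaleR) auto
  next
    show "\<mu> {0..1} = mat 1" unfolding \<mu>_def one[symmetric] using x by (intro sum.cong) auto
  next
    fix B :: "nat \<Rightarrow> real set" assume disj: "disjoint_family B"
    show "(\<lambda>i. \<mu> (B i)) sums \<mu> (\<Union>i. B i)" unfolding \<mu>_def
    proof (intro sums_sum)
      fix i
      show "(\<lambda>j. indicator (B j) (x i) *\<^sub>R A i) sums (indicator (\<Union>j. B j) (x i) *\<^sub>R A i)"
      proof (cases "\<exists>j. x i \<in> B j")
        case True
        then obtain j0 where j0: "x i \<in> B j0" by blast
        then have "indicator (B j) (x i) *\<^sub>R A i = (if j = j0 then A i else 0)" for j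
          using disj by (auto simp: indicator_def disjoint_family_on_def)
        moreover have "indicator (\<Union>j. B j) (x i) *\<^sub>R A i = A i" using True by (auto simp: indicator_def)
        ultimately show ?thesis using sums_single[of j0 "\<lambda>_. A i"] by simp
      next
        case False
        then show ?thesis by (simp add: indicator_def)
      qed
    qed
  qed
  moreover have "S k = mm_moment \<mu> k" if k: "k \<in> {1..n}" for k
  proof -
    \<comment> \<open>The step function whose integral is the Riemann sum; the last summand supplies
      the endpoint 1.\<close>
    define w where "w N y = (\<Sum>j<N. (real j / real N) ^ k * indicator (cell N j) y) + indicator {1} y" for N and y :: real
    have bound: "\<bar>w N y - y ^ k\<bar> \<le> real k / real N" if y: "y \<in> {0..1}" and N: "0 < N" for y N
    proof (cases "y = 1")
      case True
      have "1 \<notin> cell N j" if "j < N" for j using cell_sub[OF that] by auto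
      then have "w N y = 1" using True by (simp add: w_def)
      then show ?thesis using True by simp
    next
      case False
      then have y1: "0 \<le> y" "y < 1" using y by auto
      define j0 where "j0 = nat \<lfloor>y * real N\<rfloor>"
      have "y \<in> (\<Union>j<N. cell N j)" using y1 cell_union[OF N] by simp
      then have j0: "j0 < N" "y \<in> cell N j0" using cell_iff[OF N] by (auto simp: j0_def)
      have "w N y = (\<Sum>j<N. if j = j0 then (real j0 / real N) ^ k else 0)"
      proof -
        have "indicator (cell N j) y = (if j = j0 then 1 else (0::real))" for j
          using cell_iff[OF N, of y j] y1 by (simp add: j0_def indicator_def)
        then show ?thesis using False by (simp add: w_def if_distrib[of "\<lambda>x. _ * x"] cong: if_cong)
      qed
      then have w: "w N y = (real j0 / real N) ^ k" using j0 by simp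
      have "norm (real j0 / real N) \<le> 1" "norm y \<le> 1" using j0 y1 by (auto simp: field_simps)
      from norm_power_diff[OF this, of k]
      have "\<bar>(real j0 / real N) ^ k - y ^ k\<bar> \<le> real k * \<bar>real j0 / real N - y\<bar>" by simp
      also have "\<dots> \<le> real k * (1 / real N)"
      proof (intro mult_left_mono)
        have "real j0 / real N \<le> y" "y < real j0 / real N + 1 / real N"
          using j0(2) by (simp_all add: cell_def add_divide_distrib)
        then show "\<bar>real j0 / real N - y\<bar> \<le> 1 / real N" by linarith
      qed simp
      finally show ?thesis by (simp add: w)
    qed
    have lim: "(\<lambda>N. w N y) \<longlonglongrightarrow> y ^ k" if y: "y \<in> {0..1}" for y
    proof -
      have "(\<lambda>N. real k / real N) \<longlonglongrightarrow> 0" by real_asymp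
      moreover have "eventually (\<lambda>N. norm (w N y - y ^ k) \<le> real k / real N) sequentially"
        using eventually_gt_at_top[of 0] by eventually_elim (use bound[OF y] in simp)
      ultimately have "(\<lambda>N. w N y - y ^ k) \<longlonglongrightarrow> 0" by (rule Lim_null_comparison[rotated])
      then show ?thesis by (simp add: LIM_zero_iff)
    qed
    have "mm_rsum \<mu> k N = (\<Sum>i<d. w N (x i) *\<^sub>R A i)" for N
    proof -
      have "(\<Sum>j<N. (real j / real N) ^ k *\<^sub>R \<mu> (cell N j)) =
          (\<Sum>i<d. \<Sum>j<N. ((real j / real N) ^ k * indicator (cell N j) (x i)) *\<^sub>R A i)"
        unfolding \<mu>_def by (subst sum.swap) (simp only: scaleR_sum_right scaleR_scaleR)
      also have "\<dots> = (\<Sum>i<d. (\<Sum>j<N. (real j / real N) ^ k * indicator (cell N j) (x i)) *\<^sub>R A i)"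
        by (simp only: scaleR_sum_left)
      finally have cells: "(\<Sum>j<N. (real j / real N) ^ k *\<^sub>R \<mu> (cell N j)) = \<dots>" .
      have one: "\<mu> {1} = (\<Sum>i<d. indicator {1} (x i) *\<^sub>R A i)" by (simp only: \<mu>_def)
      show ?thesis
        unfolding mm_rsum_cell cells one w_def scaleR_add_left sum.distrib ..
    qed
    moreover have "(\<lambda>N. \<Sum>i<d. w N (x i) *\<^sub>R A i) \<longlonglongrightarrow> (\<Sum>i<d. (x i ^ k) *\<^sub>R A i)"
      using x by (intro tendsto_sum tendsto_scaleR lim tendsto_const) auto
    ultimately have "(\<lambda>N. mm_rsum \<mu> k N) \<longlonglongrightarrow> amom {..<d} x A k"
      by (simp only: amom_def)
    then show ?thesis using k by (simp add: S mm_moment_def limI)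
  qed
  ultimately show "S \<in> moment_space n" by (auto simp: moment_space_def S)
qed

subsection \<open>Completely monotone sequences\<close>

text \<open>Pascal's rule.\<close>

lemma sum_binomial_Suc:
  fixes g :: "nat \<Rightarrow> 'a::real_vector"
  shows "(\<Sum>j\<le>Suc r. real (Suc r choose j) *\<^sub>R g j) = (\<Sum>j\<le>r. real (r choose j) *\<^sub>R (g j + g (Suc j)))"
proof -
  have "(\<Sum>j\<le>Suc r. real (Suc r choose j) *\<^sub>R g j) =
      (\<Sum>j\<le>r. real (r choose j) *\<^sub>R g (Suc j)) + (g 0 + (\<Sum>j\<le>r. real (r choose Suc j) *\<^sub>R g (Suc j)))"
    by (subst sum.atMost_Suc_shift) (simp add: scaleR_add_left sum.distrib add_ac)
  also have "g 0 + (\<Sum>j\<le>r. real (r choose Suc j) *\<^sub>R g (Suc j)) = (\<Sum>j\<le>Suc r. real (r choose j) *\<^sub>R g j)"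
    by (subst sum.atMost_Suc_shift) simp
  also have "\<dots> = (\<Sum>j\<le>r. real (r choose j) *\<^sub>R g j)" by (simp add: binomial_eq_0)
  finally show ?thesis by (simp add: scaleR_add_right sum.distrib add.commute)
qed

text \<open>With falling factorials in place of powers, the weight of a point changes into a
  binomial weight of smaller order; this makes the Bernstein sums exact.\<close>

lemma falling_ratio_binomial:
  assumes "k \<le> N" "j \<le> N"
  shows "(\<Prod>i<k. (real j - real i) / (real N - real i)) * real (N choose j) =
    (if j < k then 0 else real ((N - k) choose (j - k)))"
  using assms(1)
proof (induction k)
  case (Suc k)
  have IH: "(\<Prod>i<k. (real j - real i) / (real N - real i)) * real (N choose j) =
    (if j < k then 0 else real ((N - k) choose (j - k)))" using Suc by simp
  have "(\<Prod>i<Suc k. (real j - real i) / (real N - real i)) * real (N choose j) =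
      ((\<Prod>i<k. (real j - real i) / (real N - real i)) * real (N choose j)) * ((real j - real k) / (real N - real k))"
    by simp
  also have "\<dots> = (if j < Suc k then 0 else real ((N - Suc k) choose (j - Suc k)))"
  proof (cases "j \<le> k")
    case True then show ?thesis unfolding IH by (auto simp: le_less)
  next
    case False
    then obtain b where b: "j = Suc (k + b)" using less_iff_Suc_add[of k j] by auto
    obtain a where a: "N = Suc (k + a)" using less_iff_Suc_add[of k N] Suc.prems by auto
    have "real (Suc a * (a choose b)) = real ((Suc a choose Suc b) * Suc b)"
      by (simp only: Suc_times_binomial_eq)
    then have ab: "(1 + real a) * real (a choose b) = real (Suc a choose Suc b) * (1 + real b)"
      by (simp only: of_nat_mult of_nat_Suc)
    have 1: "\<not> j < k" "\<not> j < Suc k" "N - k = Suc a" "j - k = Suc b" "N - Suc k = a" "j - Suc k = b"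
      "real j - real k = 1 + real b" "real N - real k = 1 + real a" by (simp_all add: a b)
    have "1 + real a \<noteq> 0" by linarith
    then show ?thesis
      unfolding IH 1 if_not_P[OF 1(1)] if_not_P[OF 1(2)] times_divide_eq_right ab[symmetric] by simp
  qed
  finally show ?case .
qed simp

text \<open>Corresponding factors differ by at most k/(N - k), and there are k of them. The
  condition \<open>2 * k < N\<close> keeps every factor within [-1, 1], also where
  \<open>j < i\<close>.\<close>

lemma falling_ratio_approx:
  assumes "2 * k < N" "j \<le> N"
  shows "\<bar>(real j / real N) ^ k - (\<Prod>i<k. (real j - real i) / (real N - real i))\<bar> \<le> (real k)\<^sup>2 / (real N - real k)"
proof -
  have "norm ((\<Prod>i<k. real j / real N) - (\<Prod>i<k. (real j - real i) / (real N - real i))) \<le>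
      (\<Sum>i<k. norm (real j / real N - (real j - real i) / (real N - real i)))"
  proof (rule norm_prod_diff)
    show "norm (real j / real N) \<le> 1" using assms by simp
    fix i assume "i \<in> {..<k}"
    then show "norm ((real j - real i) / (real N - real i)) \<le> 1"
      using assms by (auto simp: abs_le_iff field_simps)
  qed
  also have "\<dots> \<le> (\<Sum>i<k. real k / (real N - real k))"
  proof (rule sum_mono)
    fix i assume i: "i \<in> {..<k}"
    have N: "real N > 0" "real N - real i > 0" "real N - real k > 0" using assms i by auto
    have "real j / real N - (real j - real i) / (real N - real i) = (real i / (real N - real i)) * ((real N - real j) / real N)"
      using N by (simp add: field_simps)
    then have "norm (real j / real N - (real j - real i) / (real N - real i)) = (real i / (real N - real i)) * ((real N - real j) / real N)"
      using N assms by (simp add: abs_mult)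
    also have "\<dots> \<le> (real i / (real N - real i)) * 1"
      using N assms by (intro mult_left_mono) auto
    also have "\<dots> \<le> real k / (real N - real k)"
      using N i by (simp, intro frac_le) auto
    finally show "norm (real j / real N - (real j - real i) / (real N - real i)) \<le> real k / (real N - real k)" .
  qed
  finally show ?thesis by (simp add: power2_eq_square)
qed

text \<open>The Bernstein weights \<open>(N choose j) D (N - j) j\<close> at \<open>j / N\<close> form atomic measures whose moments
  converge to the given sequence.\<close>

lemma completely_monotone_atomic:
  fixes D :: "nat \<Rightarrow> nat \<Rightarrow> 'p::finite cmat"
  assumes one: "D 0 0 = mat 1" and diff: "\<And>l k. D (Suc l) k = D l k - D l (Suc k)" and psd: "\<And>l k. psd (D l k)"
  shows "(\<lambda>k\<in>{1..n}. D 0 k) \<in> atomic_moments n"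
proof -
  \<comment> \<open>Iterates \<open>D l k = D (Suc l) k + D l (Suc k)\<close>.\<close>
  have expand: "(\<Sum>j\<le>r. real (r choose j) *\<^sub>R D (l + (r - j)) (k + j)) = D l k" for r l k
  proof (induction r)
    case (Suc r)
    have "(\<Sum>j\<le>Suc r. real (Suc r choose j) *\<^sub>R D (l + (Suc r - j)) (k + j)) =
        (\<Sum>j\<le>r. real (r choose j) *\<^sub>R (D (l + (Suc r - j)) (k + j) + D (l + (Suc r - Suc j)) (k + Suc j)))"
      by (rule sum_binomial_Suc)
    also have "\<dots> = (\<Sum>j\<le>r. real (r choose j) *\<^sub>R D (l + (r - j)) (k + j))"
      by (intro sum.cong refl) (simp add: Suc_diff_le diff)
    finally show ?case by (simp only: Suc)
  qed simp
  define x where "x N j = real j / real N" for N j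
  define A where "A N j = real (N choose j) *\<^sub>R D (N - j) j" for N j
  have A: "psd (A N j)" for N j unfolding A_def by (intro psd_scaleR psd) simp
  have sumA: "(\<Sum>j\<le>N. A N j) = mat 1" for N using expand[of N 0 0] by (simp add: A_def one)
  have trA: "(\<Sum>j\<le>N. tr (A N j)) = real CARD('p)" for N by (metis sumA tr_sum tr_mat_1)
  \<comment> \<open>The factorial moments of the Bernstein weights reproduce the sequence without
    error; only the passage to powers of j/N costs an error.\<close>
  have D0: "D 0 k = (\<Sum>j\<le>N. (\<Prod>i<k. (real j - real i) / (real N - real i)) *\<^sub>R A N j)" if k: "k \<le> N" for k N
  proof -
    have "D 0 k = (\<Sum>j\<le>N - k. real ((N - k) choose j) *\<^sub>R D (N - k - j) (k + j))"
      using expand[of "N - k" 0 k] by simp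
    also have "\<dots> = (\<Sum>j\<in>{k..N}. real ((N - k) choose (j - k)) *\<^sub>R D (N - j) j)"
      by (rule sum.reindex_bij_witness[of _ "\<lambda>j. j - k" "\<lambda>j. k + j"]) (use k in auto)
    also have "\<dots> = (\<Sum>j\<le>N. (if j < k then 0 else real ((N - k) choose (j - k))) *\<^sub>R D (N - j) j)"
      by (rule sum.mono_neutral_cong_left) auto
    also have "\<dots> = (\<Sum>j\<le>N. (\<Prod>i<k. (real j - real i) / (real N - real i)) *\<^sub>R A N j)"
      using falling_ratio_binomial[OF k] by (intro sum.cong refl) (simp add: A_def)
    finally show ?thesis .
  qed
  have bound: "norm (amom {..N} (x N) (A N) k - D 0 k) \<le> (real k)\<^sup>2 / (real N - real k) * real CARD('p) ^ 3"
    if N: "2 * k < N" for k N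
  proof -
    have "amom {..N} (x N) (A N) k - D 0 k =
        (\<Sum>j\<le>N. ((real j / real N) ^ k - (\<Prod>i<k. (real j - real i) / (real N - real i))) *\<^sub>R A N j)"
      using N by (subst D0[of k N]) (simp_all add: amom_def x_def scaleR_diff_left sum_subtractf)
    then have "norm (amom {..N} (x N) (A N) k - D 0 k) =
        norm (\<Sum>j\<le>N. ((real j / real N) ^ k - (\<Prod>i<k. (real j - real i) / (real N - real i))) *\<^sub>R A N j)"
      by (simp only:)
    also have "\<dots> \<le> (\<Sum>j\<le>N. (real k)\<^sup>2 / (real N - real k) * ((real CARD('p))\<^sup>2 * tr (A N j)))"
    proof (rule sum_norm_le)
      fix j assume "j \<in> {..N}"
      then have "\<bar>(real j / real N) ^ k - (\<Prod>i<k. (real j - real i) / (real N - real i))\<bar> \<le> (real k)\<^sup>2 / (real N - real k)"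
        using N by (intro falling_ratio_approx) auto
      then show "norm (((real j / real N) ^ k - (\<Prod>i<k. (real j - real i) / (real N - real i))) *\<^sub>R A N j)
          \<le> (real k)\<^sup>2 / (real N - real k) * ((real CARD('p))\<^sup>2 * tr (A N j))"
        using N unfolding norm_scaleR by (intro mult_mono norm_le_tr A) auto
    qed
    also have "\<dots> = (real k)\<^sup>2 / (real N - real k) * real CARD('p) ^ 3"
      by (simp only: sum_distrib_left[symmetric] trA) (simp add: power2_eq_square power3_eq_cube)
    finally show ?thesis .
  qed
  show ?thesis
  proof (rule atomic_moments_limit)
    show "(\<lambda>k\<in>{1..n}. amom {..N} (x N) (A N) k) \<in> atomic_moments n" for N
      by (rule atomic_momentsI) (auto simp: A x_def sumA divide_le_eq_1)
    fix k assume k: "k \<in> {1..n}"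
    have "(\<lambda>N. (real k)\<^sup>2 / (real N - real k) * real CARD('p) ^ 3) \<longlonglongrightarrow> 0" by real_asymp
    moreover have "eventually (\<lambda>N. norm (amom {..N} (x N) (A N) k - D 0 k) \<le> (real k)\<^sup>2 / (real N - real k) * real CARD('p) ^ 3) sequentially"
      using eventually_gt_at_top[of "2 * k"] by eventually_elim (rule bound)
    ultimately have "(\<lambda>N. amom {..N} (x N) (A N) k - D 0 k) \<longlonglongrightarrow> 0" by (rule Lim_null_comparison[rotated])
    then show "(\<lambda>N. (\<lambda>k\<in>{1..n}. amom {..N} (x N) (A N) k) k) \<longlonglongrightarrow> (\<lambda>k\<in>{1..n}. D 0 k) k"
      using k by (simp add: LIM_zero_iff)
  qed simp
qed

subsection \<open>Positive sequences are moment sequences\<close>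

definition form2 :: "nat \<Rightarrow> (nat \<Rightarrow> nat \<Rightarrow> 'p::finite cmat) \<Rightarrow> (nat \<Rightarrow> 'p cmat) \<Rightarrow> (nat \<Rightarrow> 'p cmat) \<Rightarrow> 'p cmat" where
  "form2 m K x y = (\<Sum>i<m. \<Sum>j<m. cadj (x i) ** K i j ** y j)"

lemma form2_cadj: "herm_arr K \<Longrightarrow> cadj (form2 m K x y) = form2 m K y x"
  unfolding form2_def by (subst (2) sum.swap) (simp add: cadj_sum cadj_mult herm_arr_def matrix_mul_assoc)

lemma form2_app: "form2 m K x y = (\<Sum>i<m. cadj (x i) ** app_bop (moc m K) y i)"
proof -
  have "app_bop (moc m K) y i = (\<Sum>j<m. K i j ** y j)" if "i < m" for i
    using that by transfer simp
  then show ?thesis by (simp add: form2_def matrix_mult_sum_right matrix_mul_assoc)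
qed

lemma app_bop_simps: "app_bop (f * g) x = app_bop f (app_bop g x)" "app_bop 1 x = x"
  "app_bop (f + g) x = (\<lambda>i. app_bop f x i + app_bop g x i)" "app_bop (f - g) x = (\<lambda>i. app_bop f x i - app_bop g x i)"
  by (transfer; simp)+

lemma form2_add_right: "form2 m K x (\<lambda>i. y i + z i) = form2 m K x y + form2 m K x z"
  and form2_diff_right: "form2 m K x (\<lambda>i. y i - z i) = form2 m K x y - form2 m K x z"
  by (simp_all add: form2_def matrix_ring_simps sum.distrib sum_subtractf)

lemma form2_diff_left: "form2 m K (\<lambda>i. y i - z i) x = form2 m K y x - form2 m K z x"
  by (simp add: form2_def matrix_ring_simps cadj_diff sum_subtractf)

text \<open>Block columns of length \<open>M\<close> stand for polynomials of degree at most
  \<open>m\<close> with matrix coefficients and \<open>sp\<close> for integration against the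
  unknown measure. The operator \<open>a\<close> plays the role of x: it is self-adjoint because
  \<open>K\<close> is hermitian, and \<open>a\<close> and \<open>c = 1 - a\<close> are positive
  because the forms of \<open>hk T 1\<close> and \<open>hd' T 0\<close> are. Then
  \<open>D l k\<close> stands for the integral of (1 - x)^l x^k.\<close>

lemma posS_odd_atomic:
  fixes S :: "nat \<Rightarrow> 'p::finite cmat"
  assumes n: "n = 2 * m + 1" and pos: "posS n S"
  shows "(\<lambda>k\<in>{1..n}. S k) \<in> atomic_moments n"
proof -
  define S' where "S' = trunc n S"
  define T where "T = Sx S'"
  have herm: "hermitian (Sx S' j)" for j unfolding S'_def by (rule posS_hermitian_trunc[OF pos])
  have "posS n S'" using pos posS_cong[of n S S'] by (simp add: S'_def trunc_def)
  then have LR: "\<forall>j\<in>{1..n}. pd (Lk T j) \<and> pd (Rk T j)"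
    unfolding posS_Lk_Rk[OF herm] T_def by simp
  have T: "T 0 = mat 1" by (simp add: T_def Sx_def)
  have TS: "T k = S k" if "k \<in> {1..n}" for k using that by (simp add: T_def Sx_def S'_def trunc_def)
  have hT: "hermitian (T k)" for k unfolding T_def by (rule herm)
  note pds = pd_schurs[OF T LR] and hk = herm_arr_hk[OF hT] and hd = herm_arr_hd'[OF hT]
  define M where "M = Suc m"
  have pd0: "pd (schur j (hk T 0))" if "j < M" for j using that n by (intro pds(1)) (simp add: M_def)
  have pd1: "pd (schur j (hk T 1))" if "j < M" for j using that n by (intro pds(2)) (simp add: M_def)
  have pd01: "pd (schur j (hd' T 0))" if "j < M" for j using that n by (intro pds(3)) (simp add: M_def)
  define H K Hi where "H = moc M (hk T 0)" and "K = moc M (hk T 1)" and "Hi = moc M (blockinv M (hk T 0))"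
  define e where "e = moc M (one_arr :: nat \<Rightarrow> nat \<Rightarrow> 'p cmat)"
  have inv: "H * Hi = e" "Hi * H = e"
    using is_blockinv_schur_pd[of M "hk T 0", OF pd0] by (simp_all add: is_blockinv_iff H_def Hi_def e_def)
  define a where "a = Hi * K"
  have Ha: "H * a = K"
    unfolding a_def mult.assoc[symmetric] inv by (simp add: e_def K_def mo_one_left)
  define sp where "sp = form2 M (hk T 0)"
  have sp_a: "sp x (app_bop a y) = form2 M (hk T 1) x y" for x y
    unfolding sp_def form2_app H_def[symmetric] K_def[symmetric] app_bop_simps(1)[symmetric] Ha ..
  have sp_sym: "cadj (sp x y) = sp y x" for x y unfolding sp_def by (rule form2_cadj[OF hk])
  have a_adj: "sp (app_bop a x) y = sp x (app_bop a y)" for x y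
  proof -
    have "sp (app_bop a x) y = cadj (sp y (app_bop a x))" by (simp only: sp_sym)
    also have "\<dots> = form2 M (hk T 1) x y" unfolding sp_a by (rule form2_cadj[OF hk])
    finally show ?thesis by (simp only: sp_a)
  qed
  define c where "c = 1 - a"
  have c_adj: "sp (app_bop c x) y = sp x (app_bop c y)" for x y
    unfolding c_def app_bop_simps sp_def form2_diff_left form2_diff_right using a_adj by (simp add: sp_def)
  have pow_adj: "sp (app_bop (b ^ k) x) y = sp x (app_bop (b ^ k) y)"
    if "\<And>x y. sp (app_bop b x) y = sp x (app_bop b y)" for b k x y
  proof (induction k arbitrary: x y)
    case 0 show ?case by (simp add: app_bop_simps)
  next
    case (Suc k)
    have "sp (app_bop (b ^ Suc k) x) y = sp (app_bop (b ^ k) x) (app_bop b y)"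
      by (simp only: power_Suc app_bop_simps(1) that)
    also have "\<dots> = sp x (app_bop (b ^ k) (app_bop b y))" by (rule Suc)
    finally show ?case by (simp only: power_Suc2 app_bop_simps(1))
  qed
  have ca: "a * c = c * a" by (simp add: c_def algebra_simps)
  then have comm: "a ^ i * c ^ j = c ^ j * a ^ i" for i j
    by (metis power_commuting_commutes)
  have mono_adj: "sp (app_bop (c ^ l * a ^ k) x) y = sp x (app_bop (c ^ l * a ^ k) y)" for l k x y
    unfolding comm[symmetric] unfolding app_bop_simps(1) by (subst pow_adj[OF a_adj], subst pow_adj[OF c_adj])
      (simp only: app_bop_simps(1)[symmetric] comm)
  \<comment> \<open>The constant polynomial 1.\<close>
  define C0 where "C0 = (one_arr 0 :: nat \<Rightarrow> 'p cmat)"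
  define D where "D l k = sp C0 (app_bop (c ^ l * a ^ k) C0)" for l k
  have psd_sp: "psd (sp w w)" for w
    using psd_block_form[of M "hk T 0" w, OF pd0 hk] by (simp add: sp_def form2_def block_form_def)
  have psd_a: "psd (sp w (app_bop a w))" for w
    using psd_block_form[of M "hk T 1" w, OF pd1 hk] by (simp add: sp_a form2_def block_form_def)
  have psd_c: "psd (sp w (app_bop c w))" for w
  proof -
    have "sp w (app_bop c w) = form2 M (hk T 0) w w - form2 M (hk T 1) w w"
      unfolding sp_a[symmetric] by (simp add: c_def app_bop_simps sp_def form2_diff_right)
    also have "\<dots> = block_form M (hd' T 0) w"
      by (simp add: form2_def block_form_def hk_def hd'_def matrix_ring_simps sum_subtractf)
    finally show ?thesis using psd_block_form[of M "hd' T 0" w, OF pd01 hd] by simp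
  qed
  \<comment> \<open>Since \<open>a + c = 1\<close>, the commuting product \<open>c * a\<close>
    splits into \<open>a * c * a + c * a * c\<close>, and each summand is a positive operator
    between two copies of a self-adjoint one.\<close>
  have psd_ca: "psd (sp w (app_bop (c * a) w))" for w
  proof -
    have "c * a = a * c * a + c * a * c" by (simp add: c_def algebra_simps)
    then have "sp w (app_bop (c * a) w) = sp w (app_bop (a * c * a + c * a * c) w)"
      by (rule arg_cong)
    also have "\<dots> = sp w (app_bop (a * c * a) w) + sp w (app_bop (c * a * c) w)"
      by (simp only: sp_def app_bop_simps(3) form2_add_right)
    also have "\<dots> = sp (app_bop a w) (app_bop c (app_bop a w)) + sp (app_bop c w) (app_bop a (app_bop c w))"
      by (simp add: app_bop_simps(1) a_adj c_adj)
    finally show ?thesis by (simp add: psd_add psd_a psd_c)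
  qed
  have psdD: "psd (D l k)" for l k
  proof -
    define l' k' where "l' = l div 2" and "k' = k div 2"
    define b where "b = c ^ l' * a ^ k'"
    define w where "w = app_bop b C0"
    \<comment> \<open>Half of each exponent moves to either side, leaving exponents 0 or 1 in the
      middle.\<close>
    have split: "c ^ l * a ^ k = b * (c ^ (l mod 2) * a ^ (k mod 2)) * b"
    proof -
      have "b * (c ^ (l mod 2) * a ^ (k mod 2)) * b =
          c ^ l' * (a ^ k' * c ^ (l mod 2)) * (a ^ (k mod 2) * c ^ l') * a ^ k'"
        by (simp add: b_def mult.assoc)
      also have "\<dots> = (c ^ l' * c ^ (l mod 2) * c ^ l') * (a ^ k' * a ^ (k mod 2) * a ^ k')"
        by (simp only: comm comm[THEN assoc_rule] mult.assoc)
      also have "\<dots> = c ^ (l' + l mod 2 + l') * a ^ (k' + k mod 2 + k')"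
        by (simp only: power_add)
      also have "l' + l mod 2 + l' = l" unfolding l'_def using div_mult_mod_eq[of l 2] by linarith
      also have "k' + k mod 2 + k' = k" unfolding k'_def using div_mult_mod_eq[of k 2] by linarith
      finally show ?thesis ..
    qed
    have "D l k = sp w (app_bop (c ^ (l mod 2) * a ^ (k mod 2)) w)"
      unfolding D_def split w_def mult.assoc app_bop_simps(1)[of b] unfolding b_def mono_adj
      by (simp only: app_bop_simps(1) mult.assoc)
    moreover have "l mod 2 = 0 \<or> l mod 2 = 1" "k mod 2 = 0 \<or> k mod 2 = 1" by auto
    ultimately show ?thesis
      using psd_sp[of w] psd_a[of w] psd_c[of w] psd_ca[of w] by (auto simp: app_bop_simps(2))
  qed
  have diffD: "D (Suc l) k = D l k - D l (Suc k)" for l k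
  proof -
    have "c ^ Suc l * a ^ k = c ^ l * a ^ k - c ^ l * a ^ Suc k"
      by (simp only: power_Suc2[of c]) (simp add: c_def algebra_simps)
    then show ?thesis by (simp only: D_def app_bop_simps(4) sp_def form2_diff_right)
  qed
  \<comment> \<open>Multiplication by x raises the degree, as long as it stays at most
    \<open>m\<close>.\<close>
  have a_shift: "app_bop a (one_arr j) = one_arr (Suc j)" if j: "Suc j < M" for j
  proof -
    have "app_bop K (one_arr j) = app_bop H (one_arr (Suc j))"
      unfolding K_def H_def using j
      by transfer (auto simp: fun_eq_iff one_arr_def hk_def if_distrib[of "\<lambda>x. _ ** x"] cong: if_cong)
    then have "app_bop a (one_arr j) = app_bop e (one_arr (Suc j))"
      unfolding a_def app_bop_simps(1) by (simp only: inv(2)[symmetric] app_bop_simps(1))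
    also have "\<dots> = one_arr (Suc j)"
      unfolding e_def using j
      by transfer (auto simp: fun_eq_iff one_arr_def if_distrib[of "\<lambda>x. _ ** x"] cong: if_cong)
    finally show ?thesis .
  qed
  have a_pow: "app_bop (a ^ j) C0 = one_arr j" if "j < M" for j
    using that by (induction j) (auto simp: C0_def app_bop_simps a_shift)
  have form_one: "form2 M F (one_arr i) (one_arr j) = F i j" if "i < M" "j < M" for i j F
    using that unfolding form2_def one_arr_def
    by (simp add: if_distrib[of cadj] if_distrib[of "\<lambda>x. _ ** x"] if_distrib[of "\<lambda>x. x ** _"] cong: if_cong)
  have D0: "D 0 (i + j) = sp (app_bop (a ^ i) C0) (app_bop (a ^ j) C0)" for i j
    by (simp add: D_def power_add app_bop_simps(1) pow_adj[OF a_adj])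
  have DT: "D 0 k = T k" if k: "k \<le> n" for k
  proof (cases "k \<le> 2 * m")
    case True
    \<comment> \<open>Both parts are at most \<open>m\<close>, within reach of the shift
      rule.\<close>
    define i j where "i = min k m" and "j = k - min k m"
    have ij: "k = i + j" "i < M" "j < M" using True by (auto simp: i_def j_def M_def)
    show ?thesis
      unfolding ij(1) D0 a_pow[OF ij(2)] a_pow[OF ij(3)] sp_def form_one[OF ij(2,3)] by (simp add: hk_def)
  next
    case False
    \<comment> \<open>The top order needs one factor \<open>a\<close> beyond the shift rule;
      \<open>sp_a\<close> absorbs it into the array \<open>hk T 1\<close>.\<close>
    then have km: "k = m + Suc m" using k n by simp
    have mM: "m < M" by (simp add: M_def)
    show ?thesis
      unfolding km D0 power_Suc app_bop_simps(1) a_pow[OF mM] sp_a form_one[OF mM mM] by (simp add: hk_def)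
  qed
  have "D 0 0 = mat 1" using DT[of 0] T by simp
  from completely_monotone_atomic[of D, OF this diffD psdD] have "(\<lambda>k\<in>{1..n}. D 0 k) \<in> atomic_moments n" .
  also have "(\<lambda>k\<in>{1..n}. D 0 k) = (\<lambda>k\<in>{1..n}. S k)" using DT TS by (intro restrict_ext) simp
  finally show ?thesis .
qed

text \<open>The midpoint is half the range away from both bounds.\<close>

lemma posS_extend:
  assumes "posS n S"
  shows "posS (Suc n) (S(Suc n := (1/2) *\<^sub>R (Sminus S (Suc n) + Splus S (Suc n))))" (is "posS _ ?S")
proof -
  have c: "Sminus ?S (Suc n) = Sminus S (Suc n)" "Splus ?S (Suc n) = Splus S (Suc n)"
    by (auto intro!: Sminus_cong Splus_cong)
  have "(1/2) *\<^sub>R (A + B) - A = (1/2) *\<^sub>R (B - A)" "B - (1/2) *\<^sub>R (A + B) = (1/2) *\<^sub>R (B - A)" for A B :: "'a cmat"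
    by (simp_all add: vec_eq_iff field_simps scaleR_conv_of_real[where 'a=complex])
  then show ?thesis
    using assms posS_range(1-3)[OF assms] posS_cong[of n S ?S]
    by (simp add: posS_Suc c pd_scaleR hermitian_scaleR hermitian_add)
qed

lemma atomic_moments_Suc:
  assumes "(\<lambda>k\<in>{1..Suc n}. S k) \<in> atomic_moments (Suc n)"
  shows "(\<lambda>k\<in>{1..n}. S k) \<in> atomic_moments n"
proof -
  obtain d :: nat and x A where A: "\<And>i. i < d \<Longrightarrow> psd (A i)" "\<And>i. i < d \<Longrightarrow> x i \<in> {0..1}" "(\<Sum>i<d. A i) = mat 1"
    "(\<lambda>k\<in>{1..Suc n}. S k) = (\<lambda>k\<in>{1..Suc n}. amom {..<d} x A k)"
    using atomic_momentsE[OF assms] by metis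
  have "S k = amom {..<d} x A k" if "k \<in> {1..n}" for k
    using fun_cong[OF A(4), of k] that by simp
  then have "(\<lambda>k\<in>{1..n}. S k) = (\<lambda>k\<in>{1..n}. amom {..<d} x A k)" by (intro restrict_ext)
  then show ?thesis using A(1-3) by (simp only:) (rule atomic_momentsI, auto)
qed

lemma posS_atomic:
  assumes pos: "posS n S"
  shows "(\<lambda>k\<in>{1..n}. S k) \<in> atomic_moments n"
proof (cases "even n")
  case True
  then obtain m where m: "Suc n = 2 * m + 1" by auto
  define S' where "S' = S(Suc n := (1/2) *\<^sub>R (Sminus S (Suc n) + Splus S (Suc n)))"
  have "(\<lambda>k\<in>{1..Suc n}. S' k) \<in> atomic_moments (Suc n)"
    unfolding S'_def by (rule posS_odd_atomic[OF m posS_extend[OF pos]])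
  then have "(\<lambda>k\<in>{1..n}. S' k) \<in> atomic_moments n" by (rule atomic_moments_Suc)
  also have "(\<lambda>k\<in>{1..n}. S' k) = (\<lambda>k\<in>{1..n}. S k)" by (intro restrict_ext) (simp add: S'_def)
  finally show ?thesis .
next
  case False
  then obtain m where "n = 2 * m + 1" by (auto elim: oddE)
  then show ?thesis by (rule posS_odd_atomic[OF _ pos])
qed

text \<open>The Hankel forms of an atomic measure are sums of congruences of its masses with weights
  x^a or x^a (1 - x), nonnegative on [0, 1], and positivity passes to the last Schur complement.
  Strict positivity up to order \<open>k\<close> makes the leading blocks invertible.\<close>

lemma atomic_psd:
  fixes S :: "nat \<Rightarrow> 'p::finite cmat"
  assumes S: "S \<in> atomic_moments n" and k: "k < n" and pos: "posS k S"
  shows "hermitian (S (Suc k))" "psd (S (Suc k) - Sminus S (Suc k))" "psd (Splus S (Suc k) - S (Suc k))"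
proof -
  obtain d :: nat and x A where A: "\<And>i. i < d \<Longrightarrow> psd (A i)" "\<And>i. i < d \<Longrightarrow> x i \<in> {0..1}" "(\<Sum>i<d. A i) = mat 1"
    "S = (\<lambda>k\<in>{1..n}. amom {..<d} x A k)"
    using atomic_momentsE[OF S] by metis
  define T where "T = amom {..<d} x A"
  have T0: "T 0 = mat 1" by (simp add: T_def amom_def A(3))
  then have Sx: "Sx T = T" by (auto simp: Sx_def)
  have hT: "hermitian (T j)" for j
  proof (rule psdD(1))
    show "psd (T j)" unfolding T_def amom_def using A(1,2) by (intro psd_sum psd_scaleR) auto
  qed
  have herm: "hermitian (Sx T j)" for j by (simp add: Sx hT)
  have ST: "S j = T j" if "1 \<le> j" "j \<le> n" for j using that by (simp add: A(4) T_def)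
  have "posS k T" using pos posS_cong[of k S T] ST k by simp
  then have LR: "\<forall>j\<in>{1..k}. pd (Lk T j) \<and> pd (Rk T j)" unfolding posS_Lk_Rk[OF herm] Sx .
  note inv = is_blockinv_Lk_Rk[OF T0 LR]
  have cong: "Sminus S (Suc k) = Sminus T (Suc k)" "Splus S (Suc k) = Splus T (Suc k)" "S (Suc k) = T (Suc k)"
    using ST k by (auto intro!: Sminus_cong Splus_cong)
  have eq: "S (Suc k) - Sminus S (Suc k) = Lk T (Suc k)" "Splus S (Suc k) - S (Suc k) = Rk T (Suc k)"
    using moment_minus_Sminus[OF herm, of "Suc k"] Splus_minus_moment[OF herm, of "Suc k"] by (simp_all add: cong Sx)
  have form: "(\<Sum>i<N. \<Sum>j<N. cadj (y i) ** (\<Sum>l<d. (g l * x l ^ (i + j)) *\<^sub>R A l) ** y j) =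
      (\<Sum>l<d. g l *\<^sub>R (cadj (\<Sum>i<N. x l ^ i *\<^sub>R y i) ** A l ** (\<Sum>i<N. x l ^ i *\<^sub>R y i)))" for N y g
  proof -
    have "(\<Sum>i<N. \<Sum>j<N. cadj (y i) ** (\<Sum>l<d. (g l * x l ^ (i + j)) *\<^sub>R A l) ** y j) =
        (\<Sum>i<N. \<Sum>j<N. \<Sum>l<d. (g l * x l ^ (i + j)) *\<^sub>R (cadj (y i) ** A l ** y j))"
      by (simp add: matrix_mult_sum_right matrix_mult_sum_left matrix_mult_scaleR_left matrix_mult_scaleR_right)
    also have "\<dots> = (\<Sum>l<d. \<Sum>i<N. \<Sum>j<N. (g l * x l ^ (i + j)) *\<^sub>R (cadj (y i) ** A l ** y j))"
      by (subst sum.swap[of _ "{..<d}" "{..<N}"]) (intro sum.cong refl sum.swap)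
    also have "\<dots> = (\<Sum>l<d. g l *\<^sub>R (cadj (\<Sum>i<N. x l ^ i *\<^sub>R y i) ** A l ** (\<Sum>i<N. x l ^ i *\<^sub>R y i)))"
      by (intro sum.cong refl) (simp add: cadj_sum cadj_scaleR matrix_mult_sum_left matrix_mult_sum_right
        matrix_mult_scaleR_left matrix_mult_scaleR_right scaleR_sum_right power_add mult_ac, subst sum.swap, simp add: mult_ac)
    finally show ?thesis .
  qed
  have psd_form: "psd (\<Sum>i<N. \<Sum>j<N. cadj (y i) ** (\<Sum>l<d. (g l * x l ^ (i + j)) *\<^sub>R A l) ** y j)"
    if "\<And>l. l < d \<Longrightarrow> 0 \<le> g l" for N y g
    unfolding form using that A(1) psd_congr[of _ "cadj _"] by (intro psd_sum psd_scaleR) auto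
  have "psd (block_form N (hk T a) y)" for N a y
  proof -
    have "hk T a i j = (\<Sum>l<d. (x l ^ a * x l ^ (i + j)) *\<^sub>R A l)" for i j
      by (simp add: hk_def T_def amom_def power_add mult_ac)
    then show ?thesis using psd_form[of "\<lambda>l. x l ^ a" y N] A(2) by (simp add: block_form_def)
  qed
  moreover have "psd (block_form N (hd' T a) y)" for N a y
  proof -
    have "hd' T a i j = (\<Sum>l<d. ((x l ^ a * (1 - x l)) * x l ^ (i + j)) *\<^sub>R A l)" for i j
    proof -
      have "x l ^ a * (1 - x l) * x l ^ (i + j) = x l ^ (i + j + a) - x l ^ (i + j + a + 1)" for l
        by (simp add: power_add algebra_simps)
      then show ?thesis
        by (simp only: hd'_def T_def amom_def sum_subtractf[symmetric] scaleR_diff_left[symmetric])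
    qed
    then show ?thesis using psd_form[of "\<lambda>l. x l ^ a * (1 - x l)" y N] A(2) by (simp add: block_form_def)
  qed
  ultimately show "psd (S (Suc k) - Sminus S (Suc k))" "psd (Splus S (Suc k) - S (Suc k))"
    unfolding eq Lk_def Rk_def diff_Suc_1 using inv
    by (auto intro!: psd_schur herm_arr_hk herm_arr_hd' hT)
  show "hermitian (S (Suc k))" using hT by (simp add: cong)
qed

subsection \<open>Measurability of the canonical moments\<close>

text \<open>Compactness gives a convergent subsequence of witnesses.\<close>

lemma closed_projection_sequential:
  fixes Q :: "'a::metric_space \<Rightarrow> 'b::metric_space \<Rightarrow> bool"
  assumes cl: "closed {z. Q (fst z) (snd z)}" and K: "compact K"
  shows "closed {x. \<exists>y\<in>K. Q x y}"
proof (unfold closed_sequential_limits, intro allI impI)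
  fix X x assume "(\<forall>n. X n \<in> {x. \<exists>y\<in>K. Q x y}) \<and> X \<longlonglongrightarrow> x"
  then have "\<forall>n. \<exists>y. y \<in> K \<and> Q (X n) y" and lim: "X \<longlonglongrightarrow> x" by auto
  then obtain Y where Y: "\<forall>n. Y n \<in> K \<and> Q (X n) (Y n)" using choice by meson
  then obtain y r where y: "y \<in> K" "strict_mono (r :: nat \<Rightarrow> nat)" "(Y \<circ> r) \<longlonglongrightarrow> y"
    using K unfolding compact_def by blast
  have lim': "(\<lambda>n. (X (r n), Y (r n))) \<longlonglongrightarrow> (x, y)"
    using LIMSEQ_subseq_LIMSEQ[OF lim y(2)] y(3) by (intro tendsto_Pair) (simp_all add: o_def)
  have "(X (r n), Y (r n)) \<in> {z. Q (fst z) (snd z)}" for n using Y by simp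
  then have "(x, y) \<in> {z. Q (fst z) (snd z)}" by (rule closed_sequentially[OF cl _ lim'])
  then show "x \<in> {x. \<exists>y\<in>K. Q x y}" using y(1) by auto
qed

text \<open>A function defined by unique choice from a closed relation is Borel, including its junk value.\<close>

lemma borel_measurable_unique_choice:
  fixes Q :: "'a::metric_space \<Rightarrow> 'b::metric_space \<Rightarrow> bool"
  assumes cl: "closed {z. Q (fst z) (snd z)}" and K: "\<And>n::nat. compact (K n)"
    and cover: "\<And>x y. Q x y \<Longrightarrow> \<exists>n. y \<in> K n"
    and f: "\<And>x y. Q x y \<Longrightarrow> f x = y" "\<And>x. \<nexists>y. Q x y \<Longrightarrow> f x = c"
  shows "f \<in> borel_measurable borel"
proof (rule borel_measurableI)
  have closed_vimage: "f -` C \<in> sets borel" if C: "closed C" for C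
  proof -
    have sets: "{x. \<exists>y\<in>K n \<inter> D. Q x y} \<in> sets borel" if "closed D" for n D
      by (intro borel_closed closed_projection_sequential cl compact_Int_closed K that)
    \<comment> \<open>Points whose value lies in \<open>C\<close>, reached through countably many
      compact sets, and, if the default lies in \<open>C\<close>, all points without a
      value.\<close>
    have "f -` C = (\<Union>n. {x. \<exists>y\<in>K n \<inter> C. Q x y}) \<union> (if c \<in> C then - (\<Union>n. {x. \<exists>y\<in>K n \<inter> UNIV. Q x y}) else {})"
      (is "_ = ?R")
    proof (intro set_eqI)
      fix x show "x \<in> f -` C \<longleftrightarrow> x \<in> ?R"
      proof (cases "\<exists>y. Q x y")
        case True
        then obtain y where y: "Q x y" by blast
        have "y' = y" if "Q x y'" for y' using f(1)[OF y] f(1)[OF that] by simp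
        then have D: "(\<exists>n. \<exists>y'\<in>K n \<inter> D. Q x y') \<longleftrightarrow> y \<in> D" for D
          using y cover[OF y] by (metis IntD2 IntI)
        have 1: "x \<in> (\<Union>n. {x. \<exists>y\<in>K n \<inter> C. Q x y}) \<longleftrightarrow> y \<in> C" using D[of C] by simp
        have 2: "x \<in> (\<Union>n. {x. \<exists>y\<in>K n \<inter> UNIV. Q x y})" using D[of UNIV] by simp
        have 3: "x \<in> f -` C \<longleftrightarrow> y \<in> C" using f(1)[OF y] by simp
        show ?thesis
          by (cases "c \<in> C") (simp_all only: 1 2 3 Un_iff Compl_iff if_True if_False empty_iff simp_thms)
      next
        case False then show ?thesis using f(2)[OF False] by auto
      qed
    qed
    moreover have "?R \<in> sets borel"
      using sets[OF C] sets[OF closed_UNIV] by (auto intro!: sets.Un sets.countable_UN borel_comp)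
    ultimately show ?thesis by simp
  qed
  fix S :: "'b set" assume "open S"
  then have "f -` (- S) \<in> sets borel" by (intro closed_vimage closed_Compl)
  then have "- (f -` (- S)) \<in> sets borel" by (rule borel_comp)
  moreover have "- (f -` (- S)) = f -` S \<inter> space borel" by auto
  ultimately show "f -` S \<inter> space borel \<in> sets borel" by simp
qed

lemma cball_cover: "\<exists>n::nat. (y :: 'a::real_normed_vector) \<in> cball 0 (real n)"
  using real_arch_simple[of "norm y"] by auto

text \<open>\<open>The (\<lambda>_. False)\<close> is the value where no positive root exists, since
  the predicate under \<open>THE\<close> is then empty.\<close>

lemma measurable_msqrt: "(msqrt :: 'p::finite cmat \<Rightarrow> 'p cmat) \<in> borel_measurable borel"
proof (rule borel_measurable_unique_choice[where Q="\<lambda>A R. psd R \<and> R ** R = A" and K="\<lambda>n. cball 0 (real n)" and c="The (\<lambda>_. False)"])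
  have "closed (snd -` {R :: 'p cmat. psd R} :: ('p cmat \<times> 'p cmat) set)"
    by (intro continuous_closed_vimage closed_psd) (auto intro: continuous_intros)
  moreover have "closed {z :: 'p cmat \<times> 'p cmat. snd z ** snd z = fst z}"
    by (intro closed_Collect_eq continuous_intros)
  ultimately have "closed (snd -` {R. psd R} \<inter> {z :: 'p cmat \<times> 'p cmat. snd z ** snd z = fst z})"
    by (rule closed_Int)
  then show "closed {z :: 'p cmat \<times> 'p cmat. psd (snd z) \<and> snd z ** snd z = fst z}"
    by (simp add: vimage_def Collect_conj_eq)
  show "msqrt A = R" if "psd R \<and> R ** R = A" for A R :: "'p cmat"
    unfolding msqrt_def by (rule the_equality) (use that psd_sqrt_unique in auto)
  show "msqrt A = The (\<lambda>_. False)" if "\<nexists>R. psd R \<and> R ** R = A" for A :: "'p cmat"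
    using that unfolding msqrt_def by (intro arg_cong[where f=The]) auto
qed (rule compact_cball cball_cover)+

lemma measurable_matrix_inv: "(matrix_inv :: 'p::finite cmat \<Rightarrow> 'p cmat) \<in> borel_measurable borel"
proof (rule borel_measurable_unique_choice[where Q="\<lambda>A B. A ** B = mat 1 \<and> B ** A = mat 1" and K="\<lambda>n. cball 0 (real n)" and c="Eps (\<lambda>_. False)"])
  show "closed {z :: 'p cmat \<times> 'p cmat. fst z ** snd z = mat 1 \<and> snd z ** fst z = mat 1}"
    by (intro closed_Collect_conj closed_Collect_eq continuous_intros)
  show "matrix_inv A = B" if AB: "A ** B = mat 1 \<and> B ** A = mat 1" for A B :: "'p cmat"
    unfolding matrix_inv_def
  proof (rule some_equality)
    fix B' assume "A ** B' = mat 1 \<and> B' ** A = mat 1"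
    then show "B' = B" using AB by (metis matrix_mul_assoc matrix_mul_lid matrix_mul_rid)
  qed (rule AB)
  show "matrix_inv A = Eps (\<lambda>_. False)" if "\<nexists>B. A ** B = mat 1 \<and> B ** A = mat 1" for A :: "'p cmat"
    using that unfolding matrix_inv_def by (intro arg_cong[where f=Eps]) auto
qed (rule compact_cball cball_cover)+

lemma continuous_array_nth:
  "continuous_on UNIV (\<lambda>K :: nat \<Rightarrow> nat \<Rightarrow> 'a::topological_space. K i j)"
  using continuous_on_product_then_coordinatewise[OF continuous_on_product_coordinates[of i], of j] by simp

lemma continuous_fst_nth: "continuous_on UNIV (\<lambda>z :: (nat \<Rightarrow> nat \<Rightarrow> 'a::topological_space) \<times> 'b::topological_space. fst z i j)"
  and continuous_snd_nth: "continuous_on UNIV (\<lambda>z :: 'b \<times> (nat \<Rightarrow> nat \<Rightarrow> 'a). snd z i j)"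
  by (rule continuous_on_compose2[OF continuous_array_nth], auto intro: continuous_intros)+

text \<open>A block inverse vanishes outside the leading block, so it is bounded and lies in one of
  countably many compact products of balls.\<close>

lemma measurable_blockinv:
  "(blockinv m :: (nat \<Rightarrow> nat \<Rightarrow> 'p::finite cmat) \<Rightarrow> _) \<in> borel_measurable borel"
proof (rule borel_measurable_unique_choice[where Q="is_blockinv m" and c="The (\<lambda>_. False)"
      and K="\<lambda>n. {B. \<forall>i. B i \<in> {b. \<forall>j. b j \<in> cball 0 (real n)}}"])
  show "closed {z :: (nat \<Rightarrow> nat \<Rightarrow> 'p cmat) \<times> (nat \<Rightarrow> nat \<Rightarrow> 'p cmat). is_blockinv m (fst z) (snd z)}"
    unfolding is_blockinv_def blockmult_def
    by (intro closed_Collect_conj closed_Collect_all closed_Collect_imp open_Collect_const closed_Collect_eq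
        continuous_intros continuous_fst_nth continuous_snd_nth)
  show "compact {B :: nat \<Rightarrow> nat \<Rightarrow> 'p cmat. \<forall>i. B i \<in> {b. \<forall>j. b j \<in> cball 0 (real n)}}" for n
    by (intro compact_functions compact_cball)
  show "\<exists>n. B \<in> {B. \<forall>i. B i \<in> {b. \<forall>j. b j \<in> cball 0 (real n)}}" if B: "is_blockinv m K B" for K B :: "nat \<Rightarrow> nat \<Rightarrow> 'p cmat"
  proof -
    obtain n where n: "(\<Sum>i<m. \<Sum>j<m. norm (B i j)) \<le> real n" using real_arch_simple by blast
    have "norm (B i j) \<le> real n" for i j
    proof (cases "i < m \<and> j < m")
      case True
      then have "norm (B i j) \<le> (\<Sum>j<m. norm (B i j))" by (intro member_le_sum) auto
      also have "\<dots> \<le> (\<Sum>i<m. \<Sum>j<m. norm (B i j))"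
        using True by (intro member_le_sum[of i "{..<m}" "\<lambda>i. \<Sum>j<m. norm (B i j)"]) (auto intro: sum_nonneg)
      finally show ?thesis using n by simp
    next
      case False
      then have "B i j = 0" using B by (auto simp: is_blockinv_def not_less)
      then show ?thesis by simp
    qed
    then show ?thesis by auto
  qed
  show "blockinv m K = B" if "is_blockinv m K B" for K B :: "nat \<Rightarrow> nat \<Rightarrow> 'p cmat"
    by (rule blockinv_eqI[OF that])
  show "blockinv m K = The (\<lambda>_. False)" if "\<nexists>B. is_blockinv m K B" for K :: "nat \<Rightarrow> nat \<Rightarrow> 'p cmat"
    using that unfolding blockinv_def is_blockinv_def[symmetric] by (intro arg_cong[where f=The]) auto
qed

lemma borel_measurable_matrix_mult [measurable (raw)]:
  fixes f g :: "'a \<Rightarrow> 'p::finite cmat"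
  assumes "f \<in> borel_measurable M" "g \<in> borel_measurable M"
  shows "(\<lambda>x. f x ** g x) \<in> borel_measurable M"
  by (rule borel_measurable_continuous_Pair[OF assms]) (intro continuous_intros)

lemma borel_measurable_cadj [measurable (raw)]:
  fixes f :: "'a \<Rightarrow> 'p::finite cmat"
  assumes "f \<in> borel_measurable M"
  shows "(\<lambda>x. cadj (f x)) \<in> borel_measurable M"
  by (rule borel_measurable_continuous_on[OF _ assms]) (intro continuous_intros)

abbreviation momM :: "nat \<Rightarrow> (nat \<Rightarrow> 'p::{finite,linorder} cmat) measure" where
  "momM n \<equiv> Pi\<^sub>M {1..n} (\<lambda>_. lebH)"

text \<open>Indices outside the product give the constant \<open>undefined\<close>; the infinite
  Hankel arrays do reach them.\<close>

lemma measurable_moment [measurable]: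
  "(\<lambda>S. S j) \<in> borel_measurable (momM n :: (nat \<Rightarrow> 'p::{finite,linorder} cmat) measure)"
proof (cases "j \<in> {1..n}")
  case True
  then have "(\<lambda>S. S j) \<in> measurable (momM n) lebH" by (rule measurable_component_singleton)
  then show ?thesis by (simp add: measurable_def)
next
  case False
  have "(\<lambda>S. S j) \<in> borel_measurable (momM n :: (nat \<Rightarrow> 'p cmat) measure) \<longleftrightarrow>
      (\<lambda>_. undefined :: 'p cmat) \<in> borel_measurable (momM n :: (nat \<Rightarrow> 'p cmat) measure)"
  proof (rule measurable_cong)
    show "S j = undefined" if "S \<in> space (momM n)" for S :: "nat \<Rightarrow> 'p cmat"
      using that False by (auto simp: space_PiM PiE_def extensional_def)
  qed
  then show ?thesis by (simp only: measurable_const space_borel UNIV_I)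
qed

lemma measurable_Sx [measurable]:
  "(\<lambda>S. Sx S j) \<in> borel_measurable (momM n :: (nat \<Rightarrow> 'p::{finite,linorder} cmat) measure)"
proof (cases "j = 0")
  case False
  then have "(\<lambda>S. Sx S j) = (\<lambda>S :: nat \<Rightarrow> 'p cmat. S j)" by (simp add: Sx_def fun_eq_iff)
  then show ?thesis by (simp only: measurable_moment)
qed (simp add: Sx_def)

lemma measurable_Hankel_inverse [measurable]:
  "(\<lambda>S. blockinv m (Hlow S j) r s) \<in> borel_measurable (momM n)"
  "(\<lambda>S. blockinv m (Hup S j) r s) \<in> borel_measurable (momM n)"
proof -
  have 1: "(\<lambda>S. Hlow S j) \<in> borel_measurable (momM n)" "(\<lambda>S. Hup S j) \<in> borel_measurable (momM n)"
    unfolding Hlow_def[abs_def] Hup_def[abs_def]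
    by (intro measurable_coordinatewise_then_product; measurable)+
  have 2: "(\<lambda>S. blockinv m (Hlow S j)) \<in> borel_measurable (momM n)"
    "(\<lambda>S. blockinv m (Hup S j)) \<in> borel_measurable (momM n)"
    by (rule measurable_compose[OF 1(1) measurable_blockinv], rule measurable_compose[OF 1(2) measurable_blockinv])
  show "(\<lambda>S. blockinv m (Hlow S j) r s) \<in> borel_measurable (momM n)"
    by (rule measurable_product_then_coordinatewise[OF measurable_product_then_coordinatewise[OF 2(1)]])
  show "(\<lambda>S. blockinv m (Hup S j) r s) \<in> borel_measurable (momM n)"
    by (rule measurable_product_then_coordinatewise[OF measurable_product_then_coordinatewise[OF 2(2)]])
qed

lemma measurable_hlow [measurable]: "(\<lambda>S. hlow S j i) \<in> borel_measurable (momM n)"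
  and measurable_hup [measurable]: "(\<lambda>S. hup S j i) \<in> borel_measurable (momM n)"
  unfolding hlow_def hup_def by measurable

lemma measurable_Sminus [measurable]: "(\<lambda>S. Sminus S k) \<in> borel_measurable (momM n)"
  unfolding Sminus_def Let_def by (cases "k \<le> 1") (simp_all only: if_True if_False, measurable)

lemma measurable_Splus [measurable]: "(\<lambda>S. Splus S k) \<in> borel_measurable (momM n)"
  unfolding Splus_def Let_def by (cases "k \<le> 1") (simp_all only: if_True if_False, measurable)

lemma measurable_canon_moment [measurable]: "(\<lambda>S. canon_moment S k) \<in> borel_measurable (momM n)"
proof -
  have [measurable]: "(\<lambda>S. matrix_inv (msqrt (Splus S k - Sminus S k))) \<in> borel_measurable (momM n)"
    by (intro measurable_compose[OF _ measurable_matrix_inv] measurable_compose[OF _ measurable_msqrt]) measurable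
  show ?thesis unfolding canon_moment_def Let_def by measurable
qed

lemma measurable_posS [measurable]: "Measurable.pred (momM n) (posS k)"
  unfolding posS_def[abs_def] by measurable

lemma moment_space_eq_atomic: "moment_space n = atomic_moments n"
  using moment_space_subset_atomic atomic_subset_moment_space by blast

lemma moment_space_measurable: "moment_space n \<in> sets (momM n)"
proof -
  have id: "(\<lambda>S. S) \<in> borel_measurable (momM n)"
    by (rule measurable_coordinatewise_then_product) measurable
  have "closed (atomic_moments n :: (nat \<Rightarrow> 'a cmat) set)"
    by (rule compact_imp_closed[OF compact_atomic_moments])
  then have "(\<lambda>S. S) -` atomic_moments n \<inter> space (momM n) \<in> sets (momM n :: (nat \<Rightarrow> 'a cmat) measure)"
    by (intro measurable_sets[OF id] borel_closed)
  moreover have "(\<lambda>S. S) -` atomic_moments n \<inter> space (momM n) = (moment_space n :: (nat \<Rightarrow> 'a cmat) set)"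
    unfolding moment_space_eq_atomic[symmetric] by (auto simp: moment_space_def space_PiM)
  ultimately show ?thesis by simp
qed

subsection \<open>The law of the canonical moments\<close>

definition beta_weight :: "nat \<Rightarrow> 'p::finite cmat \<Rightarrow> ennreal" where
  "beta_weight s U = pd_det_pow s U * pd_det_pow s (mat 1 - U)"

lemma measurable_beta_weight [measurable]: "(beta_weight s :: 'p::finite cmat \<Rightarrow> ennreal) \<in> borel_measurable borel"
  unfolding beta_weight_def[abs_def] by measurable

text \<open>The factor from the determinant of one range to that of the next.\<close>

definition det_weight :: "'p::finite cmat \<Rightarrow> real" where
  "det_weight U = Re (det U) * Re (det (mat 1 - U))"

lemma measurable_det_weight [measurable]: "(det_weight :: 'p::finite cmat \<Rightarrow> real) \<in> borel_measurable borel"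
  unfolding det_weight_def[abs_def] by measurable

lemma beta_weight_add: "ennreal (det_weight U ^ t) * beta_weight s U = beta_weight (s + t) U"
proof (cases "pd U \<and> pd (mat 1 - U)")
  case True
  then show ?thesis
    using det_pd(2)[of U] det_pd(2)[of "mat 1 - U"]
    by (simp add: beta_weight_def pd_det_pow_def det_weight_def power_mult_distrib power_add ennreal_mult[symmetric] mult_ac)
qed (auto simp: beta_weight_def pd_det_pow_def)

lemma canon_moment_congr:
  fixes S :: "nat \<Rightarrow> 'p::{finite,linorder} cmat"
  assumes D: "pd (Splus S k - Sminus S k)"
  defines "R \<equiv> msqrt (Splus S k - Sminus S k)"
  shows "pd R" "R ** R = Splus S k - Sminus S k" "R ** canon_moment S k ** R = S k - Sminus S k"
    "R ** (mat 1 - canon_moment S k) ** R = Splus S k - S k"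
    "R ** U ** R = S k - Sminus S k \<Longrightarrow> canon_moment S k = U"
proof -
  show R: "pd R" "R ** R = Splus S k - Sminus S k" unfolding R_def by (rule msqrt[OF D])+
  obtain B where B: "R ** B = mat 1" "B ** R = mat 1" using pd_imp_inverse[OF R(1)] by metis
  have "R ** matrix_inv R = mat 1 \<and> matrix_inv R ** R = mat 1"
    unfolding matrix_inv_def by (rule someI[of _ B]) (simp add: B)
  then have inv: "R ** matrix_inv R = mat 1" "matrix_inv R ** R = mat 1" by simp_all
  have can: "canon_moment S k = matrix_inv R ** (S k - Sminus S k) ** matrix_inv R"
    by (simp add: canon_moment_def R_def Let_def)
  have "R ** canon_moment S k ** R = (R ** matrix_inv R) ** (S k - Sminus S k) ** (matrix_inv R ** R)"
    unfolding can by (simp only: matrix_mul_assoc)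
  then show c: "R ** canon_moment S k ** R = S k - Sminus S k" by (simp add: inv)
  show "R ** (mat 1 - canon_moment S k) ** R = Splus S k - S k"
    by (simp add: matrix_mult_diff_left matrix_mult_diff_right c R(2))
  show "canon_moment S k = U" if "R ** U ** R = S k - Sminus S k"
  proof -
    have "canon_moment S k = (matrix_inv R ** R) ** U ** (R ** matrix_inv R)"
      unfolding can that[symmetric] by (simp only: matrix_mul_assoc)
    then show ?thesis by (simp add: inv)
  qed
qed

lemma det_range_prod:
  fixes S :: "nat \<Rightarrow> 'p::{finite,linorder} cmat"
  assumes "posS n S"
  shows "Re (det (Splus S (Suc n) - Sminus S (Suc n))) = (\<Prod>k\<in>{1..n}. det_weight (canon_moment S k))"
  using assms
proof (induction n)
  case 0
  then show ?case using posS_range(4)[OF 0] by simp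
next
  case (Suc n)
  have pos: "posS n S" using Suc.prems by (simp add: posS_Suc)
  define D U R where "D = Splus S (Suc n) - Sminus S (Suc n)" and "U = canon_moment S (Suc n)" and "R = msqrt D"
  have D: "pd D" unfolding D_def by (rule posS_range(3)[OF pos])
  note can = canon_moment_congr[of S "Suc n", folded D_def, OF D, folded R_def U_def]
  have pdU: "pd U" "pd (mat 1 - U)"
  proof -
    obtain B where B: "B ** R = mat 1" using pd_imp_inverse[OF can(1)] by metis
    have "cadj R = R" using pdD(1)[OF can(1)] by (simp add: hermitian_def)
    then show "pd U" "pd (mat 1 - U)"
      using pd_congr_iff[OF B, of U] pd_congr_iff[OF B, of "mat 1 - U"] can(3,4) Suc.prems by (simp_all add: posS_Suc)
  qed
  have r: "det R = complex_of_real (Re (det R))" "0 < Re (det R)" using det_pd[OF can(1)] by simp_all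
  have dD: "Re (det D) = (Re (det R))\<^sup>2"
    using r(1) unfolding can(2)[symmetric] det_mul by (metis Re_complex_of_real of_real_mult power2_eq_square)
  have dc: "Re (det (R ** V ** R)) = Re (det D) * Re (det V)" if V: "pd V" for V
  proof -
    have "det (R ** V ** R) = complex_of_real (Re (det R) * Re (det V) * Re (det R))"
      unfolding det_mul of_real_mult r(1)[symmetric] det_pd(1)[OF V, symmetric] ..
    then show ?thesis by (simp add: dD power2_eq_square)
  qed
  have "Re (det (Splus S (Suc (Suc n)) - Sminus S (Suc (Suc n)))) * Re (det D) =
      (Re (det D) * Re (det U)) * (Re (det D) * Re (det (mat 1 - U)))"
    using posS_range(5)[OF Suc.prems] dc[OF pdU(1)] dc[OF pdU(2)] unfolding D_def[symmetric] can(3,4) by simp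
  also have "\<dots> = (Re (det D) * det_weight U) * Re (det D)" by (simp add: det_weight_def mult_ac)
  finally have "Re (det (Splus S (Suc (Suc n)) - Sminus S (Suc (Suc n)))) = Re (det D) * det_weight U"
    using det_pd(2)[OF D] by simp
  also have "Re (det D) = (\<Prod>k\<in>{1..n}. det_weight (canon_moment S k))" unfolding D_def by (rule Suc.IH[OF pos])
  finally show ?case by (simp add: U_def atLeastAtMostSuc_conv mult.commute)
qed

interpretation lebH_product: product_sigma_finite "\<lambda>_. lebH :: 'p::{finite,linorder} cmat measure"
  by (intro product_sigma_finite.intro sigma_finite_lebH)

lemma canon_moment_cong:
  assumes "\<And>j. 1 \<le> j \<Longrightarrow> j \<le> k \<Longrightarrow> S j = S' j" "1 \<le> k"
  shows "canon_moment S k = canon_moment S' k"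
  using Sminus_cong[of k S S'] Splus_cong[of k S S'] assms by (simp add: canon_moment_def)

lemma pd_between_hermitian: "hermitian C \<Longrightarrow> pd (X - C) \<Longrightarrow> hermitian X"
  using hermitian_add[of "X - C" C] by (simp add: pdD(1))

text \<open>The Jacobian depends on the earlier moments only, and through
  \<open>det_range_prod\<close> only on their canonical moments.\<close>

lemma nn_integral_next_moment:
  fixes S :: "nat \<Rightarrow> 'p::{finite,linorder} cmat"
  assumes pos: "posS n S" and [measurable]: "h \<in> borel_measurable borel"
  shows "(\<integral>\<^sup>+y. indicator {y. posS (Suc n) (S(Suc n := y))} y * h (canon_moment (S(Suc n := y)) (Suc n)) \<partial>lebH) =
    ennreal ((\<Prod>k\<in>{1..n}. det_weight (canon_moment S k)) ^ CARD('p)) * (\<integral>\<^sup>+u. beta_weight 0 u * h u \<partial>lebH)"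
proof -
  define A B D R where "A = Sminus S (Suc n)" and "B = Splus S (Suc n)" and "D = B - A" and "R = msqrt D"
  have herm: "hermitian A" "hermitian B" and D: "pd D"
    unfolding A_def B_def D_def by (rule posS_range[OF pos])+
  have AB: "Sminus (S(Suc n := y)) (Suc n) = A" "Splus (S(Suc n := y)) (Suc n) = B" for y
    unfolding A_def B_def by (auto intro!: Sminus_cong Splus_cong)
  have pos': "posS n (S(Suc n := y))" for y using pos posS_cong[of n S "S(Suc n := y)"] by auto
  have ind: "posS (Suc n) (S(Suc n := y)) \<longleftrightarrow> pd (y - A) \<and> pd (B - y)" for y
    using pos' pd_between_hermitian[OF herm(1), of y] by (auto simp: posS_Suc AB)
  have R: "pd R" "R ** R = D" using msqrt[OF D] by (simp_all add: R_def)
  have can: "canon_moment (S(Suc n := A + R ** u ** R)) (Suc n) = u" for u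
    by (rule canon_moment_congr(5)) (simp_all add: AB D D_def[symmetric] R_def[symmetric])
  \<comment> \<open>An explicit Borel formula for the new canonical moment in terms of the new
    coordinate.\<close>
  define V where "V y = matrix_inv R ** (y - A) ** matrix_inv R" for y
  have canV: "canon_moment (S(Suc n := y)) (Suc n) = V y" for y
    by (simp add: canon_moment_def AB V_def R_def D_def Let_def)
  have [measurable]: "V \<in> borel_measurable borel" unfolding V_def[abs_def] by measurable
  define F where "F y = (if pd (y - A) \<and> pd (B - y) then h (V y) else 0)" for y
  have [measurable]: "F \<in> borel_measurable borel" unfolding F_def[abs_def] by measurable
  have "(\<integral>\<^sup>+y. indicator {y. posS (Suc n) (S(Suc n := y))} y * h (canon_moment (S(Suc n := y)) (Suc n)) \<partial>lebH)
      = (\<integral>\<^sup>+y. F y \<partial>lebH)"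
    by (intro nn_integral_cong) (simp add: F_def ind canV indicator_def)
  also have "\<dots> = (\<integral>\<^sup>+z. F (A + z) \<partial>lebH)" by (rule nn_integral_lebH_shift[symmetric]) (use herm in simp_all)
  also have "\<dots> = ennreal (Re (det D) ^ CARD('p)) * (\<integral>\<^sup>+u. F (A + R ** u ** R) \<partial>lebH)"
    using nn_integral_pd_congr[OF R(1), of "\<lambda>z. F (A + z)"] by (simp add: R(2))
  also have "(\<integral>\<^sup>+u. F (A + R ** u ** R) \<partial>lebH) = (\<integral>\<^sup>+u. beta_weight 0 u * h u \<partial>lebH)"
  proof (rule nn_integral_cong)
    fix u :: "'p cmat"
    obtain C where C: "C ** R = mat 1" using pd_imp_inverse[OF R(1)] by metis
    have cR: "cadj R = R" using pdD(1)[OF R(1)] by (simp add: hermitian_def)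
    have "B - (A + R ** u ** R) = R ** (mat 1 - u) ** R"
      by (simp add: matrix_mult_diff_left matrix_mult_diff_right R(2) D_def algebra_simps)
    then have "pd (A + R ** u ** R - A) \<longleftrightarrow> pd u" "pd (B - (A + R ** u ** R)) \<longleftrightarrow> pd (mat 1 - u)"
      using pd_congr_iff[OF C, of u] pd_congr_iff[OF C, of "mat 1 - u"] by (simp_all add: cR)
    then show "F (A + R ** u ** R) = beta_weight 0 u * h u"
      using can[of u] by (auto simp: F_def canV beta_weight_def pd_det_pow_def)
  qed
  also have "Re (det D) = (\<Prod>k\<in>{1..n}. det_weight (canon_moment S k))"
    unfolding D_def A_def B_def by (rule det_range_prod[OF pos])
  finally show ?thesis .
qed

lemma measurable_canon_moments [measurable]:
  "(\<lambda>S. \<lambda>k\<in>{1..n}. canon_moment S k) \<in> measurable (momM n) (Pi\<^sub>M {1..n} (\<lambda>_. borel))"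
  by (rule measurable_restrict) measurable

text \<open>Integrating out the last moment leaves a Jacobian that is a product over the earlier
  canonical moments; it raises each of their exponents by p, from p(n - k) to p(n + 1 - k).\<close>

lemma nn_integral_canon_moments:
  fixes g :: "(nat \<Rightarrow> 'p::{finite,linorder} cmat) \<Rightarrow> ennreal"
  assumes "g \<in> borel_measurable (momM n)"
  shows "(\<integral>\<^sup>+S. indicator {S. posS n S} S * g (\<lambda>k\<in>{1..n}. canon_moment S k) \<partial>momM n) =
    (\<integral>\<^sup>+U. g U * (\<Prod>k\<in>{1..n}. beta_weight (CARD('p) * (n - k)) (U k)) \<partial>momM n)"
  using assms
proof (induction n arbitrary: g)
  case 0
  then show ?case by (simp add: PiM_empty nn_integral_count_space_finite)
next
  case (Suc n)
  note g [measurable] = Suc.prems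
  let ?I = "{1..n}" and ?p = "CARD('p)"
  have ins: "{1..Suc n} = insert (Suc n) ?I" and nin: "Suc n \<notin> ?I" by (auto simp: atLeastAtMostSuc_conv)
  have can_meas: "(\<lambda>S. \<lambda>k\<in>{1..m}. canon_moment S k) \<in> measurable (momM m) (momM m :: (nat \<Rightarrow> 'p cmat) measure)" for m
    by (rule measurable_restrict) measurable
  \<comment> \<open>The test function for the induction hypothesis: \<open>g\<close> with its last
    argument integrated out, times the Jacobian.\<close>
  define G where "G V = ennreal ((\<Prod>k\<in>?I. det_weight (V k)) ^ ?p) * (\<integral>\<^sup>+u. beta_weight 0 u * g (V(Suc n := u)) \<partial>lebH)" for V
  have upd: "(\<lambda>(V, u). V(Suc n := u)) \<in> measurable (momM n \<Otimes>\<^sub>M lebH) (momM (Suc n) :: (nat \<Rightarrow> 'p cmat) measure)"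
    unfolding ins by (rule measurable_add_dim)
  have g2: "(\<lambda>(V, u). g (V(Suc n := u))) \<in> borel_measurable (momM n \<Otimes>\<^sub>M lebH)"
  proof -
    have "(\<lambda>(V, u). g (V(Suc n := u))) = (\<lambda>x. g ((\<lambda>(V, u). V(Suc n := u)) x))"
      by (rule ext) (simp only: case_prod_beta)
    then show ?thesis using measurable_compose[OF upd g] by (simp only:)
  qed
  have w_meas [measurable]: "(\<lambda>V. det_weight (V k)) \<in> borel_measurable (momM n)" for k
    by (rule measurable_compose[OF measurable_moment measurable_det_weight])
  have G_meas: "G \<in> borel_measurable (momM n)"
  proof -
    have "(\<lambda>(V, u). beta_weight 0 u * g (V(Suc n := u))) \<in> borel_measurable (momM n \<Otimes>\<^sub>M lebH)"
      using g2 by (simp add: case_prod_unfold) measurable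
    then have [measurable]: "(\<lambda>V. \<integral>\<^sup>+u. beta_weight 0 u * g (V(Suc n := u)) \<partial>lebH) \<in> borel_measurable (momM n)"
      by (intro sigma_finite_measure.borel_measurable_nn_integral[OF sigma_finite_lebH]) simp
    show ?thesis unfolding G_def[abs_def] by measurable
  qed
  have F_meas: "(\<lambda>S. indicator {S. posS (Suc n) S} S * g (\<lambda>k\<in>{1..Suc n}. canon_moment S k)) \<in> borel_measurable (momM (Suc n))"
    using measurable_compose[OF can_meas g] by measurable
  have canI: "(\<lambda>k\<in>{1..Suc n}. canon_moment (S(Suc n := y)) k) =
      (\<lambda>k\<in>?I. canon_moment S k)(Suc n := canon_moment (S(Suc n := y)) (Suc n))" for S and y :: "'p cmat"
  proof
    fix k show "(\<lambda>k\<in>{1..Suc n}. canon_moment (S(Suc n := y)) k) k =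
      ((\<lambda>k\<in>?I. canon_moment S k)(Suc n := canon_moment (S(Suc n := y)) (Suc n))) k"
      by (cases "k \<in> ?I") (auto intro: canon_moment_cong)
  qed
  have "(\<integral>\<^sup>+S. indicator {S. posS (Suc n) S} S * g (\<lambda>k\<in>{1..Suc n}. canon_moment S k) \<partial>momM (Suc n)) =
      (\<integral>\<^sup>+S. \<integral>\<^sup>+y. indicator {S. posS (Suc n) S} (S(Suc n := y)) *
        g (\<lambda>k\<in>{1..Suc n}. canon_moment (S(Suc n := y)) k) \<partial>lebH \<partial>momM n)"
    using lebH_product.product_nn_integral_insert[OF _ nin F_meas[unfolded ins]] unfolding ins by simp
  also have "\<dots> = (\<integral>\<^sup>+S. indicator {S. posS n S} S * G (\<lambda>k\<in>?I. canon_moment S k) \<partial>momM n)"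
  proof (rule nn_integral_cong)
    fix S :: "nat \<Rightarrow> 'p cmat" assume S: "S \<in> space (momM n)"
    define V where "V = (\<lambda>k\<in>?I. canon_moment S k)"
    have V: "V \<in> space (momM n)" by (auto simp: V_def space_PiM)
    have h: "(\<lambda>u. g (V(Suc n := u))) \<in> borel_measurable borel"
      using measurable_compose[OF measurable_Pair1'[OF V] g2] by simp
    show "(\<integral>\<^sup>+y. indicator {S. posS (Suc n) S} (S(Suc n := y)) * g (\<lambda>k\<in>{1..Suc n}. canon_moment (S(Suc n := y)) k) \<partial>lebH) =
        indicator {S. posS n S} S * G (\<lambda>k\<in>?I. canon_moment S k)"
    proof (cases "posS n S")
      case True
      have "(\<integral>\<^sup>+y. indicator {S. posS (Suc n) S} (S(Suc n := y)) * g (\<lambda>k\<in>{1..Suc n}. canon_moment (S(Suc n := y)) k) \<partial>lebH)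
        = (\<integral>\<^sup>+y. indicator {y. posS (Suc n) (S(Suc n := y))} y * g (V(Suc n := canon_moment (S(Suc n := y)) (Suc n))) \<partial>lebH)"
        unfolding canI V_def[symmetric] by (intro nn_integral_cong) (simp add: indicator_def)
      also have "\<dots> = ennreal ((\<Prod>k\<in>?I. det_weight (canon_moment S k)) ^ ?p) * (\<integral>\<^sup>+u. beta_weight 0 u * g (V(Suc n := u)) \<partial>lebH)"
        by (rule nn_integral_next_moment[OF True h])
      also have "\<dots> = G V" by (simp add: G_def V_def)
      finally show ?thesis using True by (simp add: V_def)
    next
      case False
      then have "\<not> posS (Suc n) (S(Suc n := y))" for y using posS_cong[of n S "S(Suc n := y)"] by (auto simp: posS_Suc)
      then show ?thesis using False by simp
    qed
  qed
  also have "\<dots> = (\<integral>\<^sup>+V. G V * (\<Prod>k\<in>?I. beta_weight (?p * (n - k)) (V k)) \<partial>momM n)"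
    by (rule Suc.IH[OF G_meas])
  also have "\<dots> = (\<integral>\<^sup>+V. \<integral>\<^sup>+u. g (V(Suc n := u)) * (\<Prod>k\<in>{1..Suc n}. beta_weight (?p * (Suc n - k)) ((V(Suc n := u)) k)) \<partial>lebH \<partial>momM n)"
  proof (rule nn_integral_cong)
    fix V :: "nat \<Rightarrow> 'p cmat" assume V: "V \<in> space (momM n)"
    have h [measurable]: "(\<lambda>u. g (V(Suc n := u))) \<in> borel_measurable borel"
      using measurable_compose[OF measurable_Pair1'[OF V] g2] by simp
    show "G V * (\<Prod>k\<in>?I. beta_weight (?p * (n - k)) (V k)) =
        (\<integral>\<^sup>+u. g (V(Suc n := u)) * (\<Prod>k\<in>{1..Suc n}. beta_weight (?p * (Suc n - k)) ((V(Suc n := u)) k)) \<partial>lebH)"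
    proof (cases "\<forall>k\<in>?I. pd (V k) \<and> pd (mat 1 - V k)")
      case True
      have nn: "0 \<le> det_weight (V k)" if "k \<in> ?I" for k
        using True that det_pd(2)[of "V k"] det_pd(2)[of "mat 1 - V k"] by (simp add: det_weight_def)
      have "ennreal ((\<Prod>k\<in>?I. det_weight (V k)) ^ ?p) * (\<Prod>k\<in>?I. beta_weight (?p * (n - k)) (V k)) =
          (\<Prod>k\<in>?I. ennreal (det_weight (V k) ^ ?p) * beta_weight (?p * (n - k)) (V k))"
      proof -
        have "ennreal ((\<Prod>k\<in>?I. det_weight (V k)) ^ ?p) = (\<Prod>k\<in>?I. ennreal (det_weight (V k) ^ ?p))"
          unfolding prod_power_distrib using nn by (intro prod_ennreal[symmetric]) simp
        then show ?thesis by (simp add: prod.distrib)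
      qed
      also have "\<dots> = (\<Prod>k\<in>?I. beta_weight (?p * (Suc n - k)) (V k))"
        by (intro prod.cong refl) (simp add: beta_weight_add Suc_diff_le add.commute)
      finally have Q: "ennreal ((\<Prod>k\<in>?I. det_weight (V k)) ^ ?p) * (\<Prod>k\<in>?I. beta_weight (?p * (n - k)) (V k)) =
          (\<Prod>k\<in>?I. beta_weight (?p * (Suc n - k)) (V k))" .
      have "G V * (\<Prod>k\<in>?I. beta_weight (?p * (n - k)) (V k)) =
          (\<Prod>k\<in>?I. beta_weight (?p * (Suc n - k)) (V k)) * (\<integral>\<^sup>+u. beta_weight 0 u * g (V(Suc n := u)) \<partial>lebH)"
        unfolding G_def Q[symmetric] by (simp only: mult_ac)
      also have "\<dots> = (\<integral>\<^sup>+u. (\<Prod>k\<in>?I. beta_weight (?p * (Suc n - k)) (V k)) * (beta_weight 0 u * g (V(Suc n := u))) \<partial>lebH)"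
        using borel_measurable_times_ennreal[OF measurable_beta_weight h]
        by (intro nn_integral_cmult[symmetric]) (simp add: measurable_cong_sets[OF sets_lebH refl])
      also have "\<dots> = (\<integral>\<^sup>+u. g (V(Suc n := u)) * (\<Prod>k\<in>{1..Suc n}. beta_weight (?p * (Suc n - k)) ((V(Suc n := u)) k)) \<partial>lebH)"
      proof (rule nn_integral_cong)
        fix u :: "'p cmat"
        have "(\<Prod>k\<in>?I. beta_weight (?p * (Suc n - k)) ((V(Suc n := u)) k)) = (\<Prod>k\<in>?I. beta_weight (?p * (Suc n - k)) (V k))"
          by (intro prod.cong refl) auto
        then show "(\<Prod>k\<in>?I. beta_weight (?p * (Suc n - k)) (V k)) * (beta_weight 0 u * g (V(Suc n := u))) =
          g (V(Suc n := u)) * (\<Prod>k\<in>{1..Suc n}. beta_weight (?p * (Suc n - k)) ((V(Suc n := u)) k))"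
          unfolding ins using nin by (simp add: mult_ac)
      qed
      finally show ?thesis .
    next
      \<comment> \<open>Outside the cones both products vanish, whatever the sign of
        \<open>det_weight\<close>.\<close>
      case False
      then obtain k where k: "k \<in> ?I" "\<And>s. beta_weight s (V k) = 0"
        by (auto simp: beta_weight_def pd_det_pow_def)
      have "(\<Prod>k\<in>?I. beta_weight (?p * (n - k)) (V k)) = 0"
        using k by (intro prod_zero) (auto intro!: bexI[of _ k])
      moreover have "(\<Prod>k\<in>{1..Suc n}. beta_weight (?p * (Suc n - k)) ((V(Suc n := u)) k)) = 0" for u
        using k nin by (intro prod_zero) (auto intro!: bexI[of _ k])
      ultimately show ?thesis by (simp only: mult_zero_right nn_integral_const mult_zero_left)
    qed
  qed
  also have "\<dots> = (\<integral>\<^sup>+U. g U * (\<Prod>k\<in>{1..Suc n}. beta_weight (?p * (Suc n - k)) (U k)) \<partial>momM (Suc n))"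
  proof -
    have "(\<lambda>U. g U * (\<Prod>k\<in>{1..Suc n}. beta_weight (?p * (Suc n - k)) (U k))) \<in> borel_measurable (momM (Suc n))"
      by (intro borel_measurable_times_ennreal g borel_measurable_prod_ennreal measurable_compose[OF measurable_moment measurable_beta_weight])
    from lebH_product.product_nn_integral_insert[OF _ nin this[unfolded ins]] show ?thesis unfolding ins by simp
  qed
  finally show ?case .
qed

section \<open>The boundary of the moment space is negligible\<close>

lemma AE_lebH_translate:
  fixes C :: "'p::{finite,linorder} cmat"
  assumes [measurable]: "Measurable.pred borel P" and AE: "AE X in lebH. P X" and C: "hermitian C"
  shows "AE X in lebH. P (X - C)" "AE X in lebH. P (C - X)"
proof -
  let ?f = "indicator {X. \<not> P X} :: 'p cmat \<Rightarrow> ennreal"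
  have f: "?f \<in> borel_measurable borel" by measurable
  have tr: "(\<lambda>X. - C + X) \<in> borel_measurable borel" "(\<lambda>X. C - X) \<in> borel_measurable borel"
    by (intro borel_measurable_continuous_onI continuous_intros)+
  have "(\<integral>\<^sup>+X. ?f X \<partial>lebH) = 0"
    using AE by (subst AE_iff_nn_integral[symmetric]) simp_all
  then have "(\<integral>\<^sup>+X. ?f (- C + X) \<partial>lebH) = 0" "(\<integral>\<^sup>+X. ?f (C - X) \<partial>lebH) = 0"
    using C hermitian_diff[of 0 C] nn_integral_lebH_shift[of ?f "- C"] nn_integral_lebH_reflect[of ?f C]
    by (simp_all del: nn_integral_indicator)
  moreover have "(\<lambda>X. ?f (- C + X)) \<in> borel_measurable lebH" "(\<lambda>X. ?f (C - X)) \<in> borel_measurable lebH"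
    using measurable_compose[OF tr(1) f] measurable_compose[OF tr(2) f]
    by (simp_all only: measurable_cong_sets[OF sets_lebH refl])
  ultimately have "AE X in lebH. ?f (- C + X) = 0" "AE X in lebH. ?f (C - X) = 0"
    using nn_integral_0_iff_AE by blast+
  then show "AE X in lebH. P (X - C)" "AE X in lebH. P (C - X)"
    by (auto simp: indicator_def split: if_splits)
qed

text \<open>Fubini in the coordinate \<open>Suc k\<close>: the bounds do not depend on it, so in
  each fibre the exceptional set is contained in a translate and a reflection of the null boundary
  of the cone.\<close>

lemma AE_psd_imp_posS:
  assumes k: "k < n"
  shows "AE S in (momM n :: (nat \<Rightarrow> 'p::{finite,linorder} cmat) measure).
    posS k S \<and> psd (S (Suc k) - Sminus S (Suc k)) \<and> psd (Splus S (Suc k) - S (Suc k)) \<longrightarrow> posS (Suc k) S"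
proof -
  define bad :: "(nat \<Rightarrow> 'p cmat) \<Rightarrow> bool" where "bad S \<longleftrightarrow>
    posS k S \<and> psd (S (Suc k) - Sminus S (Suc k)) \<and> psd (Splus S (Suc k) - S (Suc k)) \<and>
    \<not> (pd (S (Suc k) - Sminus S (Suc k)) \<and> pd (Splus S (Suc k) - S (Suc k)))" for S
  let ?I = "{1..n} - {Suc k}"
  have ins: "{1..n} = insert (Suc k) ?I" using k by auto
  have bad_meas [measurable]: "Measurable.pred (momM n) bad" unfolding bad_def[abs_def] by measurable
  have "(\<lambda>S. indicator {S. bad S} S :: ennreal) \<in> borel_measurable (momM n)" by measurable
  then have "(\<integral>\<^sup>+S. indicator {S. bad S} S \<partial>momM n) =
      (\<integral>\<^sup>+S. \<integral>\<^sup>+y. indicator {S. bad S} (S(Suc k := y)) \<partial>lebH \<partial>Pi\<^sub>M ?I (\<lambda>_. lebH))"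
    using lebH_product.product_nn_integral_insert[of ?I "Suc k" "\<lambda>S. indicator {S. bad S} S"]
    unfolding ins[symmetric] by simp
  also have "\<dots> = (\<integral>\<^sup>+S. 0 \<partial>Pi\<^sub>M ?I (\<lambda>_. lebH :: 'p cmat measure))"
  proof (rule nn_integral_cong)
    fix S :: "nat \<Rightarrow> 'p cmat"
    have AB: "Sminus (S(Suc k := y)) (Suc k) = Sminus S (Suc k)" "Splus (S(Suc k := y)) (Suc k) = Splus S (Suc k)" for y
      by (auto intro!: Sminus_cong Splus_cong)
    have pos: "posS k (S(Suc k := y)) \<longleftrightarrow> posS k S" for y by (rule posS_cong) auto
    have "AE y in lebH. \<not> bad (S(Suc k := y))"
    proof (cases "posS k S")
      case True
      have "Measurable.pred borel (\<lambda>X :: 'p cmat. psd X \<longrightarrow> pd X)" by measurable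
      note tr = AE_lebH_translate[OF this AE_psd_imp_pd]
      show ?thesis
        using tr(1)[OF posS_range(1)[OF True]] tr(2)[OF posS_range(2)[OF True]]
        by eventually_elim (auto simp: bad_def AB)
    qed (simp add: bad_def pos)
    then have "(\<integral>\<^sup>+y. indicator {S. bad S} (S(Suc k := y)) \<partial>lebH) = (\<integral>\<^sup>+y. 0 \<partial>(lebH :: 'p cmat measure))"
      by (intro nn_integral_cong_AE) (auto simp: indicator_def)
    then show "(\<integral>\<^sup>+y. indicator {S. bad S} (S(Suc k := y)) \<partial>lebH) = 0" by simp
  qed
  finally have "(\<integral>\<^sup>+S. indicator {S. bad S} S \<partial>momM n) = 0" by simp
  then have "AE S in momM n. indicator {S. bad S} S = (0 :: ennreal)"
    by (subst (asm) nn_integral_0_iff_AE) measurable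
  then have "AE S in momM n. \<not> bad S" by (simp add: indicator_def)
  then show ?thesis
  proof eventually_elim
    case (elim S)
    then show ?case
      using pd_between_hermitian[OF posS_range(1), of k S "S (Suc k)"] by (auto simp: bad_def posS_Suc)
  qed
qed

text \<open>The weak inequalities of order \<open>k + 1\<close> are derived only after those up to
  \<open>k\<close> are strict, since the bounds involve inverses. Hence strictness is obtained
  almost everywhere one order at a time.\<close>

lemma AE_moment_space_iff_posS:
  "AE S in (momM n :: (nat \<Rightarrow> 'p::{finite,linorder} cmat) measure). S \<in> moment_space n \<longleftrightarrow> posS n S"
proof -
  have "AE S in (momM n :: (nat \<Rightarrow> 'p cmat) measure). \<forall>k\<in>{..<n}. posS k S \<and>
      psd (S (Suc k) - Sminus S (Suc k)) \<and> psd (Splus S (Suc k) - S (Suc k)) \<longrightarrow> posS (Suc k) S"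
    by (rule AE_finite_allI) (simp_all add: AE_psd_imp_posS)
  then show ?thesis
    using AE_space
  proof eventually_elim
    case (elim S)
    have ext: "(\<lambda>k\<in>{1..n}. S k) = S" using elim(2) by (simp add: space_PiM)
    have "posS k S" if "S \<in> moment_space n" "k \<le> n" for k
      using that(2)
    proof (induction k)
      case (Suc k)
      then show ?case
        using elim(1) atomic_psd[of S n k] that(1) by (auto simp: moment_space_eq_atomic)
    qed simp
    then show ?case using posS_atomic[of n S] unfolding ext moment_space_eq_atomic by auto
  qed
qed

section \<open>Normalised Beta laws and the distribution of the canonical moments\<close>

lemma nn_integral_beta_weight:
  "(\<integral>\<^sup>+X. beta_weight s X \<partial>(lebH :: 'p::{finite,linorder} cmat measure)) =
    ennreal (mBeta2 CARD('p) (real (s + CARD('p))) (real (s + CARD('p))))"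
  unfolding beta_weight_def by (rule nn_integral_betaH)

lemma beta2_eq_density:
  "(beta2 (real (s + CARD('p))) (real (s + CARD('p))) :: 'p::{finite,linorder} cmat measure) =
    density lebH (\<lambda>X. beta_weight s X * inverse (ennreal (mBeta2 CARD('p) (real (s + CARD('p))) (real (s + CARD('p))))))"
proof -
  define b where "b = mBeta2 CARD('p) (real (s + CARD('p))) (real (s + CARD('p)))"
  have b: "0 < b" unfolding b_def by (rule mBeta2_pos)
  have "ennreal (if loewner_less 0 X \<and> loewner_less X (mat 1)
      then Re (det X) powr (real (s + CARD('p)) - real CARD('p)) * Re (det (mat 1 - X)) powr (real (s + CARD('p)) - real CARD('p)) / b
      else 0) = beta_weight s X * inverse (ennreal b)" for X :: "'p cmat"
  proof (cases "pd X \<and> pd (mat 1 - X)")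
    case True
    then have "loewner_less 0 X" "loewner_less X (mat 1)"
      using pdD(1) by (auto simp: loewner_less_def)
    moreover have "Re (det X) powr real s = Re (det X) ^ s" "Re (det (mat 1 - X)) powr real s = Re (det (mat 1 - X)) ^ s"
      using True by (simp_all add: powr_realpow det_pd(2))
    ultimately show ?thesis
      using True b det_pd(2)[of X] det_pd(2)[of "mat 1 - X"]
      by (simp add: beta_weight_def pd_det_pow_def inverse_ennreal ennreal_mult[symmetric] divide_inverse)
  next
    case False
    then have "\<not> (loewner_less 0 X \<and> loewner_less X (mat 1))" by (auto simp: loewner_less_def)
    moreover have "beta_weight s X = 0" using False by (auto simp: beta_weight_def pd_det_pow_def)
    ultimately show ?thesis by (simp only: if_False ennreal_0 mult_zero_left)
  qed
  then show ?thesis unfolding beta2_def b_def by (simp only:)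
qed

lemma emeasure_beta2:
  assumes [measurable]: "A \<in> sets borel"
  shows "emeasure (beta2 (real (s + CARD('p))) (real (s + CARD('p)))) A =
    (\<integral>\<^sup>+X. indicator A X * beta_weight s X \<partial>(lebH :: 'p::{finite,linorder} cmat measure)) *
    inverse (ennreal (mBeta2 CARD('p) (real (s + CARD('p))) (real (s + CARD('p)))))"
proof -
  have m: "(\<lambda>X. indicator A X * beta_weight s X) \<in> borel_measurable (lebH :: 'p cmat measure)"
    "(\<lambda>X. beta_weight s X * c) \<in> borel_measurable (lebH :: 'p cmat measure)" for c
    unfolding measurable_cong_sets[OF sets_lebH refl] by measurable
  have "emeasure (density lebH (\<lambda>X. beta_weight s X * c)) A =
      (\<integral>\<^sup>+X. indicator A X * beta_weight s X \<partial>(lebH :: 'p cmat measure)) * c" for c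
    using emeasure_density[OF m(2), of A c] nn_integral_multc[OF m(1), of c]
    by (simp add: mult_ac)
  then show ?thesis unfolding beta2_eq_density .
qed

lemma sets_beta2 [simp, measurable_cong]: "sets (beta2 a b) = sets borel"
  by (simp add: beta2_def)

lemma prob_space_beta2:
  "prob_space (beta2 (real (s + CARD('p))) (real (s + CARD('p))) :: 'p::{finite,linorder} cmat measure)"
proof
  have "0 < mBeta2 CARD('p) (real (s + CARD('p))) (real (s + CARD('p)))" by (rule mBeta2_pos)
  moreover have "space (beta2 (real (s + CARD('p))) (real (s + CARD('p))) :: 'p cmat measure) = UNIV"
    by (simp add: beta2_def)
  ultimately show "emeasure (beta2 (real (s + CARD('p))) (real (s + CARD('p))) :: 'p cmat measure)
      (space (beta2 (real (s + CARD('p))) (real (s + CARD('p))))) = 1"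
    by (simp add: emeasure_beta2 nn_integral_beta_weight inverse_ennreal ennreal_mult[symmetric] del: of_nat_add)
qed

text \<open>With every \<open>A k = UNIV\<close> this gives the volume of the moment space; in
  general it is the numerator of the uniform law.\<close>

lemma emeasure_moment_space_canon_rectangle:
  fixes A :: "nat \<Rightarrow> 'p::{finite,linorder} cmat set"
  assumes A: "\<And>k. k \<in> {1..n} \<Longrightarrow> A k \<in> sets borel"
  shows "emeasure (momM n) {S \<in> moment_space n. \<forall>k\<in>{1..n}. canon_moment S k \<in> A k} =
    (\<Prod>k\<in>{1..n}. \<integral>\<^sup>+X. indicator (A k) X * beta_weight (CARD('p) * (n - k)) X \<partial>lebH)"
proof -
  define g where "g U = (\<Prod>k\<in>{1..n}. indicator (A k) (U k) :: ennreal)" for U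
  have g: "g \<in> borel_measurable (momM n)"
    unfolding g_def[abs_def] using A
    by (intro borel_measurable_prod_ennreal measurable_compose[OF measurable_moment] borel_measurable_indicator)
  have gi: "g U = (if \<forall>k\<in>{1..n}. U k \<in> A k then 1 else 0)" for U
  proof (cases "\<forall>k\<in>{1..n}. U k \<in> A k")
    case False
    then have "g U = 0" unfolding g_def by (intro prod_zero) (auto simp: indicator_def)
    then show ?thesis using False by simp
  qed (simp add: g_def)
  have ms: "Measurable.pred (momM n) (\<lambda>S. \<forall>k\<in>{1..n}. canon_moment S k \<in> A k)"
    by (intro pred_intros_finite measurable_compose[OF measurable_canon_moment] pred_sets2[OF A]) simp_all
  have "{S \<in> moment_space n. \<forall>k\<in>{1..n}. canon_moment S k \<in> A k} =
      moment_space n \<inter> {S \<in> space (momM n). \<forall>k\<in>{1..n}. canon_moment S k \<in> A k}"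
    using sets.sets_into_space[OF moment_space_measurable] by fastforce
  then have "{S \<in> moment_space n. \<forall>k\<in>{1..n}. canon_moment S k \<in> A k} \<in> sets (momM n)"
    using sets.Int[OF moment_space_measurable predE[OF ms]] by simp
  then have "emeasure (momM n) {S \<in> moment_space n. \<forall>k\<in>{1..n}. canon_moment S k \<in> A k} =
      (\<integral>\<^sup>+S. indicator {S \<in> moment_space n. \<forall>k\<in>{1..n}. canon_moment S k \<in> A k} S \<partial>momM n)" by simp
  also have "\<dots> = (\<integral>\<^sup>+S. indicator {S. posS n S} S * g (\<lambda>k\<in>{1..n}. canon_moment S k) \<partial>momM n)"
    using AE_moment_space_iff_posS by (intro nn_integral_cong_AE, eventually_elim) (auto simp: gi)
  also have "\<dots> = (\<integral>\<^sup>+U. (\<Prod>k\<in>{1..n}. indicator (A k) (U k) * beta_weight (CARD('p) * (n - k)) (U k)) \<partial>momM n)"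
    unfolding nn_integral_canon_moments[OF g] by (simp add: g_def prod.distrib)
  also have "\<dots> = (\<Prod>k\<in>{1..n}. \<integral>\<^sup>+X. indicator (A k) X * beta_weight (CARD('p) * (n - k)) X \<partial>lebH)"
  proof (rule lebH_product.product_nn_integral_prod)
    fix k assume "k \<in> {1..n}"
    then have [measurable]: "A k \<in> sets borel" by (rule A)
    show "(\<lambda>X. indicator (A k) X * beta_weight (CARD('p) * (n - k)) X) \<in> borel_measurable lebH"
      unfolding measurable_cong_sets[OF sets_lebH refl] by measurable
  qed simp
  finally show ?thesis .
qed

theorem theorem5p1:
  fixes n :: nat
  defines "M \<equiv> PiM {1..n} (\<lambda>_. (lebH :: (complex^('p::{finite,linorder})^('p::{finite,linorder})) measure))"
  shows "moment_space n \<in> sets M \<and> 0 < emeasure M (moment_space n) \<and> emeasure M (moment_space n) < \<infinity> \<and>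
         distr (uniform_measure M (moment_space n)) (PiM {1..n} (\<lambda>_. borel))
               (\<lambda>S. \<lambda>k\<in>{1..n}. canon_moment S k)
         = PiM {1..n} (\<lambda>k. beta2 (real (CARD('p) * (n - k + 1))) (real (CARD('p) * (n - k + 1))))"
proof (intro conjI)
  \<comment> \<open>The exponent of the determinants: the Beta parameter p(n - k + 1) is
    \<open>s k + CARD('p)\<close>.\<close>
  define s where "s k = CARD('p) * (n - k)" for k
  define b where "b k = mBeta2 CARD('p) (real (s k + CARD('p))) (real (s k + CARD('p)))" for k
  define \<beta> :: "nat \<Rightarrow> 'p cmat measure" where "\<beta> k = beta2 (real (s k + CARD('p))) (real (s k + CARD('p)))" for k
  let ?F = "\<lambda>S :: nat \<Rightarrow> 'p cmat. \<lambda>k\<in>{1..n}. canon_moment S k"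
  have b: "0 < b k" for k unfolding b_def by (rule mBeta2_pos)
  have beta: "\<beta> k = beta2 (real (CARD('p) * (n - k + 1))) (real (CARD('p) * (n - k + 1)))" for k
    by (simp add: \<beta>_def s_def add.commute)
  have sets_beta [simp]: "sets (\<beta> k) = sets borel" for k by (simp add: \<beta>_def)
  interpret \<beta>: product_prob_space \<beta>
    unfolding \<beta>_def by (intro product_prob_spaceI prob_space_beta2)
  show ms: "moment_space n \<in> sets M" unfolding M_def by (rule moment_space_measurable)
  have vol: "emeasure M (moment_space n) = ennreal (\<Prod>k\<in>{1..n}. b k)"
    using emeasure_moment_space_canon_rectangle[of n "\<lambda>_. UNIV :: 'p cmat set"] b
    by (simp add: M_def nn_integral_beta_weight s_def[symmetric] b_def[symmetric] prod_ennreal less_imp_le del: of_nat_add)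
  have bpos: "0 < (\<Prod>k\<in>{1..n}. b k)" using b by (simp add: prod_pos)
  then show "0 < emeasure M (moment_space n)" "emeasure M (moment_space n) < \<infinity>" by (simp_all add: vol)
  have F: "?F \<in> measurable (uniform_measure M (moment_space n)) (PiM {1..n} (\<lambda>_. borel))"
    using measurable_canon_moments[of n] by (simp add: M_def cong: measurable_cong_sets)
  have "distr (uniform_measure M (moment_space n)) (PiM {1..n} (\<lambda>_. borel)) ?F = PiM {1..n} \<beta>"
  \<comment> \<open>Rectangles determine the product measure, and on them the volume already splits
    into factors, which is independence.\<close>
  proof (rule \<beta>.PiM_eqI)
    show "sets (distr (uniform_measure M (moment_space n)) (PiM {1..n} (\<lambda>_. borel)) ?F) = sets (PiM {1..n} \<beta>)"
      by (simp cong: sets_PiM_cong)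
    fix A :: "nat \<Rightarrow> 'p cmat set" assume "\<And>k. k \<in> {1..n} \<Longrightarrow> A k \<in> sets (\<beta> k)"
    then have A: "\<And>k. k \<in> {1..n} \<Longrightarrow> A k \<in> sets borel" by simp
    have AP: "Pi\<^sub>E {1..n} A \<in> sets (PiM {1..n} (\<lambda>_. borel))" using A by (intro sets_PiM_I_finite) simp_all
    have int: "moment_space n \<inter> (?F -` Pi\<^sub>E {1..n} A \<inter> space M) =
        {S \<in> moment_space n. \<forall>k\<in>{1..n}. canon_moment S k \<in> A k}"
      using sets.sets_into_space[OF ms] by (auto simp: PiE_iff)
    have "?F -` Pi\<^sub>E {1..n} A \<inter> space M \<in> sets M"
      using measurable_sets[OF F AP] by simp
    then have "emeasure (distr (uniform_measure M (moment_space n)) (PiM {1..n} (\<lambda>_. borel)) ?F) (Pi\<^sub>E {1..n} A)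
        = emeasure M {S \<in> moment_space n. \<forall>k\<in>{1..n}. canon_moment S k \<in> A k} / ennreal (\<Prod>k\<in>{1..n}. b k)"
      unfolding emeasure_distr[OF F AP] space_uniform_measure using ms
      by (subst emeasure_uniform_measure) (simp_all only: int vol)
    also have "\<dots> = (\<Prod>k\<in>{1..n}. \<integral>\<^sup>+X. indicator (A k) X * beta_weight (s k) X \<partial>lebH) * inverse (ennreal (\<Prod>k\<in>{1..n}. b k))"
      using emeasure_moment_space_canon_rectangle[of n A] A unfolding M_def s_def divide_ennreal_def by simp
    also have "inverse (ennreal (\<Prod>k\<in>{1..n}. b k)) = (\<Prod>k\<in>{1..n}. inverse (ennreal (b k)))"
      using b bpos prod_inversef[of b "{1..n}"]
      by (simp add: inverse_ennreal prod_ennreal less_imp_le o_def)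
    also have "(\<Prod>k\<in>{1..n}. \<integral>\<^sup>+X. indicator (A k) X * beta_weight (s k) X \<partial>lebH) * \<dots> = (\<Prod>k\<in>{1..n}. emeasure (\<beta> k) (A k))"
      unfolding prod.distrib[symmetric] using A by (intro prod.cong refl) (simp add: \<beta>_def b_def emeasure_beta2 del: of_nat_add)
    finally show "emeasure (distr (uniform_measure M (moment_space n)) (PiM {1..n} (\<lambda>_. borel)) ?F) (Pi\<^sub>E {1..n} A)
      = (\<Prod>k\<in>{1..n}. emeasure (\<beta> k) (A k))" .
  qed simp
  then show "distr (uniform_measure M (moment_space n)) (PiM {1..n} (\<lambda>_. borel)) ?F
      = PiM {1..n} (\<lambda>k. beta2 (real (CARD('p) * (n - k + 1))) (real (CARD('p) * (n - k + 1))))"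
    unfolding beta[symmetric] .
qed

end
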